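(* Let $0<m\le n$ with $(m,n)\ne(1,1),(1,2)$, and let $\mathcal{E}$ be a Monge equation $$y^{(m)}=F\bigl(x,y,y',\dots,y^{(m-1)},z,z',\dots,z^{(n)}\bigr)$$ with $F_{z^{(n)}z^{(n)}}\ne0$. Then the algebra of internal symmetries of $\mathcal{E}$ coincides with the algebra of external symmetries of $\mathcal{E}$, i.e. those induced on $\mathcal{E}$ by (infinitesimal) Lie transformations of the ambient mixed jet space $J^{m,n}(\mathbb{R},\mathbb{R}^2)$.
   Context: Here $y=y(x)$, $z=z(x)$ and all considerations are local. The mixed jet space $J^{m,n}(\mathbb{R},\mathbb{R}^2)\simeq\mathbb{R}^{m+n+3}$ has coordinates $(x,y=y_0,y_1,\dots,y_m,z=z_0,z_1,\dots,z_n)$ and carries the canonical rank 3 (Cartan) distribution $$\mathcal{C}=\operatorname{Ann}\{dy_i-y_{i+1}\,dx,\ dz_j-z_{j+1}\,dx \mid 0\le i<m,\ 0\le j<n\}.$$ The equation $\mathcal{E}$ is the hypersurface $\{y_m=F(x,y,\dots,y_{m-1},z,\dots,z_n)\}\subset J^{m,n}(\mathbb{R},\mathbb{R}^2)$, and $\Delta=\mathcal{C}\cap T\mathcal{E}$ is the induced rank 2 distribution on $\mathcal{E}$. An internal symmetry of $\mathcal{E}$ is an (infinitesimal) symmetry of the pair $(\mathcal{E},\Delta)$, i.e. a vector field on $\mathcal{E}$ whose flow preserves $\Delta$. A Lie transformation of $J^{m,n}(\mathbb{R},\mathbb{R}^2)$ is a (local) diffeomorphism preserving $\mathcal{C}$;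 an infinitesimal Lie transformation is a vector field whose flow consists of Lie transformations. An external symmetry of $\mathcal{E}$ is an infinitesimal Lie transformation tangent to $\mathcal{E}$, and it induces an internal symmetry by restriction to $\mathcal{E}$. The condition $F_{z^{(n)}z^{(n)}}\neq0$ is required at every point. *)

theory Defs
  imports "HOL-Analysis.Analysis"
begin

subsection \<open>Smooth maps and tangent spaces of subsets of a normed space\<close>

text \<open>\<open>k\<close> times continuously differentiable; only used for open sets \<open>S\<close>.\<close>

fun times_cont_diff_on :: "nat \<Rightarrow> 'a::real_normed_vector set \<Rightarrow> ('a \<Rightarrow> 'b::real_normed_vector) \<Rightarrow> bool" where
  "times_cont_diff_on 0 S f \<longleftrightarrow> continuous_on S f"
| "times_cont_diff_on (Suc k) S f \<longleftrightarrow>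
     (\<forall>x\<in>S. f differentiable (at x)) \<and>
     (\<forall>h. times_cont_diff_on k S (\<lambda>x. frechet_derivative f (at x) h))"

definition smooth_on :: "'a::real_normed_vector set \<Rightarrow> ('a \<Rightarrow> 'b::real_normed_vector) \<Rightarrow> bool" where
  "smooth_on S f \<longleftrightarrow> (\<forall>k. times_cont_diff_on k S f)"

text \<open>Smoothness on an arbitrary subset, such as a hypersurface: locally the restriction
  of a smooth map on an open set.\<close>

definition smooth_map_on :: "'a::real_normed_vector set \<Rightarrow> ('a \<Rightarrow> 'b::real_normed_vector) \<Rightarrow> bool" where
  "smooth_map_on M f \<longleftrightarrow>
     (\<forall>p\<in>M. \<exists>B g. open B \<and> p \<in> B \<and> smooth_on B g \<and> (\<forall>q\<in>M \<inter> B. f q = g q))"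

definition diffeomorphism_on :: "'a::real_normed_vector set \<Rightarrow> 'a set \<Rightarrow> ('a \<Rightarrow> 'a) \<Rightarrow> bool" where
  "diffeomorphism_on A B f \<longleftrightarrow>
     bij_betw f A B \<and> smooth_map_on A f \<and> smooth_map_on B (inv_into A f)"

text \<open>Velocities at \<open>p\<close> of curves in \<open>M\<close>; this is the usual tangent space when \<open>M\<close> is an
  embedded submanifold.\<close>

definition tangent_space :: "'a::real_normed_vector set \<Rightarrow> 'a \<Rightarrow> 'a set" where
  "tangent_space M p =
     {w. \<exists>\<gamma>. \<gamma> (0::real) = p \<and> (\<forall>\<^sub>F t in nhds 0. \<gamma> t \<in> M) \<and> (\<gamma> has_vector_derivative w) (at 0)}"

definition vector_field_on :: "'a::real_normed_vector set \<Rightarrow> ('a \<Rightarrow> 'a) \<Rightarrow> bool" where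
  "vector_field_on M v \<longleftrightarrow> smooth_map_on M v \<and> (\<forall>p\<in>M. v p \<in> tangent_space M p)"

definition partial_deriv :: "(real ^ 'k \<Rightarrow> real) \<Rightarrow> 'k::finite \<Rightarrow> real ^ 'k \<Rightarrow> real" where
  "partial_deriv f i p = frechet_derivative f (at p) (axis i 1)"

subsection \<open>Symmetries of a manifold with a distribution\<close>

text \<open>\<open>\<Phi>\<close> is the flow of \<open>v\<close> on \<open>M\<close>, for times in \<open>(-e, e)\<close> and initial points in the
  relatively open set \<open>N\<close>.\<close>

definition local_flow ::
  "'a::real_normed_vector set \<Rightarrow> ('a \<Rightarrow> 'a) \<Rightarrow> real \<Rightarrow> 'a set \<Rightarrow> (real \<Rightarrow> 'a \<Rightarrow> 'a) \<Rightarrow> bool" where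
  "local_flow M v e N \<Phi> \<longleftrightarrow>
     0 < e \<and> openin (top_of_set M) N \<and>
     smooth_map_on ({-e<..<e} \<times> N) (\<lambda>(t, q). \<Phi> t q) \<and>
     (\<forall>q\<in>N. \<Phi> 0 q = q \<and>
        (\<forall>t\<in>{-e<..<e}. \<Phi> t q \<in> M \<and> ((\<lambda>s. \<Phi> s q) has_vector_derivative v (\<Phi> t q)) (at t)))"

text \<open>A distribution assigns a set of tangent vectors to each point. In
  \<open>preserves_distribution\<close> the domain \<open>N\<close> is relatively open in a manifold \<open>M\<close>. The derivative
  within \<open>N\<close> is then uniquely determined on the tangent spaces of \<open>M\<close>, where it is the tangent
  map of \<open>f\<close>; its values on other vectors do not matter when \<open>D\<close> is tangent to \<open>M\<close>.\<close>

definition preserves_distribution ::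
  "('a::real_normed_vector \<Rightarrow> 'a set) \<Rightarrow> 'a set \<Rightarrow> ('a \<Rightarrow> 'a) \<Rightarrow> bool" where
  "preserves_distribution D N f \<longleftrightarrow>
     (\<forall>q\<in>N. \<exists>L. (f has_derivative L) (at q within N) \<and> L ` D q = D (f q))"

definition local_symmetry ::
  "'a::real_normed_vector set \<Rightarrow> ('a \<Rightarrow> 'a set) \<Rightarrow> 'a set \<Rightarrow> ('a \<Rightarrow> 'a) \<Rightarrow> bool" where
  "local_symmetry M D N f \<longleftrightarrow>
     openin (top_of_set M) N \<and> openin (top_of_set M) (f ` N) \<and>
     diffeomorphism_on N (f ` N) f \<and> preserves_distribution D N f"

definition infinitesimal_symmetry ::
  "'a::real_normed_vector set \<Rightarrow> ('a \<Rightarrow> 'a set) \<Rightarrow> ('a \<Rightarrow> 'a) \<Rightarrow> bool" where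
  "infinitesimal_symmetry M D v \<longleftrightarrow>
     vector_field_on M v \<and>
     (\<forall>p\<in>M. \<exists>e N \<Phi>. p \<in> N \<and> local_flow M v e N \<Phi> \<and>
        (\<forall>t\<in>{-e<..<e}. local_symmetry M D N (\<Phi> t)))"

subsection \<open>Mixed jet spaces\<close>

text \<open>The mixed jet space of orders \<open>m\<close>, \<open>n\<close> is \<open>real ^ 'k\<close> together with a labelling
  \<open>c\<close> that matches the jet variables \<open>x, y\<^sub>0, \<dots>, y\<^sub>m, z\<^sub>0, \<dots>, z\<^sub>n\<close> bijectively with the
  coordinates; in particular \<open>CARD('k) = m + n + 3\<close>.\<close>

datatype jet_var = JX | JY nat | JZ nat

definition jet_vars :: "nat \<Rightarrow> nat \<Rightarrow> jet_var set" where
  "jet_vars m n = {JX} \<union> JY ` {..m} \<union> JZ ` {..n}"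

definition jet_labelling :: "nat \<Rightarrow> nat \<Rightarrow> (jet_var \<Rightarrow> 'k::finite) \<Rightarrow> bool" where
  "jet_labelling m n c \<longleftrightarrow> bij_betw c (jet_vars m n) UNIV"

definition cartan :: "nat \<Rightarrow> nat \<Rightarrow> (jet_var \<Rightarrow> 'k::finite) \<Rightarrow> real ^ 'k \<Rightarrow> (real ^ 'k) set" where
  "cartan m n c p =
     {w. (\<forall>i<m. w $ c (JY i) - p $ c (JY (Suc i)) * w $ c JX = 0) \<and>
         (\<forall>j<n. w $ c (JZ j) - p $ c (JZ (Suc j)) * w $ c JX = 0)}"

definition infinitesimal_lie_transformation ::
  "nat \<Rightarrow> nat \<Rightarrow> (jet_var \<Rightarrow> 'k::finite) \<Rightarrow> (real ^ 'k) set \<Rightarrow> (real ^ 'k \<Rightarrow> real ^ 'k) \<Rightarrow> bool" where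
  "infinitesimal_lie_transformation m n c A W \<longleftrightarrow>
     open A \<and> infinitesimal_symmetry A (cartan m n c) W"

subsection \<open>Monge equations\<close>

text \<open>A function of all jet variables except \<open>y\<^sub>m\<close>, on an open set of such variables, is
  encoded by its pullback to the jet space: both its domain \<open>U\<close> and its values are invariant
  under changes of \<open>y\<^sub>m\<close>.\<close>

definition monge_rhs ::
  "nat \<Rightarrow> nat \<Rightarrow> (jet_var \<Rightarrow> 'k::finite) \<Rightarrow> (real ^ 'k) set \<Rightarrow> (real ^ 'k \<Rightarrow> real) \<Rightarrow> bool" where
  "monge_rhs m n c U F \<longleftrightarrow>
     open U \<and> smooth_on U F \<and>
     (\<forall>p\<in>U. \<forall>q. (\<forall>a\<in>jet_vars m n - {JY m}. q $ c a = p $ c a) \<longrightarrow> q \<in> U \<and> F q = F p)"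

definition monge_eq ::
  "nat \<Rightarrow> (jet_var \<Rightarrow> 'k::finite) \<Rightarrow> (real ^ 'k) set \<Rightarrow> (real ^ 'k \<Rightarrow> real) \<Rightarrow> (real ^ 'k) set" where
  "monge_eq m c U F = {p \<in> U. p $ c (JY m) = F p}"

definition monge_distribution ::
  "nat \<Rightarrow> nat \<Rightarrow> (jet_var \<Rightarrow> 'k::finite) \<Rightarrow> (real ^ 'k) set \<Rightarrow> real ^ 'k \<Rightarrow> (real ^ 'k) set" where
  "monge_distribution m n c E p = cartan m n c p \<inter> tangent_space E p"

definition internal_symmetry ::
  "nat \<Rightarrow> nat \<Rightarrow> (jet_var \<Rightarrow> 'k::finite) \<Rightarrow> (real ^ 'k) set \<Rightarrow> (real ^ 'k) set \<Rightarrow>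
     (real ^ 'k \<Rightarrow> real ^ 'k) \<Rightarrow> bool" where
  "internal_symmetry m n c E V v \<longleftrightarrow>
     openin (top_of_set E) V \<and> infinitesimal_symmetry V (monge_distribution m n c E) v"

definition external_symmetry ::
  "nat \<Rightarrow> nat \<Rightarrow> (jet_var \<Rightarrow> 'k::finite) \<Rightarrow> (real ^ 'k) set \<Rightarrow> (real ^ 'k) set \<Rightarrow>
     (real ^ 'k \<Rightarrow> real ^ 'k) \<Rightarrow> bool" where
  "external_symmetry m n c E A W \<longleftrightarrow>
     infinitesimal_lie_transformation m n c A W \<and> (\<forall>q\<in>E \<inter> A. W q \<in> tangent_space E q)"

text \<open>All considerations are local: the symmetry algebras are algebras of germs, at a point of
  \<open>E\<close>, of vector fields on \<open>E\<close>, with the Lie bracket of vector fields on \<open>E\<close>. A germ is encoded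
  as the class of all maps that agree on \<open>E\<close> near the point, so taking the germ on \<open>E\<close> of an
  ambient vector field includes its restriction to \<open>E\<close>.\<close>

definition germ_on :: "'a::topological_space set \<Rightarrow> 'a \<Rightarrow> ('a \<Rightarrow> 'b) \<Rightarrow> ('a \<Rightarrow> 'b) set" where
  "germ_on E p v = {w. \<forall>\<^sub>F q in nhds p. q \<in> E \<longrightarrow> w q = v q}"

definition internal_symmetry_algebra ::
  "nat \<Rightarrow> nat \<Rightarrow> (jet_var \<Rightarrow> 'k::finite) \<Rightarrow> (real ^ 'k) set \<Rightarrow> real ^ 'k \<Rightarrow>
     (real ^ 'k \<Rightarrow> real ^ 'k) set set" where
  "internal_symmetry_algebra m n c E p =
     {germ_on E p v | v V. p \<in> V \<and> internal_symmetry m n c E V v}"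

definition external_symmetry_algebra ::
  "nat \<Rightarrow> nat \<Rightarrow> (jet_var \<Rightarrow> 'k::finite) \<Rightarrow> (real ^ 'k) set \<Rightarrow> real ^ 'k \<Rightarrow>
     (real ^ 'k \<Rightarrow> real ^ 'k) set set" where
  "external_symmetry_algebra m n c E p =
     {germ_on E p W | W A. p \<in> A \<and> external_symmetry m n c E A W}"

end

theory Submission
  imports Defs
begin

text \<open>
  Coordinates on the equation manifold \<open>E\<close> are all jet variables but \<open>y\<^sub>m\<close>. The distribution is
  spanned by the total derivative \<open>D\<close>, in which \<open>y\<^sub>m = F\<close>, and by \<open>Z = \<partial>/\<partial>z\<^sub>n\<close>. With
  \<open>Y = \<partial>/\<partial>y\<^bsub>m-1\<^esub>\<close> and subscripts of \<open>F\<close> for its derivatives along \<open>Z\<close>, the brackets that matter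
  are \<open>[Z, D] = X1 = \<partial>/\<partial>z\<^bsub>n-1\<^esub> + F1 Y\<close> and \<open>[Z, X1] = F2 Y\<close>, where \<open>F2 \<noteq> 0\<close>.

  Let \<open>v\<close> be an internal symmetry. The heart of the matter is that \<open>v\<close> preserves the line field of
  \<open>Z\<close>, that is, that its \<open>x\<close>-component \<open>\<xi>\<close> does not depend on \<open>z\<^sub>n\<close> (\<open>Z_xi\<close>). The values
  \<open>\<phi>\<^sub>i = \<eta>\<^sub>i - y\<^bsub>i+1\<^esub> \<xi>\<close> and \<open>\<psi>\<^sub>j = \<zeta>\<^sub>j - z\<^bsub>j+1\<^esub> \<xi>\<close> of the contact forms on \<open>v\<close> satisfy
  \<open>D \<phi>\<^sub>i = \<phi>\<^bsub>i+1\<^esub>\<close> and \<open>D \<psi>\<^sub>j = \<psi>\<^bsub>j+1\<^esub>\<close>, all of them except the last ones are annihilated by \<open>Z\<close>,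
  and \<open>Z \<psi>\<^bsub>n-1\<^esub> = - \<xi>\<close>, \<open>Z \<phi>\<^bsub>m-1\<^esub> = - F1 \<xi>\<close>. Commuting \<open>Z\<close> past \<open>D\<close> and \<open>X1\<close> gives
  \<open>Z Z \<psi>\<^bsub>n-1\<^esub> = 0\<close>: if \<open>m \<ge> 2\<close> by comparing the two chains one step before their ends, and if
  \<open>m = 1\<close>, so that \<open>n \<ge> 3\<close>, by going back to \<open>\<psi>\<^bsub>n-3\<^esub>\<close>. For \<open>(m, n) = (1, 1)\<close> and \<open>(1, 2)\<close> the
  chains are too short.

  It follows that the components of \<open>v\<close> other than \<open>\<zeta>\<^sub>n\<close>, and then by the variational equation
  (\<open>Z_psi\<close>) also the corresponding coordinates of its flow, are independent of \<open>z\<^sub>n\<close>. So the flow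
  descends to the space of the variables other than \<open>y\<^sub>m\<close> and \<open>z\<^sub>n\<close>, where it maps the directions
  of \<open>D\<close>, for the various values of \<open>z\<^sub>n\<close>, to directions of the same kind. As \<open>1\<close>, \<open>z\<^sub>n\<close>, \<open>F\<close> are
  linearly independent functions of \<open>z\<^sub>n\<close>, these directions span the Cartan distribution one order
  lower. So the flow preserves this distribution (the step that needs it is \<open>relation_along_tot\<close>),
  and its prolongation acts on the jet space by Lie transformations. The
  prolonged flow is given by an explicit formula in the first derivatives of the given flow, so
  that no existence theorem for differential equations is needed; its generator extends \<open>v\<close>
  (\<open>exists_extension\<close>).

  Conversely, the flow of an external symmetry preserves the Cartan distribution and, by Gronwall's
  lemma, also \<open>E\<close>, hence the intersection of the Cartan distribution with the tangent spaces of \<open>E\<close>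
  (\<open>external_symmetry_internal\<close>).
\<close>

section \<open>Smooth maps\<close>

lemma has_derivative_cong_open:
  assumes "open S" "x \<in> S" "\<And>y. y \<in> S \<Longrightarrow> f y = g y"
  shows "(f has_derivative f') (at x) \<longleftrightarrow> (g has_derivative f') (at x)"
  using has_derivative_transform_within_open[OF _ assms(1,2), of f f' UNIV g]
    has_derivative_transform_within_open[OF _ assms(1,2), of g f' UNIV f] assms(3)
  by auto

lemma frechet_derivative_cong_open:
  assumes "open S" "x \<in> S" "\<And>y. y \<in> S \<Longrightarrow> f y = g y"
  shows "frechet_derivative f (at x) = frechet_derivative g (at x)"
  unfolding frechet_derivative_def using has_derivative_cong_open[OF assms] by simp

lemma times_cont_diff_on_cong:
  assumes "open S" "\<And>x. x \<in> S \<Longrightarrow> f x = g x"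
  shows "times_cont_diff_on k S f \<longleftrightarrow> times_cont_diff_on k S g"
  using assms(2)
proof (induction k arbitrary: f g)
  case 0
  then show ?case by (simp cong: continuous_on_cong)
next
  case (Suc k)
  have tr: "(f has_derivative f') (at x) \<longleftrightarrow> (g has_derivative f') (at x)" if "x \<in> S" for x f'
    by (rule has_derivative_cong_open[OF assms(1) that Suc.prems])
  have "frechet_derivative f (at x) = frechet_derivative g (at x)" if "x \<in> S" for x
    by (rule frechet_derivative_cong_open[OF assms(1) that Suc.prems])
  then have "times_cont_diff_on k S (\<lambda>x. frechet_derivative f (at x) h)
      = times_cont_diff_on k S (\<lambda>x. frechet_derivative g (at x) h)" for h
    by (intro Suc.IH) simp
  moreover have "(\<forall>x\<in>S. f differentiable (at x)) = (\<forall>x\<in>S. g differentiable (at x))"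
    unfolding differentiable_def using tr by blast
  ultimately show ?case by simp
qed

lemma times_cont_diff_on_SucI:
  assumes "open S" "\<And>x. x \<in> S \<Longrightarrow> (f has_derivative f' x) (at x)"
    "\<And>h. times_cont_diff_on k S (\<lambda>x. f' x h)"
  shows "times_cont_diff_on (Suc k) S f"
proof -
  have "times_cont_diff_on k S (\<lambda>x. frechet_derivative f (at x) h)" for h
    using times_cont_diff_on_cong[OF assms(1), of "\<lambda>x. frechet_derivative f (at x) h" "\<lambda>x. f' x h" k]
      assms(3)[of h] frechet_derivative_at[OF assms(2)] by simp
  then show ?thesis using assms(2) by (auto simp: differentiable_def)
qed

lemma times_cont_diff_on_subset:
  "times_cont_diff_on k S f \<Longrightarrow> T \<subseteq> S \<Longrightarrow> times_cont_diff_on k T f"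
  by (induction k arbitrary: f) (auto intro: continuous_on_subset)

lemma times_cont_diff_on_SucD:
  "times_cont_diff_on (Suc k) S f \<Longrightarrow> times_cont_diff_on k S f"
proof (induction k arbitrary: f)
  case 0
  then show ?case
    by (auto intro!: differentiable_imp_continuous_on differentiable_at_imp_differentiable_on)
next
  case (Suc k)
  show ?case unfolding times_cont_diff_on.simps(2)[of k]
    using Suc.prems Suc.IH unfolding times_cont_diff_on.simps(2)[of "Suc k"] by blast
qed

lemma times_cont_diff_on_const: "times_cont_diff_on k S (\<lambda>x. a)"
  by (induction k arbitrary: a) auto

lemma times_cont_diff_on_bounded_linear:
  assumes "open S" "bounded_linear L" "times_cont_diff_on k S f"
  shows "times_cont_diff_on k S (\<lambda>x. L (f x))"
  using assms(3)
proof (induction k arbitrary: f)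
  case 0
  then show ?case using bounded_linear.continuous_on[OF assms(2)] by simp
next
  case (Suc k)
  show ?case
  proof (rule times_cont_diff_on_SucI[OF assms(1), of _ "\<lambda>x h. L (frechet_derivative f (at x) h)"])
    show "((\<lambda>x. L (f x)) has_derivative (\<lambda>h. L (frechet_derivative f (at x) h))) (at x)" if "x \<in> S" for x
      using Suc.prems that by (intro bounded_linear.has_derivative[OF assms(2)])
        (simp add: frechet_derivative_works)
    show "times_cont_diff_on k S (\<lambda>x. L (frechet_derivative f (at x) h))" for h
      using Suc.prems by (intro Suc.IH) simp
  qed
qed

lemma times_cont_diff_on_add:
  assumes "open S" "times_cont_diff_on k S f" "times_cont_diff_on k S g"
  shows "times_cont_diff_on k S (\<lambda>x. f x + g x)"
  using assms(2,3)
proof (induction k arbitrary: f g)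
  case 0
  then show ?case by (simp add: continuous_on_add)
next
  case (Suc k)
  show ?case
  proof (rule times_cont_diff_on_SucI[OF assms(1),
        of _ "\<lambda>x h. frechet_derivative f (at x) h + frechet_derivative g (at x) h"])
    show "((\<lambda>x. f x + g x) has_derivative
        (\<lambda>h. frechet_derivative f (at x) h + frechet_derivative g (at x) h)) (at x)" if "x \<in> S" for x
      using Suc.prems that by (intro has_derivative_add) (simp_all add: frechet_derivative_works)
    show "times_cont_diff_on k S (\<lambda>x. frechet_derivative f (at x) h + frechet_derivative g (at x) h)" for h
      using Suc.prems by (intro Suc.IH) simp_all
  qed
qed

lemma times_cont_diff_on_sum:
  assumes "open S" "\<And>i. i \<in> I \<Longrightarrow> times_cont_diff_on k S (f i)"
  shows "times_cont_diff_on k S (\<lambda>x. \<Sum>i\<in>I. f i x)"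
  using assms(2)
proof (induction I rule: infinite_finite_induct)
  case (insert i I)
  then show ?case using times_cont_diff_on_add[OF assms(1), of k "f i" "\<lambda>x. \<Sum>i\<in>I. f i x"] by simp
qed (simp_all add: times_cont_diff_on_const)

lemma times_cont_diff_on_scaleR:
  fixes f :: "'a::real_normed_vector \<Rightarrow> real"
  assumes "open S" "times_cont_diff_on k S f" "times_cont_diff_on k S g"
  shows "times_cont_diff_on k S (\<lambda>x. f x *\<^sub>R g x)"
  using assms(2,3)
proof (induction k arbitrary: f g)
  case 0
  then show ?case by (simp add: continuous_on_scaleR)
next
  case (Suc k)
  show ?case
  proof (rule times_cont_diff_on_SucI[OF assms(1),
        of _ "\<lambda>x h. f x *\<^sub>R frechet_derivative g (at x) h + frechet_derivative f (at x) h *\<^sub>R g x"])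
    show "((\<lambda>x. f x *\<^sub>R g x) has_derivative (\<lambda>h. f x *\<^sub>R frechet_derivative g (at x) h +
          frechet_derivative f (at x) h *\<^sub>R g x)) (at x)" if "x \<in> S" for x
      using Suc.prems that by (intro has_derivative_scaleR) (simp_all add: frechet_derivative_works)
    show "times_cont_diff_on k S (\<lambda>x. f x *\<^sub>R frechet_derivative g (at x) h +
          frechet_derivative f (at x) h *\<^sub>R g x)" for h
      using Suc.prems times_cont_diff_on_SucD[OF Suc.prems(1)] times_cont_diff_on_SucD[OF Suc.prems(2)]
      by (intro times_cont_diff_on_add assms(1) Suc.IH) simp_all
  qed
qed

lemma times_cont_diff_on_inverse:
  fixes f :: "'a::real_normed_vector \<Rightarrow> real"
  assumes "open S" "times_cont_diff_on k S f" "\<And>x. x \<in> S \<Longrightarrow> f x \<noteq> 0"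
  shows "times_cont_diff_on k S (\<lambda>x. inverse (f x))"
  using assms(2)
proof (induction k)
  case 0
  then show ?case using assms(3) by (simp add: continuous_on_inverse)
next
  case (Suc k)
  have IH: "times_cont_diff_on k S (\<lambda>x. inverse (f x))"
    using times_cont_diff_on_SucD[OF Suc.prems] Suc.IH by blast
  show ?case
  proof (rule times_cont_diff_on_SucI[OF assms(1),
        of _ "\<lambda>x h. (- inverse (f x)) *\<^sub>R (frechet_derivative f (at x) h *\<^sub>R inverse (f x))"])
    show "((\<lambda>x. inverse (f x)) has_derivative
        (\<lambda>h. (- inverse (f x)) *\<^sub>R (frechet_derivative f (at x) h *\<^sub>R inverse (f x)))) (at x)" if "x \<in> S" for x
    proof -
      have "(f has_derivative frechet_derivative f (at x)) (at x)"
        using Suc.prems that by (simp add: frechet_derivative_works)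
      from Deriv.has_derivative_inverse[OF assms(3)[OF that] this] show ?thesis
        by (simp add: mult.assoc)
    qed
    show "times_cont_diff_on k S
        (\<lambda>x. (- inverse (f x)) *\<^sub>R (frechet_derivative f (at x) h *\<^sub>R inverse (f x)))" for h
      using IH Suc.prems
        times_cont_diff_on_bounded_linear[OF assms(1) bounded_linear_minus[OF bounded_linear_ident] IH]
      by (intro times_cont_diff_on_scaleR assms(1)) simp_all
  qed
qed

lemma times_cont_diff_on_compose:
  fixes f :: "'a::real_normed_vector \<Rightarrow> 'b::euclidean_space"
  assumes "open S" "open T" "f ` S \<subseteq> T" "times_cont_diff_on k S f" "times_cont_diff_on k T g"
  shows "times_cont_diff_on k S (\<lambda>x. g (f x))"
  using assms(4,5)
proof (induction k arbitrary: g)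
  case 0
  then show ?case using assms(3) by (auto intro: continuous_on_compose2)
next
  case (Suc k)
  have fk: "times_cont_diff_on k S f" using times_cont_diff_on_SucD[OF Suc.prems(1)] .
  let ?g' = "\<lambda>x h. \<Sum>b\<in>Basis. (frechet_derivative f (at x) h \<bullet> b) *\<^sub>R frechet_derivative g (at (f x)) b"
  show ?case
  proof (rule times_cont_diff_on_SucI[OF assms(1), of _ ?g'])
    fix x assume x: "x \<in> S"
    have df: "(f has_derivative frechet_derivative f (at x)) (at x)"
      using Suc.prems x by (simp add: frechet_derivative_works)
    have dg: "(g has_derivative frechet_derivative g (at (f x))) (at (f x))"
      using Suc.prems x assms(3) by (auto simp add: frechet_derivative_works)
    have lin: "linear (frechet_derivative g (at (f x)))"
      using dg has_derivative_linear by blast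
    have "frechet_derivative g (at (f x)) (frechet_derivative f (at x) h) = ?g' x h" for h
    proof -
      have "frechet_derivative g (at (f x)) (\<Sum>b\<in>Basis. (frechet_derivative f (at x) h \<bullet> b) *\<^sub>R b) = ?g' x h"
        by (simp only: linear_sum[OF lin] linear_cmul[OF lin])
      then show ?thesis by (simp add: euclidean_representation)
    qed
    then show "((\<lambda>x. g (f x)) has_derivative ?g' x) (at x)"
      using has_derivative_compose[OF df dg] by simp
  next
    fix h
    show "times_cont_diff_on k S (\<lambda>x. ?g' x h)"
      using Suc.prems fk
      by (intro times_cont_diff_on_sum times_cont_diff_on_scaleR assms(1) Suc.IH
          times_cont_diff_on_bounded_linear[OF assms(1) bounded_linear_inner_left]) simp_all
  qed
qed

lemma smooth_on_cong:
  "open S \<Longrightarrow> (\<And>x. x \<in> S \<Longrightarrow> f x = g x) \<Longrightarrow> smooth_on S f \<longleftrightarrow> smooth_on S g"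
  unfolding smooth_on_def using times_cont_diff_on_cong by blast

lemma smooth_on_subset: "smooth_on S f \<Longrightarrow> T \<subseteq> S \<Longrightarrow> smooth_on T f"
  unfolding smooth_on_def using times_cont_diff_on_subset by blast

lemma smooth_on_const: "smooth_on S (\<lambda>x. a)"
  by (simp add: smooth_on_def times_cont_diff_on_const)

lemma smooth_on_bounded_linear:
  "open S \<Longrightarrow> bounded_linear L \<Longrightarrow> smooth_on S f \<Longrightarrow> smooth_on S (\<lambda>x. L (f x))"
  by (simp add: smooth_on_def times_cont_diff_on_bounded_linear)

lemma smooth_on_ident: "open S \<Longrightarrow> smooth_on S (\<lambda>x. x)"
  unfolding smooth_on_def
proof
  fix k assume "open S"
  then show "times_cont_diff_on k S (\<lambda>x. x)"
    by (cases k) (auto simp: times_cont_diff_on_const differentiable_ident)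
qed

lemma smooth_on_add:
  "open S \<Longrightarrow> smooth_on S f \<Longrightarrow> smooth_on S g \<Longrightarrow> smooth_on S (\<lambda>x. f x + g x)"
  by (simp add: smooth_on_def times_cont_diff_on_add)

lemma smooth_on_sum:
  "open S \<Longrightarrow> (\<And>i. i \<in> I \<Longrightarrow> smooth_on S (f i)) \<Longrightarrow> smooth_on S (\<lambda>x. \<Sum>i\<in>I. f i x)"
  by (simp add: smooth_on_def times_cont_diff_on_sum)

lemma smooth_on_scaleR:
  fixes f :: "'a::real_normed_vector \<Rightarrow> real"
  shows "open S \<Longrightarrow> smooth_on S f \<Longrightarrow> smooth_on S g \<Longrightarrow> smooth_on S (\<lambda>x. f x *\<^sub>R g x)"
  by (simp add: smooth_on_def times_cont_diff_on_scaleR)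

lemma smooth_on_mult:
  fixes f g :: "'a::real_normed_vector \<Rightarrow> real"
  shows "open S \<Longrightarrow> smooth_on S f \<Longrightarrow> smooth_on S g \<Longrightarrow> smooth_on S (\<lambda>x. f x * g x)"
  using smooth_on_scaleR[of S f g] by simp

lemma smooth_on_minus:
  "open S \<Longrightarrow> smooth_on S f \<Longrightarrow> smooth_on S (\<lambda>x. - f x)"
  by (rule smooth_on_bounded_linear[OF _ bounded_linear_minus[OF bounded_linear_ident]])

lemma smooth_on_diff:
  "open S \<Longrightarrow> smooth_on S f \<Longrightarrow> smooth_on S g \<Longrightarrow> smooth_on S (\<lambda>x. f x - g x)"
  using smooth_on_add[of S f "\<lambda>x. - g x"] smooth_on_minus[of S g] by simp

lemma smooth_on_divide:
  fixes f g :: "'a::real_normed_vector \<Rightarrow> real"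
  assumes "open S" "smooth_on S f" "smooth_on S g" "\<And>x. x \<in> S \<Longrightarrow> g x \<noteq> 0"
  shows "smooth_on S (\<lambda>x. f x / g x)"
proof -
  have "smooth_on S (\<lambda>x. inverse (g x))"
    using assms by (simp add: smooth_on_def times_cont_diff_on_inverse)
  from smooth_on_mult[OF assms(1,2) this] show ?thesis by (simp add: divide_inverse)
qed

lemma smooth_on_compose:
  fixes f :: "'a::real_normed_vector \<Rightarrow> 'b::euclidean_space"
  assumes "open S" "open T" "f ` S \<subseteq> T" "smooth_on S f" "smooth_on T g"
  shows "smooth_on S (\<lambda>x. g (f x))"
  using assms times_cont_diff_on_compose by (metis smooth_on_def)

lemma smooth_on_nth: "open S \<Longrightarrow> smooth_on S f \<Longrightarrow> smooth_on S (\<lambda>x. f x $ i)"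
  by (rule smooth_on_bounded_linear[OF _ bounded_linear_vec_nth])

lemma smooth_on_vec:
  fixes f :: "'a::real_normed_vector \<Rightarrow> real ^ 'k"
  assumes "open S" "\<And>i. smooth_on S (\<lambda>x. f x $ i)"
  shows "smooth_on S f"
proof -
  have "smooth_on S (\<lambda>x. \<Sum>i\<in>UNIV. f x $ i *\<^sub>R (axis i 1 :: real ^ 'k))"
    using assms by (intro smooth_on_sum smooth_on_scaleR smooth_on_const)
  moreover have "(\<Sum>i\<in>UNIV. f x $ i *\<^sub>R axis i 1) = f x" for x
    by (subst (2) basis_expansion[symmetric]) (simp add: scalar_mult_eq_scaleR)
  ultimately show ?thesis by simp
qed

lemma smooth_on_Pair:
  assumes "open S" "smooth_on S f" "smooth_on S g"
  shows "smooth_on S (\<lambda>x. (f x, g x))"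
proof -
  have "smooth_on S (\<lambda>x. (f x, 0) + (0, g x))"
    using assms by (intro smooth_on_add smooth_on_bounded_linear[where L = "\<lambda>y. (y, 0)"]
        smooth_on_bounded_linear[where L = "\<lambda>y. (0, y)"] bounded_linear_Pair
        bounded_linear_ident bounded_linear_zero)
  then show ?thesis by simp
qed

lemma smooth_on_differentiable: "smooth_on S f \<Longrightarrow> x \<in> S \<Longrightarrow> f differentiable (at x)"
  unfolding smooth_on_def by (metis times_cont_diff_on.simps(2))

lemma smooth_on_has_derivative:
  "smooth_on S f \<Longrightarrow> x \<in> S \<Longrightarrow> (f has_derivative frechet_derivative f (at x)) (at x)"
  using smooth_on_differentiable frechet_derivative_works by blast

lemma smooth_on_linear_derivative:
  "smooth_on S f \<Longrightarrow> x \<in> S \<Longrightarrow> linear (frechet_derivative f (at x))"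
  using smooth_on_has_derivative has_derivative_linear by blast

lemma smooth_on_continuous_on: "smooth_on S f \<Longrightarrow> continuous_on S f"
  unfolding smooth_on_def by (metis times_cont_diff_on.simps(1))

lemma smooth_on_derivative_const:
  "smooth_on S f \<Longrightarrow> smooth_on S (\<lambda>x. frechet_derivative f (at x) h)"
  unfolding smooth_on_def by (metis times_cont_diff_on.simps(2))

lemma smooth_on_derivative:
  fixes f :: "'a::euclidean_space \<Rightarrow> 'b::real_normed_vector"
  assumes "open S" "smooth_on S f" "smooth_on S X"
  shows "smooth_on S (\<lambda>x. frechet_derivative f (at x) (X x))"
proof -
  have "frechet_derivative f (at x) (X x) = (\<Sum>b\<in>Basis. (X x \<bullet> b) *\<^sub>R frechet_derivative f (at x) b)"
    if "x \<in> S" for x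
  proof -
    note lin = smooth_on_linear_derivative[OF assms(2) that]
    have "frechet_derivative f (at x) (\<Sum>b\<in>Basis. (X x \<bullet> b) *\<^sub>R b)
        = (\<Sum>b\<in>Basis. (X x \<bullet> b) *\<^sub>R frechet_derivative f (at x) b)"
      by (simp only: linear_sum[OF lin] linear_cmul[OF lin])
    then show ?thesis by (simp add: euclidean_representation)
  qed
  moreover have "smooth_on S (\<lambda>x. \<Sum>b\<in>Basis. (X x \<bullet> b) *\<^sub>R frechet_derivative f (at x) b)"
    using assms smooth_on_derivative_const[OF assms(2)]
    by (intro smooth_on_sum smooth_on_scaleR
        smooth_on_bounded_linear[OF assms(1) bounded_linear_inner_left])
  ultimately show ?thesis
    using smooth_on_cong[OF assms(1), of "\<lambda>x. frechet_derivative f (at x) (X x)"] by simp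
qed

lemma smooth_map_on_open:
  assumes "smooth_on S f" "open S" "M \<subseteq> S"
  shows "smooth_map_on M f"
  unfolding smooth_map_on_def using assms by blast

lemma smooth_map_on_subset:
  assumes "smooth_map_on M f" "M' \<subseteq> M"
  shows "smooth_map_on M' f"
  unfolding smooth_map_on_def
proof
  fix p assume "p \<in> M'"
  then have "p \<in> M" using assms(2) by blast
  then obtain B g where "open B" "p \<in> B" "smooth_on B g" "\<forall>q\<in>M \<inter> B. f q = g q"
    using assms(1) unfolding smooth_map_on_def by blast
  then show "\<exists>B g. open B \<and> p \<in> B \<and> smooth_on B g \<and> (\<forall>q\<in>M' \<inter> B. f q = g q)"
    using assms(2) by (intro exI[of _ B] exI[of _ g]) auto
qed

lemma times_cont_diff_on_local:
  assumes "\<And>x. x \<in> S \<Longrightarrow> \<exists>B. open B \<and> x \<in> B \<and> times_cont_diff_on k B f"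
  shows "times_cont_diff_on k S f"
  using assms
proof (induction k arbitrary: f)
  case 0
  show ?case unfolding times_cont_diff_on.simps
  proof (rule continuous_at_imp_continuous_on, rule ballI)
    fix x assume "x \<in> S"
    from 0[OF this] show "isCont f x" by (auto simp: continuous_on_eq_continuous_at)
  qed
next
  case (Suc k)
  then show ?case unfolding times_cont_diff_on.simps by meson
qed

lemma smooth_map_on_open_iff:
  assumes "open S"
  shows "smooth_map_on S f \<longleftrightarrow> smooth_on S f"
proof
  assume L: "smooth_map_on S f"
  show "smooth_on S f" unfolding smooth_on_def
  proof (intro allI times_cont_diff_on_local)
    fix k x assume "x \<in> S"
    then obtain B g where B: "open B" "x \<in> B" "smooth_on B g" "\<forall>q\<in>S \<inter> B. f q = g q"
      using L unfolding smooth_map_on_def by blast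
    have "smooth_on (S \<inter> B) f"
      using smooth_on_cong[of "S \<inter> B" f g] smooth_on_subset[OF B(3), of "S \<inter> B"] B assms by auto
    then show "\<exists>B. open B \<and> x \<in> B \<and> times_cont_diff_on k B f"
      using assms B \<open>x \<in> S\<close> unfolding smooth_on_def by (intro exI[of _ "S \<inter> B"]) auto
  qed
qed (use smooth_map_on_open assms in blast)

lemma smooth_map_on_cong:
  assumes "smooth_map_on M f" "\<And>x. x \<in> M \<Longrightarrow> f x = g x"
  shows "smooth_map_on M g"
  unfolding smooth_map_on_def
proof
  fix p assume "p \<in> M"
  then obtain B h where "open B" "p \<in> B" "smooth_on B h" "\<forall>q\<in>M \<inter> B. f q = h q"
    using assms(1) unfolding smooth_map_on_def by blast
  then show "\<exists>B h. open B \<and> p \<in> B \<and> smooth_on B h \<and> (\<forall>q\<in>M \<inter> B. g q = h q)"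
    using assms(2) by (intro exI[of _ B] exI[of _ h]) auto
qed

text \<open>Equality of mixed second derivatives: by the mean value theorem, applied twice in both
  orders, the second difference of \<open>f\<close> on a small parallelogram is a value of either one.\<close>

lemma second_difference_value:
  fixes f :: "'a::real_normed_vector \<Rightarrow> real"
  assumes S: "smooth_on S f" and s: "0 < s"
    and sub: "\<And>a b. 0 \<le> a \<Longrightarrow> a \<le> s \<Longrightarrow> 0 \<le> b \<Longrightarrow> b \<le> s \<Longrightarrow> x + a *\<^sub>R h + b *\<^sub>R k \<in> S"
  shows "\<exists>a b. 0 \<le> a \<and> a \<le> s \<and> 0 \<le> b \<and> b \<le> s \<and>
    f (x + s *\<^sub>R h + s *\<^sub>R k) - f (x + s *\<^sub>R h) - f (x + s *\<^sub>R k) + f x =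
    s * s * frechet_derivative (\<lambda>y. frechet_derivative f (at y) h) (at (x + a *\<^sub>R h + b *\<^sub>R k)) k"
proof -
  let ?Dh = "\<lambda>y. frechet_derivative f (at y) h"
  have Dh: "smooth_on S ?Dh" by (rule smooth_on_derivative_const[OF S])
  have d1: "((\<lambda>a. f (x + a *\<^sub>R h + b *\<^sub>R k)) has_real_derivative ?Dh (x + a *\<^sub>R h + b *\<^sub>R k)) (at a)"
    if "0 \<le> a" "a \<le> s" "0 \<le> b" "b \<le> s" for a b
  proof -
    have "((\<lambda>a. x + a *\<^sub>R h + b *\<^sub>R k) has_derivative (\<lambda>r. r *\<^sub>R h)) (at a)"
      by (auto intro!: derivative_eq_intros)
    from has_derivative_compose[OF this smooth_on_has_derivative[OF S sub[OF that]]]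
    have "((\<lambda>a. f (x + a *\<^sub>R h + b *\<^sub>R k)) has_derivative
        (\<lambda>r. r *\<^sub>R ?Dh (x + a *\<^sub>R h + b *\<^sub>R k))) (at a)"
      using linear_cmul[OF smooth_on_linear_derivative[OF S sub[OF that]]] by simp
    then show ?thesis by (simp add: has_field_derivative_def mult_commute_abs)
  qed
  have d2: "((\<lambda>b. ?Dh (x + a *\<^sub>R h + b *\<^sub>R k)) has_real_derivative
      frechet_derivative ?Dh (at (x + a *\<^sub>R h + b *\<^sub>R k)) k) (at b)"
    if "0 \<le> a" "a \<le> s" "0 \<le> b" "b \<le> s" for a b
  proof -
    have "((\<lambda>b. x + a *\<^sub>R h + b *\<^sub>R k) has_derivative (\<lambda>r. r *\<^sub>R k)) (at b)"
      by (auto intro!: derivative_eq_intros)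
    from has_derivative_compose[OF this smooth_on_has_derivative[OF Dh sub[OF that]]]
    have "((\<lambda>b. ?Dh (x + a *\<^sub>R h + b *\<^sub>R k)) has_derivative
        (\<lambda>r. r *\<^sub>R frechet_derivative ?Dh (at (x + a *\<^sub>R h + b *\<^sub>R k)) k)) (at b)"
      using linear_cmul[OF smooth_on_linear_derivative[OF Dh sub[OF that]]] by simp
    then show ?thesis by (simp add: has_field_derivative_def mult_commute_abs)
  qed
  have "\<exists>a. a > 0 \<and> a < s \<and> (f (x + s *\<^sub>R h + s *\<^sub>R k) - f (x + s *\<^sub>R h + 0 *\<^sub>R k)) -
      (f (x + 0 *\<^sub>R h + s *\<^sub>R k) - f (x + 0 *\<^sub>R h + 0 *\<^sub>R k)) =
      (s - 0) * (?Dh (x + a *\<^sub>R h + s *\<^sub>R k) - ?Dh (x + a *\<^sub>R h + 0 *\<^sub>R k))"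
    using s by (intro MVT2 DERIV_diff d1) auto
  then obtain a where a: "0 < a" "a < s" and eq1:
    "f (x + s *\<^sub>R h + s *\<^sub>R k) - f (x + s *\<^sub>R h) - f (x + s *\<^sub>R k) + f x =
      s * (?Dh (x + a *\<^sub>R h + s *\<^sub>R k) - ?Dh (x + a *\<^sub>R h + 0 *\<^sub>R k))"
    by auto
  have "\<exists>b. b > 0 \<and> b < s \<and> ?Dh (x + a *\<^sub>R h + s *\<^sub>R k) - ?Dh (x + a *\<^sub>R h + 0 *\<^sub>R k) =
     (s - 0) * frechet_derivative ?Dh (at (x + a *\<^sub>R h + b *\<^sub>R k)) k"
    using s a by (intro MVT2 d2) auto
  then obtain b where "0 < b" "b < s" "?Dh (x + a *\<^sub>R h + s *\<^sub>R k) - ?Dh (x + a *\<^sub>R h + 0 *\<^sub>R k) =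
     s * frechet_derivative ?Dh (at (x + a *\<^sub>R h + b *\<^sub>R k)) k" by auto
  then show ?thesis using a eq1
    by (intro exI[of _ a] exI[of _ b]) (simp only: mult.assoc, auto)
qed

lemma smooth_on_derivative_commute:
  fixes f :: "'a::real_normed_vector \<Rightarrow> real"
  assumes "open S" "smooth_on S f" "x \<in> S"
  shows "frechet_derivative (\<lambda>y. frechet_derivative f (at y) h) (at x) k
       = frechet_derivative (\<lambda>y. frechet_derivative f (at y) k) (at x) h"
    (is "?A h k x = ?A k h x")
proof (rule ccontr)
  assume ne: "?A h k x \<noteq> ?A k h x"
  define e where "e = \<bar>?A h k x - ?A k h x\<bar> / 2"
  have e: "e > 0" using ne by (simp add: e_def)
  have cont: "continuous_on S (\<lambda>y. ?A h' k' y)" for h' k'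
    by (intro smooth_on_continuous_on smooth_on_derivative_const assms)
  have "\<exists>d>0. \<forall>y. dist y x < d \<longrightarrow> y \<in> S \<and> dist (?A h' k' y) (?A h' k' x) < e" for h' k'
  proof -
    obtain d1 where "d1 > 0" "\<And>y. dist y x < d1 \<Longrightarrow> y \<in> S"
      using assms(1,3) open_dist by blast
    moreover have "\<exists>d>0. \<forall>y\<in>S. dist y x < d \<longrightarrow> dist (?A h' k' y) (?A h' k' x) < e"
      by (rule cont[of h' k', unfolded continuous_on_iff, rule_format, OF assms(3) e])
    then obtain d2 where "d2 > 0" "\<forall>y\<in>S. dist y x < d2 \<longrightarrow> dist (?A h' k' y) (?A h' k' x) < e"
      by (elim exE conjE)
    ultimately show ?thesis by (intro exI[of _ "min d1 d2"]) auto
  qed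
  then obtain d1 d2 where d: "d1 > 0" "d2 > 0"
    and d1: "\<And>y. dist y x < d1 \<Longrightarrow> y \<in> S \<and> dist (?A h k y) (?A h k x) < e"
    and d2: "\<And>y. dist y x < d2 \<Longrightarrow> y \<in> S \<and> dist (?A k h y) (?A k h x) < e"
    by meson
  define s where "s = min d1 d2 / (2 * (norm h + norm k + 1))"
  have s: "s > 0" unfolding s_def using d by (intro divide_pos_pos) (auto simp: add_nonneg_pos)
  have "s * (norm h + norm k) < min d1 d2"
  proof -
    have "0 < norm h + norm k + 1" by (simp add: add_nonneg_pos)
    then have "norm h + norm k + 1 \<noteq> 0" by simp
    then have "s * (norm h + norm k + 1) = min d1 d2 / 2"
      unfolding s_def by (simp add: divide_simps)
    moreover have "s * (norm h + norm k) \<le> s * (norm h + norm k + 1)" using s by simp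
    moreover have "0 < min d1 d2" using d by simp
    ultimately show ?thesis by linarith
  qed
  then have near: "dist (x + a *\<^sub>R h + b *\<^sub>R k) x < min d1 d2" if "0 \<le> a" "a \<le> s" "0 \<le> b" "b \<le> s" for a b
  proof -
    have "norm (a *\<^sub>R h + b *\<^sub>R k) \<le> a * norm h + b * norm k"
      using norm_triangle_ineq[of "a *\<^sub>R h" "b *\<^sub>R k"] that by simp
    also have "\<dots> \<le> s * norm h + s * norm k" using that by (intro add_mono mult_right_mono) auto
    finally show ?thesis using \<open>s * (norm h + norm k) < min d1 d2\<close>
      by (simp add: dist_norm algebra_simps)
  qed
  have near': "dist (x + a *\<^sub>R k + b *\<^sub>R h) x < min d1 d2" if "0 \<le> a" "a \<le> s" "0 \<le> b" "b \<le> s" for a b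
    using near[OF that(3,4,1,2)] by (simp add: add.commute add.left_commute)
  obtain a b where ab: "0 \<le> a" "a \<le> s" "0 \<le> b" "b \<le> s"
    "f (x + s *\<^sub>R h + s *\<^sub>R k) - f (x + s *\<^sub>R h) - f (x + s *\<^sub>R k) + f x =
      s * s * ?A h k (x + a *\<^sub>R h + b *\<^sub>R k)"
    using second_difference_value[OF assms(2) s, of x h k] near d1 by force
  obtain a' b' where ab': "0 \<le> a'" "a' \<le> s" "0 \<le> b'" "b' \<le> s"
    "f (x + s *\<^sub>R k + s *\<^sub>R h) - f (x + s *\<^sub>R k) - f (x + s *\<^sub>R h) + f x =
      s * s * ?A k h (x + a' *\<^sub>R k + b' *\<^sub>R h)"
    using second_difference_value[OF assms(2) s, of x k h] near' d2 by force
  have "x + s *\<^sub>R k + s *\<^sub>R h = x + s *\<^sub>R h + s *\<^sub>R k" by (simp add: add.commute add.left_commute)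
  then have "s * s * ?A h k (x + a *\<^sub>R h + b *\<^sub>R k) = s * s * ?A k h (x + a' *\<^sub>R k + b' *\<^sub>R h)"
    using ab(5) ab'(5) by (simp add: algebra_simps)
  then have "?A h k (x + a *\<^sub>R h + b *\<^sub>R k) = ?A k h (x + a' *\<^sub>R k + b' *\<^sub>R h)" using s by simp
  moreover have "dist (?A h k (x + a *\<^sub>R h + b *\<^sub>R k)) (?A h k x) < e"
    using d1 near[OF ab(1-4)] by simp
  moreover have "dist (?A k h (x + a' *\<^sub>R k + b' *\<^sub>R h)) (?A k h x) < e"
    using d2 near'[OF ab'(1-4)] by simp
  ultimately show False unfolding e_def dist_real_def by argo
qed

section \<open>Flows of smooth vector fields\<close>

text \<open>The homogeneous case of Gronwall's lemma.\<close>

lemma gronwall_zero: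
  fixes u :: "real \<Rightarrow> 'a::real_inner"
  assumes der: "\<And>t. t \<in> {a<..<b} \<Longrightarrow> (u has_vector_derivative u' t) (at t)"
    and bd: "\<And>t. t \<in> {a<..<b} \<Longrightarrow> norm (u' t) \<le> C * norm (u t)"
    and t0: "t0 \<in> {a<..<b}" "u t0 = 0" and t: "t \<in> {a<..<b}"
  shows "u t = 0"
proof -
  \<comment> \<open>With the factor \<open>exp (- 2 C s)\<close> the squared norm decreases to the right of \<open>t0\<close>, and with
    the factor \<open>exp (2 C s)\<close> it increases to the left.\<close>
  have d: "((\<lambda>s. exp (c * s) * (u s \<bullet> u s)) has_real_derivative
      exp (c * s) * (c * (u s \<bullet> u s) + 2 * (u s \<bullet> u' s))) (at s)" if "s \<in> {a<..<b}" for c s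
  proof -
    have "((\<lambda>s. u s \<bullet> u s) has_vector_derivative (u s \<bullet> u' s + u' s \<bullet> u s)) (at s)"
      using has_derivative_inner[OF der[OF that, unfolded has_vector_derivative_def]
          der[OF that, unfolded has_vector_derivative_def]]
      by (simp add: has_vector_derivative_def algebra_simps)
    then have "((\<lambda>s. u s \<bullet> u s) has_real_derivative 2 * (u s \<bullet> u' s)) (at s)"
      by (simp add: has_real_derivative_iff_has_vector_derivative inner_commute)
    then show ?thesis
      by (auto intro!: derivative_eq_intros simp: algebra_simps)
  qed
  have bd': "\<bar>u s \<bullet> u' s\<bar> \<le> C * (u s \<bullet> u s)" if "s \<in> {a<..<b}" for s
  proof -
    have "\<bar>u s \<bullet> u' s\<bar> \<le> norm (u s) * norm (u' s)" by (rule Cauchy_Schwarz_ineq2)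
    also have "\<dots> \<le> norm (u s) * (C * norm (u s))" using bd[OF that] by (intro mult_left_mono) auto
    finally show ?thesis by (simp add: dot_square_norm power2_eq_square algebra_simps)
  qed
  have "u t \<bullet> u t \<le> 0"
  proof (cases "t0 \<le> t")
    case True
    have "exp (- 2 * C * t) * (u t \<bullet> u t) \<le> exp (- 2 * C * t0) * (u t0 \<bullet> u t0)"
    proof (rule DERIV_nonpos_imp_nonincreasing[OF True])
      fix s assume "t0 \<le> s" "s \<le> t"
      then have s: "s \<in> {a<..<b}" using t t0 by auto
      have "(- 2 * C) * (u s \<bullet> u s) + 2 * (u s \<bullet> u' s) \<le> 0" using bd'[OF s] by linarith
      then show "\<exists>y. ((\<lambda>s. exp (- 2 * C * s) * (u s \<bullet> u s)) has_real_derivative y) (at s) \<and> y \<le> 0"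
        by (intro exI[of _ "exp (- 2 * C * s) * (- 2 * C * (u s \<bullet> u s) + 2 * (u s \<bullet> u' s))"] conjI d s
            mult_nonneg_nonpos) auto
    qed
    then show ?thesis using t0 by (simp add: mult_le_0_iff)
  next
    case False
    have "exp (2 * C * t) * (u t \<bullet> u t) \<le> exp (2 * C * t0) * (u t0 \<bullet> u t0)"
    proof (rule DERIV_nonneg_imp_nondecreasing[of t t0 "\<lambda>s. exp (2 * C * s) * (u s \<bullet> u s)"])
      show "t \<le> t0" using False by simp
    next
      fix s assume "t \<le> s" "s \<le> t0"
      then have s: "s \<in> {a<..<b}" using t t0 by auto
      have "(2 * C) * (u s \<bullet> u s) + 2 * (u s \<bullet> u' s) \<ge> 0" using bd'[OF s] by linarith
      then show "\<exists>y. ((\<lambda>s. exp (2 * C * s) * (u s \<bullet> u s)) has_real_derivative y) (at s) \<and> y \<ge> 0"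
        by (intro exI[of _ "exp (2 * C * s) * (2 * C * (u s \<bullet> u s) + 2 * (u s \<bullet> u' s))"] conjI d s
            mult_nonneg_nonneg) auto
    qed
    then show ?thesis using t0 by (simp add: mult_le_0_iff)
  qed
  then show ?thesis by (metis inner_eq_zero_iff inner_ge_zero order_antisym)
qed

lemma smooth_on_locally_bounded_derivative:
  fixes W :: "'a::euclidean_space \<Rightarrow> 'b::euclidean_space"
  assumes "open S" "smooth_on S W" "p \<in> S"
  shows "\<exists>r>0. \<exists>C\<ge>0. cball p r \<subseteq> S \<and>
    (\<forall>x\<in>cball p r. \<forall>h. norm (frechet_derivative W (at x) h) \<le> C * norm h) \<and>
    (\<forall>x\<in>cball p r. \<forall>y\<in>cball p r. norm (W x - W y) \<le> C * norm (x - y))"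
proof -
  obtain r where r: "r > 0" "cball p r \<subseteq> S" using assms(1,3) open_contains_cball by blast
  have "\<exists>M. \<forall>x\<in>cball p r. norm (frechet_derivative W (at x) b) \<le> M" for b
  proof -
    have "continuous_on (cball p r) (\<lambda>x. frechet_derivative W (at x) b)"
      using continuous_on_subset[OF smooth_on_continuous_on[OF smooth_on_derivative_const[OF assms(2)]] r(2)] .
    then have "bounded ((\<lambda>x. frechet_derivative W (at x) b) ` cball p r)"
      by (intro compact_imp_bounded compact_continuous_image) auto
    then show ?thesis by (auto simp: bounded_iff)
  qed
  then obtain M where M: "\<And>b x. x \<in> cball p r \<Longrightarrow> norm (frechet_derivative W (at x) b) \<le> M b" by metis
  define C where "C = (\<Sum>b\<in>Basis. \<bar>M b\<bar>)"
  have bd: "norm (frechet_derivative W (at x) h) \<le> C * norm h" if "x \<in> cball p r" for x h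
  proof -
    have lin: "linear (frechet_derivative W (at x))"
      using smooth_on_linear_derivative[OF assms(2)] that r by blast
    have "frechet_derivative W (at x) (\<Sum>b\<in>Basis. (h \<bullet> b) *\<^sub>R b)
        = (\<Sum>b\<in>Basis. (h \<bullet> b) *\<^sub>R frechet_derivative W (at x) b)"
      by (simp only: linear_sum[OF lin] linear_cmul[OF lin])
    then have "norm (frechet_derivative W (at x) h)
        = norm (\<Sum>b\<in>Basis. (h \<bullet> b) *\<^sub>R frechet_derivative W (at x) b)"
      by (simp add: euclidean_representation)
    also have "\<dots> \<le> (\<Sum>b\<in>Basis. norm h * \<bar>M b\<bar>)"
    proof (rule sum_norm_le)
      fix b :: 'a assume b: "b \<in> Basis"
      have "\<bar>h \<bullet> b\<bar> * norm (frechet_derivative W (at x) b) \<le> norm h * \<bar>M b\<bar>"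
        using Basis_le_norm[OF b, of h] order_trans[OF M[OF that, of b] abs_ge_self]
        by (intro mult_mono) auto
      then show "norm ((h \<bullet> b) *\<^sub>R frechet_derivative W (at x) b) \<le> norm h * \<bar>M b\<bar>" by simp
    qed
    finally show ?thesis by (simp add: C_def sum_distrib_left sum_distrib_right mult.commute)
  qed
  have C0: "C \<ge> 0" unfolding C_def by (simp add: sum_nonneg)
  have "norm (W x - W y) \<le> C * norm (x - y)" if "x \<in> cball p r" "y \<in> cball p r" for x y
  proof (rule differentiable_bound[OF convex_cball[of p r], of W "\<lambda>x. frechet_derivative W (at x)"])
    show "(W has_derivative frechet_derivative W (at z)) (at z within cball p r)" if "z \<in> cball p r" for z
      using smooth_on_has_derivative[OF assms(2)] that r by (blast intro: has_derivative_at_withinI)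
    show "onorm (frechet_derivative W (at z)) \<le> C" if "z \<in> cball p r" for z
      using bd[OF that] C0 by (intro onorm_bound) auto
  qed (use that in auto)
  then show ?thesis using r C0 bd by blast
qed

lemma integral_curve_unique:
  fixes W :: "'a::real_inner \<Rightarrow> 'a"
  assumes "\<And>s. s \<in> {a<..<b} \<Longrightarrow> (\<alpha> has_vector_derivative W (\<alpha> s)) (at s)"
    and "\<And>s. s \<in> {a<..<b} \<Longrightarrow> (\<beta> has_vector_derivative W (\<beta> s)) (at s)"
    and "\<And>s. s \<in> {a<..<b} \<Longrightarrow> \<alpha> s \<in> B" "\<And>s. s \<in> {a<..<b} \<Longrightarrow> \<beta> s \<in> B"
    and "\<And>x y. x \<in> B \<Longrightarrow> y \<in> B \<Longrightarrow> norm (W x - W y) \<le> C * norm (x - y)"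
    and "t0 \<in> {a<..<b}" "\<alpha> t0 = \<beta> t0" "t \<in> {a<..<b}"
  shows "\<alpha> t = \<beta> t"
proof -
  have "\<alpha> t - \<beta> t = 0"
    by (rule gronwall_zero[of a b "\<lambda>s. \<alpha> s - \<beta> s" "\<lambda>s. W (\<alpha> s) - W (\<beta> s)" C t0])
      (use assms in \<open>auto intro!: has_vector_derivative_diff\<close>)
  then show ?thesis by simp
qed

lemma tangent_space_open:
  assumes "open A" "p \<in> A"
  shows "tangent_space A p = UNIV"
proof -
  have "w \<in> tangent_space A p" for w
  proof -
    have "((\<lambda>t. p + t *\<^sub>R w) \<longlongrightarrow> p + 0 *\<^sub>R w) (nhds 0)"
      by (intro tendsto_intros) (auto simp: filterlim_ident)
    then have "\<forall>\<^sub>F t in nhds 0. p + t *\<^sub>R w \<in> A"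
      using topological_tendstoD[of _ p _ A] assms by auto
    moreover have "((\<lambda>t. p + t *\<^sub>R w) has_vector_derivative w) (at 0)"
      by (auto intro!: derivative_eq_intros)
    ultimately show ?thesis unfolding tangent_space_def
      by (intro CollectI exI[of _ "\<lambda>t. p + t *\<^sub>R w"]) auto
  qed
  then show ?thesis by auto
qed

lemma open_interval_times_neighbourhood:
  fixes X :: "(real \<times> 'a::metric_space) set"
  assumes "open X" "(0, p) \<in> X"
  shows "\<exists>e>0. \<exists>r>0. {-e<..<e} \<times> ball p r \<subseteq> X"
proof -
  obtain A B where AB: "open A" "open B" "(0::real) \<in> A" "p \<in> B" "A \<times> B \<subseteq> X"
    using open_prod_elim[OF assms] by (metis mem_Sigma_iff)
  obtain e where "e > 0" "ball 0 e \<subseteq> A" using AB open_contains_ball by blast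
  moreover obtain r where "r > 0" "ball p r \<subseteq> B" using AB open_contains_ball by blast
  moreover have "{-e<..<e} = ball (0::real) e" by (auto simp: dist_real_def)
  ultimately show ?thesis using AB(5) by (intro exI[of _ e] exI[of _ r] conjI) auto
qed

text \<open>A continuous family of maps that starts at the identity maps a small ball into a given
  neighbourhood of its centre, for small times.\<close>

lemma flow_neighbourhood:
  fixes \<Theta> :: "real \<Rightarrow> 'a::metric_space \<Rightarrow> 'a"
  assumes "0 < e" "open A" "p \<in> A" "continuous_on ({-e<..<e} \<times> A) (\<lambda>(t, q). \<Theta> t q)"
    and "\<Theta> 0 p = p" "open B" "p \<in> B"
  shows "\<exists>e'>0. \<exists>r>0. e' \<le> e \<and> ball p r \<subseteq> A \<and> (\<forall>t\<in>{-e'<..<e'}. \<forall>q\<in>ball p r. \<Theta> t q \<in> B)"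
proof -
  let ?X = "(\<lambda>(t, q). \<Theta> t q) -` B \<inter> ({-e<..<e} \<times> A)"
  have "open ?X"
    using assms(4) by (subst (asm) continuous_on_open_vimage) (auto simp: open_Times assms)
  moreover have "(0, p) \<in> ?X" using assms by auto
  ultimately obtain e' r where *: "e' > 0" "r > 0" "{-e'<..<e'} \<times> ball p r \<subseteq> ?X"
    using open_interval_times_neighbourhood by blast
  moreover have "{-(min e e')<..<min e e'} \<times> ball p r \<subseteq> {-e'<..<e'} \<times> ball p r"
    by (intro Sigma_mono) auto
  ultimately have 1: "{-(min e e')<..<min e e'} \<times> ball p r \<subseteq> ?X" by blast
  have 2: "ball p r \<subseteq> A"
  proof
    fix q assume "q \<in> ball p r"
    then have "(0, q) \<in> {-e'<..<e'} \<times> ball p r" using * by auto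
    then show "q \<in> A" using *(3) by blast
  qed
  have 3: "\<Theta> t q \<in> B" if "t \<in> {-(min e e')<..<min e e'}" "q \<in> ball p r" for t q
    using subsetD[OF 1, of "(t, q)"] that by auto
  show ?thesis using * assms(1) 2 3
    by (intro exI[of _ "min e e'"] conjI exI[of _ r]) auto
qed

lemma smooth_on_slice:
  fixes f :: "'a::euclidean_space \<Rightarrow> 'b::euclidean_space \<Rightarrow> 'c::real_normed_vector"
  assumes "open T" "open A" "smooth_on (T \<times> A) (\<lambda>(t, q). f t q)" "t \<in> T"
  shows "smooth_on A (f t)"
proof -
  have "smooth_on A (\<lambda>q. (t, q))"
    by (rule smooth_on_Pair[OF assms(2) smooth_on_const smooth_on_ident[OF assms(2)]])
  from smooth_on_compose[OF assms(2) open_Times[OF assms(1,2)] _ this assms(3)] assms(4)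
  show ?thesis by auto
qed

text \<open>Smooth solutions of the flow equation are invertible for small times by uniqueness of
  integral curves, the inverse being the flow for the opposite time. If their derivatives map
  a distribution into itself, the same holds for the inverses, so that they preserve it.\<close>

lemma infinitesimal_symmetry_of_flow:
  fixes W :: "'a::euclidean_space \<Rightarrow> 'a"
  assumes e: "0 < e" and A: "open A" and W: "smooth_on A W"
    and smooth: "smooth_on ({-e<..<e} \<times> A) (\<lambda>(t, q). \<Theta> t q)"
    and init: "\<And>q. q \<in> A \<Longrightarrow> \<Theta> 0 q = q"
    and flow: "\<And>t q. t \<in> {-e<..<e} \<Longrightarrow> q \<in> A \<Longrightarrow>
      ((\<lambda>s. \<Theta> s q) has_vector_derivative W (\<Theta> t q)) (at t)"
    and D: "\<And>t q w. t \<in> {-e<..<e} \<Longrightarrow> q \<in> A \<Longrightarrow> w \<in> D q \<Longrightarrow>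
      frechet_derivative (\<Theta> t) (at q) w \<in> D (\<Theta> t q)"
  shows "infinitesimal_symmetry A D W"
  unfolding infinitesimal_symmetry_def
proof (intro conjI ballI)
  show "vector_field_on A W"
    unfolding vector_field_on_def using A W smooth_map_on_open tangent_space_open by blast
next
  fix p assume p: "p \<in> A"
  have cont: "continuous_on ({-e<..<e} \<times> A) (\<lambda>(t, q). \<Theta> t q)"
    by (rule smooth_on_continuous_on[OF smooth])
  obtain r C where r: "r > 0" "cball p r \<subseteq> A"
    and lip: "\<And>x y. x \<in> cball p r \<Longrightarrow> y \<in> cball p r \<Longrightarrow> norm (W x - W y) \<le> C * norm (x - y)"
    using smooth_on_locally_bounded_derivative[OF A W p] by metis
  obtain e1 r1 where e1: "e1 > 0" "r1 > 0" "e1 \<le> e" "ball p r1 \<subseteq> A"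
    and in1: "\<And>t q. t \<in> {-e1<..<e1} \<Longrightarrow> q \<in> ball p r1 \<Longrightarrow> \<Theta> t q \<in> ball p r"
    using flow_neighbourhood[OF e A p cont init[OF p] open_ball[of p r]] r by auto
  obtain e2' r2 where e2': "e2' > 0" "r2 > 0" "e2' \<le> e"
    and in2: "\<And>t q. t \<in> {-e2'<..<e2'} \<Longrightarrow> q \<in> ball p r2 \<Longrightarrow> \<Theta> t q \<in> ball p r1"
    using flow_neighbourhood[OF e A p cont init[OF p] open_ball[of p r1]] e1 by auto
  define e2 where "e2 = min (e1 / 2) e2'"
  define N where "N = ball p (min r1 r2)"
  have e2: "e2 > 0" "e2 \<le> e1 / 2" "e2 \<le> e2'" using e1 e2' by (auto simp: e2_def)
  have NA: "N \<subseteq> ball p r1" "N \<subseteq> ball p r2" "N \<subseteq> A" "p \<in> N" "open N"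
    using e1 e2' unfolding N_def by auto
  \<comment> \<open>The local group law: both sides are integral curves in \<open>s\<close> with the same value at \<open>s = 0\<close>.\<close>
  have group: "\<Theta> s (\<Theta> a q) = \<Theta> (a + s) q"
    if "q \<in> ball p r1" "\<bar>a\<bar> < e1 / 2" "\<Theta> a q \<in> ball p r1" "\<bar>s\<bar> < e1 / 2" for a s q
  proof (rule integral_curve_unique[of "- e1 / 2" "e1 / 2" "\<lambda>s. \<Theta> s (\<Theta> a q)" W
        "\<lambda>s. \<Theta> (a + s) q" "cball p r" C 0])
    fix s' assume s': "s' \<in> {- e1 / 2<..<e1 / 2}"
    have s1: "s' \<in> {-e1<..<e1}" "a + s' \<in> {-e1<..<e1}"
      using s' that e1 by (auto simp: abs_if split: if_splits)
    then have s2: "s' \<in> {-e<..<e}" "a + s' \<in> {-e<..<e}" using e1 by auto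
    show "((\<lambda>s. \<Theta> s (\<Theta> a q)) has_vector_derivative W (\<Theta> s' (\<Theta> a q))) (at s')"
      using flow[OF s2(1)] that e1 by blast
    have "((\<lambda>s. \<Theta> s q) \<circ> (\<lambda>s. a + s) has_vector_derivative 1 *\<^sub>R W (\<Theta> (a + s') q)) (at s')"
      using flow[OF s2(2)] that e1 by (intro vector_diff_chain_at) (auto intro!: derivative_eq_intros)
    then show "((\<lambda>s. \<Theta> (a + s) q) has_vector_derivative W (\<Theta> (a + s') q)) (at s')"
      by (simp add: o_def)
    show "\<Theta> s' (\<Theta> a q) \<in> cball p r" "\<Theta> (a + s') q \<in> cball p r"
      using in1 s1 that ball_subset_cball by blast+
  qed (use that e1 lip init in \<open>auto simp: abs_less_iff\<close>)
  show "\<exists>e N \<Phi>. p \<in> N \<and> local_flow A W e N \<Phi> \<and> (\<forall>t\<in>{-e<..<e}. local_symmetry A D N (\<Phi> t))"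
  proof (intro exI conjI ballI)
    show "p \<in> N" by (rule NA)
    have sub: "{-e2<..<e2} \<subseteq> {-e<..<e}" using e1 e2 by auto
    have smooth2: "smooth_map_on ({-e2<..<e2} \<times> N) (\<lambda>(t, q). \<Theta> t q)"
      using smooth_map_on_open[OF smooth] A sub NA by (simp add: open_Times Sigma_mono)
    show "local_flow A W e2 N \<Theta>"
      unfolding local_flow_def
    proof (intro conjI ballI e2 smooth2)
      show "openin (top_of_set A) N" using NA A by (simp add: openin_open_eq)
      show "\<Theta> 0 q = q" if "q \<in> N" for q using that NA init by blast
      show "\<Theta> t q \<in> A" if "q \<in> N" "t \<in> {-e2<..<e2}" for q t
        using in2[of t q] that NA(2) e1(4) e2(3) subsetD[OF NA(2), of q] by (auto dest: subsetD)
      show "((\<lambda>s. \<Theta> s q) has_vector_derivative W (\<Theta> t q)) (at t)"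
        if "q \<in> N" "t \<in> {-e2<..<e2}" for q t
        using flow that sub NA by blast
    qed
    fix t assume t: "t \<in> {-e2<..<e2}"
    have t': "-t \<in> {-e2<..<e2}" "\<bar>t\<bar> < e1 / 2" "\<bar>-t\<bar> < e1 / 2" "t \<in> {-e<..<e}" "- t \<in> {-e<..<e}"
      "t \<in> {-e2'<..<e2'}" "- t \<in> {-e2'<..<e2'}"
      using t e2 sub e1 e2' by auto
    have inN: "\<Theta> t q \<in> ball p r1" if "q \<in> N" for q
      using in2 t'(6) that NA by blast
    have inv1: "\<Theta> (-t) (\<Theta> t q) = q" if "q \<in> N" for q
      using group[OF subsetD[OF NA(1) that] t'(2) inN[OF that] t'(3)] init[OF subsetD[OF NA(3) that]] by simp
    have inv2: "\<Theta> t (\<Theta> (-t) x) = x" if "x \<in> ball p r1" "\<Theta> (-t) x \<in> N" for x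
      using group[OF that(1) t'(3) subsetD[OF NA(1) that(2)] t'(2)] init[OF subsetD[OF e1(4) that(1)]] by simp
    have slice: "smooth_on A (\<Theta> s)" if "s \<in> {-e<..<e}" for s
      by (rule smooth_on_slice[OF _ A smooth that]) simp
    have image: "\<Theta> t ` N = \<Theta> (-t) -` N \<inter> ball p r1"
      using inN inv1 inv2 by force
    have "open (\<Theta> (-t) -` N \<inter> ball p r1)"
    proof -
      have "continuous_on (ball p r1) (\<Theta> (-t))"
        using smooth_on_continuous_on[OF slice[OF t'(5)]] e1(4) continuous_on_subset by blast
      then show ?thesis using NA(5) by (subst (asm) continuous_on_open_vimage) auto
    qed
    then have openi: "open (\<Theta> t ` N)" using image by simp
    have imA: "\<Theta> t ` N \<subseteq> A" using image e1 by blast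
    have inj: "inj_on (\<Theta> t) N" using inv1 by (metis inj_onI)
    have inv_eq: "inv_into N (\<Theta> t) x = \<Theta> (-t) x" if "x \<in> \<Theta> t ` N" for x
      using that inv1 inj by auto
    show "local_symmetry A D N (\<Theta> t)"
      unfolding local_symmetry_def diffeomorphism_on_def preserves_distribution_def
    proof (intro conjI ballI)
      show "openin (top_of_set A) N" "openin (top_of_set A) (\<Theta> t ` N)"
        using NA A imA openi by (simp_all add: openin_open_eq)
      show "bij_betw (\<Theta> t) N (\<Theta> t ` N)" using inj by (simp add: bij_betw_def)
      show "smooth_map_on N (\<Theta> t)" using smooth_map_on_open[OF slice[OF t'(4)] A NA(3)] .
      show "smooth_map_on (\<Theta> t ` N) (inv_into N (\<Theta> t))"
        unfolding smooth_map_on_def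
        using openi inv_eq smooth_on_subset[OF slice[OF t'(5)] imA]
        by (intro ballI exI[of _ "\<Theta> t ` N"] exI[of _ "\<Theta> (-t)"]) auto
      fix q assume q: "q \<in> N"
      let ?L = "frechet_derivative (\<Theta> t) (at q)"
      let ?K = "frechet_derivative (\<Theta> (-t)) (at (\<Theta> t q))"
      have dL: "(\<Theta> t has_derivative ?L) (at q)"
        using smooth_on_has_derivative[OF slice[OF t'(4)]] q NA by blast
      have dK: "(\<Theta> (-t) has_derivative ?K) (at (\<Theta> t q))"
        using smooth_on_has_derivative[OF slice[OF t'(5)]] q imA by blast
      have LK: "?L (?K w) = w" for w
      proof -
        have "(\<Theta> t has_derivative ?L) (at (\<Theta> (-t) (\<Theta> t q)))" using dL inv1[OF q] by simp
        from has_derivative_compose[OF dK this]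
        have "((\<lambda>x. \<Theta> t (\<Theta> (-t) x)) has_derivative (\<lambda>w. ?L (?K w))) (at (\<Theta> t q))" .
        then have "((\<lambda>x. x) has_derivative (\<lambda>w. ?L (?K w))) (at (\<Theta> t q))"
          using inv1 q by (elim has_derivative_transform_within_open[OF _ openi]) auto
        from has_derivative_unique[OF this has_derivative_ident] show ?thesis by metis
      qed
      show "\<exists>L. (\<Theta> t has_derivative L) (at q within N) \<and> L ` D q = D (\<Theta> t q)"
      proof (intro exI[of _ ?L] conjI has_derivative_at_withinI[OF dL])
        show "?L ` D q = D (\<Theta> t q)"
        proof
          show "?L ` D q \<subseteq> D (\<Theta> t q)" using D[OF t'(4)] q NA by blast
          show "D (\<Theta> t q) \<subseteq> ?L ` D q"
          proof
            fix w assume "w \<in> D (\<Theta> t q)"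
            then have "?K w \<in> D (\<Theta> (-t) (\<Theta> t q))" using D[OF t'(5)] imA q by blast
            then show "w \<in> ?L ` D q" using LK[of w] inv1[OF q] by (metis imageI)
          qed
        qed
      qed
    qed
  qed
qed

text \<open>Time derivatives commute with derivatives in space.\<close>

lemma time_derivative_of_slice_derivative:
  fixes f :: "real \<Rightarrow> 'a::euclidean_space \<Rightarrow> real"
  assumes T: "open T" and A: "open A" and f: "smooth_on (T \<times> A) (\<lambda>(t, q). f t q)"
    and g: "\<And>t q. t \<in> T \<Longrightarrow> q \<in> A \<Longrightarrow> ((\<lambda>s. f s q) has_real_derivative g t q) (at t)"
    and tq: "t \<in> T" "q \<in> A"
  shows "((\<lambda>s. frechet_derivative (f s) (at q) w) has_real_derivative
      frechet_derivative (g t) (at q) w) (at t)"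
proof -
  let ?f = "\<lambda>(t, q). f t q"
  let ?f' = "\<lambda>h x. frechet_derivative ?f (at x) h"
  have TA: "open (T \<times> A)" using T A by (simp add: open_Times)
  have sl: "frechet_derivative (\<lambda>q. u (s, q)) (at q) w = frechet_derivative u (at (s, q)) (0, w)"
    if "smooth_on (T \<times> A) u" "s \<in> T" "q \<in> A" for u :: "real \<times> 'a \<Rightarrow> real" and s q w
  proof -
    have "(Pair s has_derivative Pair 0) (at q)"
      by (auto intro!: derivative_eq_intros)
    from has_derivative_compose[OF this smooth_on_has_derivative[OF that(1)]] that(2,3)
    have "((\<lambda>q. u (s, q)) has_derivative (\<lambda>w. frechet_derivative u (at (s, q)) (0, w))) (at q)" by simp
    from frechet_derivative_at[OF this] show ?thesis by metis
  qed
  have ti: "((\<lambda>s. u (s, q)) has_real_derivative frechet_derivative u (at (t, q)) (1, 0)) (at t)"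
    if "smooth_on (T \<times> A) u" "t \<in> T" "q \<in> A" for u :: "real \<times> 'a \<Rightarrow> real" and t q
  proof -
    have "((\<lambda>s. (s, q)) has_derivative (\<lambda>r. (r, 0))) (at t)"
      by (auto intro!: derivative_eq_intros)
    from has_derivative_compose[OF this smooth_on_has_derivative[OF that(1)]] that(2,3)
    have "((\<lambda>s. u (s, q)) has_derivative (\<lambda>r. frechet_derivative u (at (t, q)) (r, 0))) (at t)" by simp
    moreover have "(\<lambda>r. frechet_derivative u (at (t, q)) (r, 0))
        = (*) (frechet_derivative u (at (t, q)) (1, 0))"
    proof
      fix r
      have "frechet_derivative u (at (t, q)) (r *\<^sub>R (1, 0))
          = r *\<^sub>R frechet_derivative u (at (t, q)) (1, 0)"
        using linear_cmul[OF smooth_on_linear_derivative[OF that(1)]] that(2,3) by blast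
      then show "frechet_derivative u (at (t, q)) (r, 0)
          = frechet_derivative u (at (t, q)) (1, 0) * r" by (simp add: mult.commute)
    qed
    ultimately show ?thesis by (simp only: has_field_derivative_def)
  qed
  have g': "g s q' = ?f' (1, 0) (s, q')" if "s \<in> T" "q' \<in> A" for s q'
    using DERIV_unique[OF g[OF that]] ti[OF f that] by simp
  have "frechet_derivative (g t) (at q) w = frechet_derivative (\<lambda>q. ?f' (1, 0) (t, q)) (at q) w"
  proof -
    have "((\<lambda>q. ?f' (1, 0) (t, q)) has_derivative
        frechet_derivative (\<lambda>q. ?f' (1, 0) (t, q)) (at q)) (at q)"
    proof -
      have "smooth_on A (\<lambda>q. ?f' (1, 0) (t, q))"
        by (rule smooth_on_slice[OF T A, of "\<lambda>t q. ?f' (1, 0) (t, q)"])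
          (use smooth_on_derivative_const[OF f] tq in \<open>simp_all add: case_prod_unfold\<close>)
      from smooth_on_has_derivative[OF this tq(2)] show ?thesis .
    qed
    then have "(g t has_derivative frechet_derivative (\<lambda>q. ?f' (1, 0) (t, q)) (at q)) (at q)"
      by (rule has_derivative_transform_within_open[OF _ A]) (use tq g' in auto)
    from frechet_derivative_at[OF this] show ?thesis by metis
  qed
  also have "\<dots> = frechet_derivative (?f' (1, 0)) (at (t, q)) (0, w)"
    by (rule sl[OF smooth_on_derivative_const[OF f] tq])
  also have "\<dots> = frechet_derivative (?f' (0, w)) (at (t, q)) (1, 0)"
    by (rule smooth_on_derivative_commute[OF TA f]) (use tq in auto)
  finally have eq: "frechet_derivative (g t) (at q) w = frechet_derivative (?f' (0, w)) (at (t, q)) (1, 0)" .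
  have "((\<lambda>s. ?f' (0, w) (s, q)) has_real_derivative
      frechet_derivative (g t) (at q) w) (at t)"
    unfolding eq by (rule ti[OF smooth_on_derivative_const[OF f] tq])
  then show ?thesis
  proof (rule has_field_derivative_transform_within_open[OF _ T tq(1)])
    show "?f' (0, w) (s, q) = frechet_derivative (f s) (at q) w" if "s \<in> T" for s
      using sl[OF f that tq(2), of w] by (simp add: case_prod_conv)
  qed
qed

section \<open>Jet coordinates and the equation manifold\<close>

lemma jet_vars_simps [simp]:
  "JX \<in> jet_vars m n" "JY i \<in> jet_vars m n \<longleftrightarrow> i \<le> m" "JZ j \<in> jet_vars m n \<longleftrightarrow> j \<le> n"
  by (auto simp: jet_vars_def)

text \<open>Monge equations of orders \<open>m \<le> n\<close>, without the nondegeneracy condition.\<close>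

locale monge =
  fixes m n :: nat and c :: "jet_var \<Rightarrow> 'k::finite"
    and U :: "(real ^ 'k) set" and F :: "real ^ 'k \<Rightarrow> real"
  assumes m_pos: "0 < m" and m_le_n: "m \<le> n"
    and labelling: "jet_labelling m n c"
    and rhs: "monge_rhs m n c U F"
begin

text \<open>The equation manifold, and the indices of the highest variables.\<close>

abbreviation E :: "(real ^ 'k) set" where "E \<equiv> monge_eq m c U F"

abbreviation ym :: 'k where "ym \<equiv> c (JY m)"

abbreviation zn :: 'k where "zn \<equiv> c (JZ n)"

lemma label_eq [simp]: "a \<in> jet_vars m n \<Longrightarrow> b \<in> jet_vars m n \<Longrightarrow> c a = c b \<longleftrightarrow> a = b"
  using labelling unfolding jet_labelling_def bij_betw_def inj_on_def by blast

lemma label_cases: obtains a where "a \<in> jet_vars m n" "i = c a"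
  using labelling unfolding jet_labelling_def bij_betw_def by blast

lemma open_U: "open U" and smooth_F: "smooth_on U F"
  using rhs unfolding monge_rhs_def by auto

lemma U_F_invariant:
  assumes "q \<in> U" "\<And>i. i \<noteq> ym \<Longrightarrow> q' $ i = q $ i"
  shows "q' \<in> U" "F q' = F q"
proof -
  have "\<forall>a\<in>jet_vars m n - {JY m}. q' $ c a = q $ c a" using assms(2) by simp
  then show "q' \<in> U" "F q' = F q" using rhs assms(1) unfolding monge_rhs_def by blast+
qed

text \<open>The projection of the jet space to the equation manifold along \<open>y\<^sub>m\<close>. Functions on the
  equation manifold are handled through their pullback by this map.\<close>

definition to_eq :: "real ^ 'k \<Rightarrow> real ^ 'k" where
  "to_eq q = q + (F q - q $ ym) *\<^sub>R axis ym 1"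

lemma to_eq_nth: "to_eq q $ i = (if i = ym then F q else q $ i)"
  by (simp add: to_eq_def axis_def)

lemma to_eq_U: "q \<in> U \<Longrightarrow> to_eq q \<in> U" "q \<in> U \<Longrightarrow> F (to_eq q) = F q"
  using U_F_invariant[of q "to_eq q"] by (auto simp: to_eq_nth)

lemma to_eq_in: "q \<in> U \<Longrightarrow> to_eq q \<in> E"
  using to_eq_U[of q] by (simp add: monge_eq_def to_eq_nth)

lemma E_subset_U: "E \<subseteq> U"
  by (auto simp: monge_eq_def)

lemma to_eq_id: "q \<in> E \<Longrightarrow> to_eq q = q"
  by (simp add: monge_eq_def to_eq_def)

lemma smooth_to_eq: "smooth_on U to_eq"
  unfolding to_eq_def using open_U smooth_F
  by (intro smooth_on_add smooth_on_scaleR smooth_on_diff smooth_on_const smooth_on_ident smooth_on_nth)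

lemma has_derivative_to_eq:
  assumes "q \<in> U"
  shows "(to_eq has_derivative (\<lambda>w. w + (frechet_derivative F (at q) w - w $ ym) *\<^sub>R axis ym 1)) (at q)"
  unfolding to_eq_def
  using smooth_on_has_derivative[OF smooth_F assms]
  by (auto intro!: derivative_eq_intros bounded_linear.has_derivative[OF bounded_linear_vec_nth])

lemma tangent_space_E:
  assumes "q \<in> E"
  shows "tangent_space E q = {w. w $ ym = frechet_derivative F (at q) w}"
proof
  have q: "q \<in> U" using assms E_subset_U by blast
  show "tangent_space E q \<subseteq> {w. w $ ym = frechet_derivative F (at q) w}"
  proof
    fix w assume "w \<in> tangent_space E q"
    then obtain \<gamma> where \<gamma>: "\<gamma> (0::real) = q" "\<forall>\<^sub>F t in nhds 0. \<gamma> t \<in> E"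
      "(\<gamma> has_vector_derivative w) (at 0)" unfolding tangent_space_def by blast
    obtain S where S: "open S" "0 \<in> S" "\<And>t. t \<in> S \<Longrightarrow> \<gamma> t \<in> E"
      using \<gamma>(2) unfolding eventually_nhds by blast
    have d: "(\<gamma> has_derivative (\<lambda>t. t *\<^sub>R w)) (at 0)"
      using \<gamma>(3) by (simp add: has_vector_derivative_def)
    have "(F has_derivative frechet_derivative F (at q)) (at (\<gamma> 0))"
      using smooth_on_has_derivative[OF smooth_F q] \<gamma>(1) by simp
    from has_derivative_compose[OF d this]
    have "((\<lambda>t. \<gamma> t $ ym - F (\<gamma> t)) has_derivative
        (\<lambda>t. (t *\<^sub>R w) $ ym - frechet_derivative F (at q) (t *\<^sub>R w))) (at 0)"
      by (intro has_derivative_diff bounded_linear.has_derivative[OF bounded_linear_vec_nth d])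
    then have "((\<lambda>t. 0) has_derivative
        (\<lambda>t. (t *\<^sub>R w) $ ym - frechet_derivative F (at q) (t *\<^sub>R w))) (at (0::real))"
      by (rule has_derivative_transform_within_open[OF _ S(1,2)])
        (use S(3) in \<open>auto simp: monge_eq_def\<close>)
    from has_derivative_unique[OF this has_derivative_const]
    have "(1 *\<^sub>R w) $ ym - frechet_derivative F (at q) (1 *\<^sub>R w) = 0" by metis
    then show "w \<in> {w. w $ ym = frechet_derivative F (at q) w}" by simp
  qed
  show "{w. w $ ym = frechet_derivative F (at q) w} \<subseteq> tangent_space E q"
  proof
    fix w assume w: "w \<in> {w. w $ ym = frechet_derivative F (at q) w}"
    have d: "((\<lambda>t. q + t *\<^sub>R w) has_derivative (\<lambda>t. t *\<^sub>R w)) (at 0)"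
      by (auto intro!: derivative_eq_intros)
    have "((\<lambda>t. q + t *\<^sub>R w) \<longlongrightarrow> q + 0 *\<^sub>R w) (nhds 0)"
      by (intro tendsto_intros) (auto simp: filterlim_ident)
    then have "\<forall>\<^sub>F t in nhds 0. q + t *\<^sub>R w \<in> U"
      using topological_tendstoD[of _ q _ U] open_U q by auto
    then have "\<forall>\<^sub>F t in nhds 0. to_eq (q + t *\<^sub>R w) \<in> E"
      by (rule eventually_mono) (rule to_eq_in)
    moreover have "(to_eq has_derivative (\<lambda>w. w + (frechet_derivative F (at q) w - w $ ym) *\<^sub>R axis ym 1))
        (at (q + 0 *\<^sub>R w))"
      using has_derivative_to_eq[OF q] by simp
    from has_derivative_compose[OF d this] w
    have "((\<lambda>t. to_eq (q + t *\<^sub>R w)) has_vector_derivative w) (at 0)"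
      using linear_cmul[OF smooth_on_linear_derivative[OF smooth_F q]]
      by (simp add: has_vector_derivative_def)
    ultimately show "w \<in> tangent_space E q" unfolding tangent_space_def
      using to_eq_id[OF assms] by (intro CollectI exI[of _ "\<lambda>t. to_eq (q + t *\<^sub>R w)"]) auto
  qed
qed

section \<open>External symmetries restrict to internal symmetries\<close>

lemma tangent_space_image:
  assumes "openin (top_of_set E) N" "f ` N \<subseteq> E" "q \<in> N" "(f has_derivative L) (at q within N)"
    "w \<in> tangent_space E q"
  shows "L w \<in> tangent_space E (f q)"
proof -
  obtain \<gamma> where \<gamma>: "\<gamma> (0::real) = q" "\<forall>\<^sub>F t in nhds 0. \<gamma> t \<in> E"
    "(\<gamma> has_vector_derivative w) (at 0)" using assms(5) unfolding tangent_space_def by blast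
  obtain Q where Q: "open Q" "N = E \<inter> Q" using assms(1) unfolding openin_open by blast
  have d: "(\<gamma> has_derivative (\<lambda>t. t *\<^sub>R w)) (at 0)"
    using \<gamma>(3) by (simp add: has_vector_derivative_def)
  have "isCont \<gamma> 0" using has_derivative_continuous[OF d] .
  then have "\<forall>\<^sub>F t in nhds 0. \<gamma> t \<in> Q"
    using Q assms(3) \<gamma>(1) by (auto simp: continuous_at_open eventually_nhds)
  with \<gamma>(2) have "\<forall>\<^sub>F t in nhds 0. \<gamma> t \<in> N" unfolding Q by eventually_elim auto
  then obtain S where S: "open S" "0 \<in> S" "\<And>t. t \<in> S \<Longrightarrow> \<gamma> t \<in> N" unfolding eventually_nhds by blast
  have "(\<gamma> has_derivative (\<lambda>t. t *\<^sub>R w)) (at 0 within S)" using d by (rule has_derivative_at_withinI)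
  moreover have "(f has_derivative L) (at (\<gamma> 0) within \<gamma> ` S)"
    using assms(4) \<gamma>(1) S(3) has_derivative_subset by (metis image_subsetI)
  ultimately have "((\<lambda>t. f (\<gamma> t)) has_derivative (\<lambda>t. L (t *\<^sub>R w))) (at 0 within S)"
    using has_derivative_in_compose by blast
  then have "((\<lambda>t. f (\<gamma> t)) has_derivative (\<lambda>t. L (t *\<^sub>R w))) (at 0)"
    using S at_within_open by metis
  then have "((\<lambda>t. f (\<gamma> t)) has_vector_derivative L w) (at 0)"
    using linear_cmul[OF has_derivative_linear[OF assms(4)]]
    by (simp add: has_vector_derivative_def)
  moreover have "\<forall>\<^sub>F t in nhds 0. f (\<gamma> t) \<in> E"
    unfolding eventually_nhds using S assms(2) by blast
  ultimately show ?thesis unfolding tangent_space_def using \<gamma>(1)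
    by (intro CollectI exI[of _ "\<lambda>t. f (\<gamma> t)"]) auto
qed

text \<open>Along an integral curve, the time derivative of \<open>y\<^sub>m - F\<close> is a function that vanishes on \<open>E\<close>;
  as it is locally Lipschitz, it is bounded by a multiple of \<open>y\<^sub>m - F\<close> itself.\<close>

lemma flow_stays_in_equation:
  assumes A: "open A" and W: "smooth_on A W" and tan: "\<And>q. q \<in> E \<inter> A \<Longrightarrow> W q \<in> tangent_space E q"
    and p: "p \<in> E \<inter> A"
  obtains r where "r > 0" "ball p r \<subseteq> A \<inter> U"
    and "\<And>a b \<gamma> t0 t. (\<And>s. s \<in> {a<..<b} \<Longrightarrow> \<gamma> s \<in> ball p r) \<Longrightarrow>
      (\<And>s. s \<in> {a<..<b} \<Longrightarrow> (\<gamma> has_vector_derivative W (\<gamma> s)) (at s)) \<Longrightarrow>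
      t0 \<in> {a<..<b} \<Longrightarrow> t \<in> {a<..<b} \<Longrightarrow> \<gamma> t0 \<in> E \<Longrightarrow> \<gamma> t \<in> E"
proof -
  define k where "k q = W q $ ym - frechet_derivative F (at q) (W q)" for q
  have S: "open (A \<inter> U)" using A open_U by auto
  have pS: "p \<in> A \<inter> U" using p E_subset_U by blast
  have "smooth_on (A \<inter> U) k" unfolding k_def
    using S smooth_on_subset[OF W, of "A \<inter> U"] smooth_on_subset[OF smooth_F, of "A \<inter> U"]
    by (intro smooth_on_diff smooth_on_nth smooth_on_derivative) auto
  from smooth_on_locally_bounded_derivative[OF S this pS]
  obtain r0 C where r0: "r0 > 0" "cball p r0 \<subseteq> A \<inter> U"
    and lip: "\<And>x y. x \<in> cball p r0 \<Longrightarrow> y \<in> cball p r0 \<Longrightarrow> norm (k x - k y) \<le> C * norm (x - y)"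
    by metis
  have "isCont to_eq p"
    using has_derivative_continuous[OF has_derivative_to_eq] pS by blast
  then obtain r1 where r1: "r1 > 0" "\<And>q. dist q p < r1 \<Longrightarrow> dist (to_eq q) (to_eq p) < r0"
    using r0(1) unfolding continuous_at_eps_delta by blast
  define r where "r = min r0 r1"
  have rb: "ball p r \<subseteq> cball p r0" "to_eq ` ball p r \<subseteq> cball p r0"
    using r1(2) to_eq_id[of p] p by (auto simp: r_def dist_commute less_imp_le)
  show thesis
  proof (rule that[of r])
    show "r > 0" "ball p r \<subseteq> A \<inter> U" using r0 r1 rb by (auto simp: r_def)
    fix a b \<gamma> t0 t
    assume \<gamma>: "\<And>s. s \<in> {a<..<b} \<Longrightarrow> \<gamma> s \<in> ball p r"
        "\<And>s. s \<in> {a<..<b} \<Longrightarrow> (\<gamma> has_vector_derivative W (\<gamma> s)) (at s)"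
      and t0: "t0 \<in> {a<..<b}" and t: "t \<in> {a<..<b}" and t0': "\<gamma> t0 \<in> E"
    have inU: "\<gamma> s \<in> U" if "s \<in> {a<..<b}" for s using \<gamma> that rb r0 by blast
    have "\<gamma> t $ ym - F (\<gamma> t) = 0"
    proof (rule gronwall_zero[of a b "\<lambda>s. \<gamma> s $ ym - F (\<gamma> s)" "\<lambda>s. k (\<gamma> s)" C t0])
      fix s assume s: "s \<in> {a<..<b}"
      have "(\<gamma> has_derivative (\<lambda>t. t *\<^sub>R W (\<gamma> s))) (at s)"
        using \<gamma> s by (simp add: has_vector_derivative_def)
      from has_derivative_compose[OF this smooth_on_has_derivative[OF smooth_F inU[OF s]]]
        bounded_linear.has_derivative[OF bounded_linear_vec_nth this]
      have "((\<lambda>t. \<gamma> t $ ym - F (\<gamma> t)) has_derivative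
        (\<lambda>t. (t *\<^sub>R W (\<gamma> s)) $ ym - frechet_derivative F (at (\<gamma> s)) (t *\<^sub>R W (\<gamma> s)))) (at s)"
        by (intro has_derivative_diff)
      then show "((\<lambda>t. \<gamma> t $ ym - F (\<gamma> t)) has_vector_derivative k (\<gamma> s)) (at s)"
        using linear_cmul[OF smooth_on_linear_derivative[OF smooth_F inU[OF s]]]
        by (simp add: has_vector_derivative_def k_def algebra_simps)
      have eq: "to_eq (\<gamma> s) \<in> cball p r0" "\<gamma> s \<in> cball p r0" using \<gamma> s rb by blast+
      then have "to_eq (\<gamma> s) \<in> E \<inter> A" using to_eq_in[OF inU[OF s]] r0 by blast
      from tan[OF this] tangent_space_E[of "to_eq (\<gamma> s)"] this
      have "k (to_eq (\<gamma> s)) = 0" by (auto simp: k_def)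
      moreover have "norm (\<gamma> s - to_eq (\<gamma> s)) = \<bar>\<gamma> s $ ym - F (\<gamma> s)\<bar>"
        by (simp add: to_eq_def)
      ultimately show "norm (k (\<gamma> s)) \<le> C * norm (\<gamma> s $ ym - F (\<gamma> s))"
        using lip[OF eq(2,1)] by simp
    qed (use t0 t0' t in \<open>auto simp: monge_eq_def\<close>)
    then show "\<gamma> t \<in> E" using inU[OF t] by (simp add: monge_eq_def)
  qed
qed

lemma external_symmetry_internal:
  assumes "external_symmetry m n c E A W"
  shows "internal_symmetry m n c E (E \<inter> A) W"
  unfolding internal_symmetry_def infinitesimal_symmetry_def vector_field_on_def
proof (intro conjI ballI)
  let ?C = "cartan m n c" and ?D = "monge_distribution m n c E"
  have A: "open A" and sym: "infinitesimal_symmetry A ?C W"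
    and tan: "\<And>q. q \<in> E \<inter> A \<Longrightarrow> W q \<in> tangent_space E q"
    using assms unfolding external_symmetry_def infinitesimal_lie_transformation_def by auto
  show V: "openin (top_of_set E) (E \<inter> A)" using A by auto
  have WA: "smooth_map_on A W"
    using sym unfolding infinitesimal_symmetry_def vector_field_on_def by blast
  then show "smooth_map_on (E \<inter> A) W" by (rule smooth_map_on_subset) blast
  have W: "smooth_on A W" using WA smooth_map_on_open_iff[OF A] by blast
  show "W q \<in> tangent_space (E \<inter> A) q" if q: "q \<in> E \<inter> A" for q
  proof -
    obtain \<gamma> where \<gamma>: "\<gamma> (0::real) = q" "\<forall>\<^sub>F t in nhds 0. \<gamma> t \<in> E"
      "(\<gamma> has_vector_derivative W q) (at 0)" using tan[OF q] unfolding tangent_space_def by blast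
    have "isCont \<gamma> 0" using \<gamma>(3) has_vector_derivative_continuous by blast
    then have "\<forall>\<^sub>F t in nhds 0. \<gamma> t \<in> A"
      using A q \<gamma>(1) by (auto simp: continuous_at_open eventually_nhds)
    with \<gamma>(2) have "\<forall>\<^sub>F t in nhds 0. \<gamma> t \<in> E \<inter> A" by eventually_elim auto
    then show ?thesis unfolding tangent_space_def using \<gamma> by blast
  qed
  fix p assume p: "p \<in> E \<inter> A"
  then obtain e N \<Phi> where pN: "p \<in> N" and flow: "local_flow A W e N \<Phi>"
    and sy: "\<And>t. t \<in> {-e<..<e} \<Longrightarrow> local_symmetry A ?C N (\<Phi> t)"
    using sym unfolding infinitesimal_symmetry_def by blast
  have e: "0 < e" and N: "open N" "N \<subseteq> A"
    using flow A unfolding local_flow_def by (auto simp: openin_open_eq)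
  have sm: "smooth_on ({-e<..<e} \<times> N) (\<lambda>(t, q). \<Phi> t q)"
    using flow smooth_map_on_open_iff[of "{-e<..<e} \<times> N"] N unfolding local_flow_def
    by (auto simp: open_Times)
  have init: "\<Phi> 0 q = q" if "q \<in> N" for q using flow that unfolding local_flow_def by blast
  have der: "((\<lambda>s. \<Phi> s q) has_vector_derivative W (\<Phi> t q)) (at t)" if "q \<in> N" "t \<in> {-e<..<e}" for q t
    using flow that unfolding local_flow_def by blast
  show "\<exists>e N \<Phi>. p \<in> N \<and> local_flow (E \<inter> A) W e N \<Phi> \<and>
      (\<forall>t\<in>{-e<..<e}. local_symmetry (E \<inter> A) ?D N (\<Phi> t))"
  proof (rule flow_stays_in_equation[OF A W tan p])
    fix r assume r: "r > 0" "ball p r \<subseteq> A \<inter> U"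
      and stay: "\<And>a b \<gamma> t0 t. (\<And>s. s \<in> {a<..<b} \<Longrightarrow> \<gamma> s \<in> ball p r) \<Longrightarrow>
        (\<And>s. s \<in> {a<..<b} \<Longrightarrow> (\<gamma> has_vector_derivative W (\<gamma> s)) (at s)) \<Longrightarrow>
        t0 \<in> {a<..<b} \<Longrightarrow> t \<in> {a<..<b} \<Longrightarrow> \<gamma> t0 \<in> E \<Longrightarrow> \<gamma> t \<in> E"
    obtain e1 r1 where e1: "e1 > 0" "r1 > 0" "e1 \<le> e" "ball p r1 \<subseteq> N"
      and in1: "\<And>t q. t \<in> {-e1<..<e1} \<Longrightarrow> q \<in> ball p r1 \<Longrightarrow> \<Phi> t q \<in> ball p r"
      using flow_neighbourhood[OF e N(1) pN smooth_on_continuous_on[OF sm] init[OF pN] open_ball[of p r]]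
        r(1) by auto
    have E_iff: "\<Phi> t q \<in> E \<longleftrightarrow> q \<in> E" if "t \<in> {-e1<..<e1}" "q \<in> ball p r1" for t q
    proof -
      have q: "q \<in> N" using that e1 by blast
      have *: "\<Phi> s q \<in> ball p r" "((\<lambda>s. \<Phi> s q) has_vector_derivative W (\<Phi> s q)) (at s)"
        if "s \<in> {-e1<..<e1}" for s
        using in1[OF that \<open>q \<in> ball p r1\<close>] der[OF q, of s] that e1 by auto
      have "0 \<in> {-e1<..<e1}" using e1(1) by auto
      then show ?thesis
        using stay[of "-e1" e1 "\<lambda>s. \<Phi> s q" 0 t, OF *] stay[of "-e1" e1 "\<lambda>s. \<Phi> s q" t 0, OF *]
          that(1) init[OF q] by auto
    qed
    let ?N = "E \<inter> ball p r1"
    have oN: "openin (top_of_set (E \<inter> A)) ?N"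
    proof -
      have "?N = (E \<inter> A) \<inter> ball p r1" using e1 N by blast
      then show ?thesis by (metis openin_open_Int open_ball)
    qed
    have oN': "openin (top_of_set E) ?N" by auto
    show "\<exists>e N \<Phi>. p \<in> N \<and> local_flow (E \<inter> A) W e N \<Phi> \<and>
        (\<forall>t\<in>{-e<..<e}. local_symmetry (E \<inter> A) ?D N (\<Phi> t))"
    proof (intro exI[of _ e1] exI[of _ ?N] exI[of _ \<Phi>] conjI ballI)
      show "p \<in> ?N" using p e1 by auto
      show "local_flow (E \<inter> A) W e1 ?N \<Phi>"
        unfolding local_flow_def
      proof (intro conjI ballI e1(1) oN)
        show "smooth_map_on ({- e1<..<e1} \<times> ?N) (\<lambda>(t, q). \<Phi> t q)"
          by (rule smooth_map_on_open[OF sm]) (use N e1 in \<open>auto simp: open_Times\<close>)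
        show "\<Phi> 0 q = q" if "q \<in> ?N" for q using that init e1 by blast
        show "\<Phi> t q \<in> E \<inter> A" if "q \<in> ?N" "t \<in> {- e1<..<e1}" for q t
          using that in1[of t q] E_iff[of t q] r by blast
        show "((\<lambda>s. \<Phi> s q) has_vector_derivative W (\<Phi> t q)) (at t)"
          if "q \<in> ?N" "t \<in> {- e1<..<e1}" for q t
          using that der[of q t] e1 by auto
      qed
      fix t assume t: "t \<in> {-e1<..<e1}"
      then have te: "t \<in> {-e<..<e}" using e1 by auto
      let ?f = "\<Phi> t"
      let ?g = "inv_into N ?f"
      have opf: "open (?f ` N)" "?f ` N \<subseteq> A"
        using sy[OF te] A unfolding local_symmetry_def by (auto simp: openin_open_eq)
      have inj: "inj_on ?f N" and smg: "smooth_on (?f ` N) ?g"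
        using sy[OF te] opf smooth_map_on_open_iff
        unfolding local_symmetry_def diffeomorphism_on_def bij_betw_def by auto
      have gf: "?g (?f q) = q" if "q \<in> N" for q using inj that by simp
      have smf: "smooth_on N ?f" by (rule smooth_on_slice[OF _ N(1) sm te]) simp
      have im: "?f ` ?N = E \<inter> (?g -` ball p r1 \<inter> ?f ` N)"
      proof
        show "?f ` ?N \<subseteq> E \<inter> (?g -` ball p r1 \<inter> ?f ` N)"
          using E_iff[OF t] gf e1 by auto
        show "E \<inter> (?g -` ball p r1 \<inter> ?f ` N) \<subseteq> ?f ` ?N"
        proof
          fix x assume x: "x \<in> E \<inter> (?g -` ball p r1 \<inter> ?f ` N)"
          then obtain q where "q \<in> N" "x = ?f q" by blast
          then show "x \<in> ?f ` ?N" using x gf[of q] E_iff[OF t, of q] by auto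
        qed
      qed
      have og: "open (?g -` ball p r1 \<inter> ?f ` N)"
        using smooth_on_continuous_on[OF smg] continuous_on_open_vimage[OF opf(1)] by blast
      show "local_symmetry (E \<inter> A) ?D ?N ?f"
        unfolding local_symmetry_def diffeomorphism_on_def preserves_distribution_def
      proof (intro conjI ballI)
        show "openin (top_of_set (E \<inter> A)) ?N" by (rule oN)
        show "openin (top_of_set (E \<inter> A)) (?f ` ?N)"
        proof -
          have "?f ` ?N = (E \<inter> A) \<inter> (?g -` ball p r1 \<inter> ?f ` N)" using im opf(2) by blast
          then show ?thesis by (metis openin_open_Int og)
        qed
        have injN: "inj_on ?f ?N" using inj by (rule inj_on_subset) (use e1 in blast)
        then show "bij_betw ?f ?N (?f ` ?N)" by (simp add: bij_betw_def)
        show "smooth_map_on ?N ?f" by (rule smooth_map_on_open[OF smf N(1)]) (use e1 in blast)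
        show "smooth_map_on (?f ` ?N) (inv_into ?N ?f)"
        proof (rule smooth_map_on_cong[of _ ?g])
          show "smooth_map_on (?f ` ?N) ?g" by (rule smooth_map_on_open[OF smg opf(1)]) (use e1 in blast)
          fix x assume "x \<in> ?f ` ?N"
          then obtain q where q: "q \<in> ?N" "x = ?f q" by blast
          then show "?g x = inv_into ?N ?f x" using inv_into_f_f[OF injN q(1)] gf[of q] e1 by auto
        qed
        fix q assume q: "q \<in> ?N"
        then have qN: "q \<in> N" using e1 by blast
        obtain L where L: "(?f has_derivative L) (at q within N)" "L ` ?C q = ?C (?f q)"
          using sy[OF te] qN unfolding local_symmetry_def preserves_distribution_def by blast
        have LN: "(?f has_derivative L) (at q within ?N)"
          by (rule has_derivative_subset[OF L(1)]) (use e1 in blast)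
        let ?K = "frechet_derivative ?g (at (?f q))"
        have dK: "(?g has_derivative ?K) (at (?f q))"
          using smooth_on_has_derivative[OF smg] qN by blast
        have L': "(?f has_derivative L) (at q)" using L(1) at_within_open[OF qN N(1)] by simp
        have KL: "?K (L w) = w" for w
        proof -
          from has_derivative_compose[OF L' dK]
          have "((\<lambda>x. x) has_derivative (\<lambda>w. ?K (L w))) (at q)"
            by (rule has_derivative_transform_within_open[OF _ N(1) qN]) (rule gf)
          from has_derivative_unique[OF this has_derivative_ident] show ?thesis by metis
        qed
        have "L ` ?D q = ?D (?f q)"
        proof
          have "?f ` ?N \<subseteq> E" using im by blast
          then show "L ` ?D q \<subseteq> ?D (?f q)"
            using tangent_space_image[OF oN' _ q LN] L(2) unfolding monge_distribution_def by blast
          show "?D (?f q) \<subseteq> L ` ?D q"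
          proof
            fix w assume w: "w \<in> ?D (?f q)"
            then obtain w0 where w0: "w0 \<in> ?C q" "w = L w0" using L(2) unfolding monge_distribution_def by blast
            have "?K w \<in> tangent_space E (?g (?f q))"
            proof (rule tangent_space_image[of "?f ` ?N" ?g "?f q" ?K w])
              show "openin (top_of_set E) (?f ` ?N)" using im og by auto
              show "?g ` (?f ` ?N) \<subseteq> E" using gf e1 by force
              show "?f q \<in> ?f ` ?N" using q by blast
              show "(?g has_derivative ?K) (at (?f q) within ?f ` ?N)"
                by (rule has_derivative_at_withinI[OF dK])
              show "w \<in> tangent_space E (?f q)" using w unfolding monge_distribution_def by blast
            qed
            then show "w \<in> L ` ?D q"
              using w0 KL[of w0] gf[OF qN] unfolding monge_distribution_def by auto
          qed
        qed
        then show "\<exists>L. (?f has_derivative L) (at q within ?N) \<and> L ` ?D q = ?D (?f q)" using LN by blast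
      qed
    qed
  qed
qed

end

section \<open>Directional derivatives\<close>

text \<open>The derivative of \<open>f\<close> at \<open>q\<close> in the direction \<open>w\<close>.\<close>

abbreviation dd :: "('a::real_normed_vector \<Rightarrow> 'b::real_normed_vector) \<Rightarrow> 'a \<Rightarrow> 'a \<Rightarrow> 'b" where
  "dd f w q \<equiv> frechet_derivative f (at q) w"

lemma frechet_derivative_eqI: "(f has_derivative f') (at x) \<Longrightarrow> frechet_derivative f (at x) = f'"
  using frechet_derivative_at by metis

lemma dd_zero_cong:
  assumes "open S" "x \<in> S" "\<And>y. y \<in> S \<Longrightarrow> f y = 0"
  shows "dd f w x = 0"
  using frechet_derivative_cong_open[OF assms(1,2), of f "\<lambda>_. 0"] assms(3) by simp

lemma dd_nth:
  assumes "smooth_on S f" "x \<in> S"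
  shows "dd (\<lambda>y. f y $ i) w x = dd f w x $ i"
  using frechet_derivative_eqI[OF bounded_linear.has_derivative[OF bounded_linear_vec_nth
        smooth_on_has_derivative[OF assms]], of i] by simp

lemma dd_mult:
  fixes f g :: "'a::real_normed_vector \<Rightarrow> real"
  assumes "smooth_on S f" "smooth_on S g" "x \<in> S"
  shows "dd (\<lambda>y. f y * g y) w x = f x * dd g w x + dd f w x * g x"
  using frechet_derivative_eqI[OF has_derivative_mult[OF smooth_on_has_derivative[OF assms(1,3)]
        smooth_on_has_derivative[OF assms(2,3)]]] by simp

lemma dd_add:
  assumes "smooth_on S f" "smooth_on S g" "x \<in> S"
  shows "dd (\<lambda>y. f y + g y) w x = dd f w x + dd g w x"
  using frechet_derivative_eqI[OF has_derivative_add[OF smooth_on_has_derivative[OF assms(1,3)]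
        smooth_on_has_derivative[OF assms(2,3)]]] by simp

lemma dd_diff:
  assumes "smooth_on S f" "smooth_on S g" "x \<in> S"
  shows "dd (\<lambda>y. f y - g y) w x = dd f w x - dd g w x"
  using frechet_derivative_eqI[OF has_derivative_diff[OF smooth_on_has_derivative[OF assms(1,3)]
        smooth_on_has_derivative[OF assms(2,3)]]] by simp

text \<open>Derivative of a function along a vector field, differentiated in a constant direction.\<close>

lemma dd_vector_field:
  fixes f :: "'a::euclidean_space \<Rightarrow> real"
  assumes S: "open S" and f: "smooth_on S f" and X: "smooth_on S X" and x: "x \<in> S"
  shows "dd (\<lambda>y. dd f (X y) y) h x = dd (dd f h) (X x) x + dd f (dd X h x) x"
proof -
  have rep: "dd g w y = (\<Sum>b\<in>Basis. (w \<bullet> b) * dd g b y)" if "smooth_on S g" "y \<in> S"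
    for g :: "'a \<Rightarrow> real" and w y
  proof -
    note lin = smooth_on_linear_derivative[OF that]
    have "dd g (\<Sum>b\<in>Basis. (w \<bullet> b) *\<^sub>R b) y = (\<Sum>b\<in>Basis. (w \<bullet> b) * dd g b y)"
      by (simp only: linear_sum[OF lin] linear_cmul[OF lin] real_scaleR_def)
    then show ?thesis by (simp add: euclidean_representation)
  qed
  have fb: "smooth_on S (dd f b)" for b by (rule smooth_on_derivative_const[OF f])
  have "dd (\<lambda>y. dd f (X y) y) h x = dd (\<lambda>y. \<Sum>b\<in>Basis. (X y \<bullet> b) * dd f b y) h x"
    by (subst frechet_derivative_cong_open[OF S x, of _ "\<lambda>y. \<Sum>b\<in>Basis. (X y \<bullet> b) * dd f b y"])
      (simp_all add: rep[OF f, symmetric])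
  also have "\<dots> = (\<Sum>b\<in>Basis. (X x \<bullet> b) * dd (dd f b) h x + (dd X h x \<bullet> b) * dd f b x)"
  proof -
    have "((\<lambda>y. \<Sum>b\<in>Basis. (X y \<bullet> b) * dd f b y) has_derivative
        (\<lambda>h. \<Sum>b\<in>Basis. (X x \<bullet> b) * dd (dd f b) h x + (dd X h x \<bullet> b) * dd f b x)) (at x)"
      by (intro has_derivative_sum has_derivative_mult has_derivative_inner_left
          smooth_on_has_derivative[OF fb x] smooth_on_has_derivative[OF X x])
    from frechet_derivative_eqI[OF this] show ?thesis by simp
  qed
  also have "\<dots> = (\<Sum>b\<in>Basis. (X x \<bullet> b) * dd (dd f h) b x) + (\<Sum>b\<in>Basis. (dd X h x \<bullet> b) * dd f b x)"
    using smooth_on_derivative_commute[OF S f x] by (simp add: sum.distrib)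
  also have "\<dots> = dd (dd f h) (X x) x + dd f (dd X h x) x"
    using rep[OF fb x, of h "X x"] rep[OF f x, of "dd X h x"] by simp
  finally show ?thesis .
qed

lemma has_vector_derivative_cart:
  fixes f :: "real \<Rightarrow> real ^ 'k"
  assumes "\<And>i. ((\<lambda>s. f s $ i) has_real_derivative f' $ i) (at t)"
  shows "(f has_vector_derivative f') (at t)"
proof -
  have "((\<lambda>s. f s \<bullet> b) has_derivative (\<lambda>r. (r *\<^sub>R f') \<bullet> b)) (at t)" if "b \<in> Basis" for b
  proof -
    obtain i where b: "b = axis i 1" using \<open>b \<in> Basis\<close> unfolding Basis_vec_def by auto
    show ?thesis using assms[of i]
      by (simp add: b inner_axis has_field_derivative_def mult_commute_abs)
  qed
  then show ?thesis
    unfolding has_vector_derivative_def using has_derivative_componentwise_within[of f _ t UNIV] by blast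
qed

lemma has_real_derivative_nth:
  "(f has_vector_derivative f') (at t) \<Longrightarrow> ((\<lambda>s. f s $ i) has_real_derivative f' $ i) (at t)"
  using bounded_linear.has_derivative[OF bounded_linear_vec_nth, of f "\<lambda>r. r *\<^sub>R f'" "at t" i]
  by (simp add: has_vector_derivative_def has_field_derivative_def mult_commute_abs)

section \<open>Total derivatives\<close>

context monge
begin

text \<open>The index of the variable \<open>x\<close>.\<close>

abbreviation xi :: 'k where "xi \<equiv> c JX"

text \<open>The shift \<open>y\<^sub>i \<mapsto> y\<^bsub>i+1\<^esub>\<close>, \<open>z\<^sub>j \<mapsto> z\<^bsub>j+1\<^esub>\<close> of coordinates. It is meaningful only at the indices of
  \<open>y\<^sub>i\<close> with \<open>i < m\<close> and \<open>z\<^sub>j\<close> with \<open>j < n\<close>, which are called \<open>mid\<close>. With it both chains of variables are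
  treated at once. The \<open>low\<close> coordinates are these and \<open>x\<close>.\<close>

definition nxt :: "'k \<Rightarrow> 'k" where
  "nxt i = c (case inv_into (jet_vars m n) c i of JX \<Rightarrow> JX | JY k \<Rightarrow> JY (Suc k) | JZ k \<Rightarrow> JZ (Suc k))"

abbreviation mid :: "'k \<Rightarrow> bool" where "mid i \<equiv> i \<noteq> xi \<and> i \<noteq> ym \<and> i \<noteq> zn"

abbreviation low :: "'k \<Rightarrow> bool" where "low i \<equiv> i \<noteq> ym \<and> i \<noteq> zn"

text \<open>The total derivative field on the jet space, without components along \<open>y\<^sub>m\<close> and \<open>z\<^sub>n\<close>. With these two
  directions it spans the Cartan distribution.\<close>

definition tot :: "real ^ 'k \<Rightarrow> real ^ 'k" where
  "tot q = (\<chi> i. if i = xi then 1 else if mid i then q $ nxt i else 0)"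

text \<open>The indices of \<open>y\<^bsub>m-1\<^esub>\<close> and \<open>z\<^bsub>n-1\<^esub>\<close>, for the arguments \<open>ym\<close> and \<open>zn\<close>.\<close>

definition prv :: "'k \<Rightarrow> 'k" where
  "prv i = (if i = ym then c (JY (m - 1)) else c (JZ (n - 1)))"

text \<open>The vector fields \<open>Z\<close> (\<open>bZ\<close>), \<open>Y\<close> (\<open>bY\<close>), \<open>D\<close> (\<open>dvec\<close>), \<open>X1\<close> and the functions \<open>F1\<close>, \<open>F2\<close>. The fields \<open>D\<close> and \<open>X1\<close> live on
  \<open>U\<close>; they act on functions pulled back from \<open>E\<close>, to which their \<open>y\<^sub>m\<close>-components do not matter, and
  these components are chosen to be zero.\<close>

abbreviation bZ :: "real ^ 'k" where "bZ \<equiv> axis zn 1"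
abbreviation bY :: "real ^ 'k" where "bY \<equiv> axis (prv ym) 1"
abbreviation dvec :: "real ^ 'k \<Rightarrow> real ^ 'k" where "dvec q \<equiv> tot (to_eq q)"
abbreviation F1 :: "real ^ 'k \<Rightarrow> real" where "F1 \<equiv> dd F bZ"
abbreviation F2 :: "real ^ 'k \<Rightarrow> real" where "F2 \<equiv> dd F1 bZ"

definition X1 :: "real ^ 'k \<Rightarrow> real ^ 'k" where
  "X1 q = axis (prv zn) 1 + F1 q *\<^sub>R bY"

lemma inv_label: "a \<in> jet_vars m n \<Longrightarrow> inv_into (jet_vars m n) c (c a) = a"
  using labelling unfolding jet_labelling_def bij_betw_def by simp

lemma nxt_label: "i < m \<Longrightarrow> nxt (c (JY i)) = c (JY (Suc i))" "j < n \<Longrightarrow> nxt (c (JZ j)) = c (JZ (Suc j))"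
  by (simp_all add: nxt_def inv_label)

lemma mid_cases:
  assumes "mid i"
  obtains k where "k < m" "i = c (JY k)" | k where "k < n" "i = c (JZ k)"
proof -
  obtain a where a: "a \<in> jet_vars m n" "i = c a" using label_cases .
  show thesis
  proof (cases a)
    case (JY k)
    then show thesis using a assms that(1)[of k] by (cases "k = m") auto
  next
    case (JZ k)
    then show thesis using a assms that(2)[of k] by (cases "k = n") auto
  qed (use a assms in auto)
qed

lemma n_pos: "0 < n" using m_pos m_le_n by simp

lemma prv_simps:
  "mid (prv i)" "nxt (prv ym) = ym" "nxt (prv zn) = zn" "prv zn \<noteq> prv ym"
  using m_pos n_pos nxt_label(1)[of "m - 1"] nxt_label(2)[of "n - 1"]
  by (auto simp: prv_def)

lemma nxt_eq: 
  assumes "mid i"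
  shows "nxt i = ym \<longleftrightarrow> i = prv ym" "nxt i = zn \<longleftrightarrow> i = prv zn" "nxt i \<noteq> xi"
  using mid_cases[OF assms] m_pos n_pos by (cases; auto simp: prv_def nxt_label)+

lemma cartan_iff: "w \<in> cartan m n c q \<longleftrightarrow> (\<forall>i. mid i \<longrightarrow> w $ i = q $ nxt i * w $ xi)"
proof
  assume "w \<in> cartan m n c q"
  then have "w $ c (JY k) = q $ c (JY (Suc k)) * w $ xi" "w $ c (JZ l) = q $ c (JZ (Suc l)) * w $ xi"
    if "k < m" "l < n" for k l using that unfolding cartan_def by auto
  then show "\<forall>i. mid i \<longrightarrow> w $ i = q $ nxt i * w $ xi"
    by (metis m_pos mid_cases n_pos nxt_label)
next
  assume *: "\<forall>i. mid i \<longrightarrow> w $ i = q $ nxt i * w $ xi"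
  have "w $ c (JY k) = q $ c (JY (Suc k)) * w $ xi" if "k < m" for k
    using *[rule_format, of "c (JY k)"] that by (simp add: nxt_label)
  moreover have "w $ c (JZ k) = q $ c (JZ (Suc k)) * w $ xi" if "k < n" for k
    using *[rule_format, of "c (JZ k)"] that by (simp add: nxt_label)
  ultimately show "w \<in> cartan m n c q" by (simp add: cartan_def)
qed

lemma tot_nth: "tot q $ i = (if i = xi then 1 else if mid i then q $ nxt i else 0)"
  by (simp add: tot_def)

lemma smooth_tot:
  assumes "open S" "smooth_on S f"
  shows "smooth_on S (\<lambda>q. tot (f q))"
proof (rule smooth_on_vec[OF assms(1)])
  show "smooth_on S (\<lambda>q. tot (f q) $ i)" for i
  proof (cases "mid i")
    case True
    then show ?thesis using smooth_on_nth[OF assms, of "nxt i"] by (simp add: tot_nth)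
  next
    case False
    then have "(\<lambda>q. tot (f q) $ i) = (\<lambda>q. if i = xi then 1 else 0)" by (auto simp: tot_nth)
    then show ?thesis using smooth_on_const by metis
  qed
qed

lemma dd_to_eq_nth:
  assumes "q \<in> U"
  shows "dd (\<lambda>q. to_eq q $ i) w q = (if i = ym then dd F w q else w $ i)"
proof -
  have "dd to_eq w q = w + (dd F w q - w $ ym) *\<^sub>R axis ym 1"
    using frechet_derivative_eqI[OF has_derivative_to_eq[OF assms]] by simp
  then show ?thesis using dd_nth[OF smooth_to_eq assms, of i w] by (simp add: axis_def)
qed

lemma smooth_dvec: "smooth_on U dvec"
  by (rule smooth_tot[OF open_U smooth_to_eq])

lemma dd_dvec_nth:
  assumes "q \<in> U"
  shows "dd dvec w q $ i = (if mid i then (if nxt i = ym then dd F w q else w $ nxt i) else 0)"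
proof -
  have "dd dvec w q $ i = dd (\<lambda>q. dvec q $ i) w q"
    using dd_nth[OF smooth_dvec assms] by simp
  also have "\<dots> = (if mid i then (if nxt i = ym then dd F w q else w $ nxt i) else 0)"
    by (cases "mid i") (auto simp: tot_nth dd_to_eq_nth[OF assms])
  finally show ?thesis .
qed

lemma dd_dvec_Z:
  assumes "q \<in> U"
  shows "dd dvec bZ q = X1 q"
  unfolding vec_eq_iff
proof
  fix i
  show "dd dvec bZ q $ i = X1 q $ i"
  proof (cases "mid i")
    case True
    then show ?thesis using prv_simps(4)
      by (auto simp: dd_dvec_nth[OF assms] X1_def axis_def nxt_eq(1,2)[OF True])
  next
    case False
    then have "i \<noteq> prv ym" "i \<noteq> prv zn" using prv_simps(1) by metis+
    then show ?thesis using False by (auto simp: dd_dvec_nth[OF assms] X1_def axis_def)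
  qed
qed

lemma dd_dvec_Y:
  assumes "q \<in> U" "m = 1"
  shows "dd dvec bY q = dd F bY q *\<^sub>R bY"
  unfolding vec_eq_iff
proof
  fix i
  have "prv ym = c (JY (m - 1))" by (simp add: prv_def)
  moreover have "m - 1 = 0" using assms(2) by simp
  ultimately have p: "prv ym = c (JY 0)" by simp
  show "dd dvec bY q $ i = (dd F bY q *\<^sub>R bY) $ i"
  proof (cases "mid i")
    case True
    have "nxt i \<noteq> prv ym" using mid_cases[OF True] by cases (simp_all add: p nxt_label)
    then show ?thesis using True
      by (auto simp: dd_dvec_nth[OF assms(1)] axis_def nxt_eq(1)[OF True])
  next
    case False
    then have "i \<noteq> prv ym" using prv_simps(1) by metis
    then show ?thesis using False by (auto simp: dd_dvec_nth[OF assms(1)] axis_def)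
  qed
qed

lemma smooth_X1: "smooth_on U X1"
  unfolding X1_def using open_U smooth_on_derivative_const[OF smooth_F]
  by (intro smooth_on_add smooth_on_scaleR smooth_on_const)

lemma dd_X1_Z: 
  assumes "q \<in> U"
  shows "dd X1 bZ q = F2 q *\<^sub>R bY"
proof -
  have "(X1 has_derivative (\<lambda>w. dd F1 w q *\<^sub>R bY)) (at q)"
    unfolding X1_def
    using smooth_on_has_derivative[OF smooth_on_derivative_const[OF smooth_F] assms]
    by (auto intro!: derivative_eq_intros)
  from frechet_derivative_eqI[OF this] show ?thesis by simp
qed

text \<open>The brackets \<open>[Z, D] = X1\<close>, \<open>[Z, X1] = F2 Y\<close> and \<open>[Z, b] = 0\<close> for constant fields \<open>b\<close>, applied to a
  function that \<open>Z\<close> annihilates.\<close>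

context
  fixes A f
  assumes A: "open A" "A \<subseteq> U" and f: "smooth_on A f" and Zf: "\<And>q. q \<in> A \<Longrightarrow> dd f bZ q = (0::real)"
begin

lemma Z_D: "q \<in> A \<Longrightarrow> dd (\<lambda>q. dd f (dvec q) q) bZ q = dd f (X1 q) q"
  using dd_vector_field[OF A(1) f smooth_on_subset[OF smooth_dvec A(2)], of q bZ]
    dd_zero_cong[OF A(1) _ Zf] dd_dvec_Z[of q] A(2) by auto

lemma Z_X1: 
  assumes "q \<in> A"
  shows "dd (\<lambda>q. dd f (X1 q) q) bZ q = F2 q * dd f bY q"
  using dd_vector_field[OF A(1) f smooth_on_subset[OF smooth_X1 A(2)] assms, of bZ]
    dd_zero_cong[OF A(1) assms Zf] dd_X1_Z[of q] A(2) assms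
    linear_cmul[OF smooth_on_linear_derivative[OF f assms]] by auto

lemma Z_const: "q \<in> A \<Longrightarrow> dd (dd f b) bZ q = 0"
  using smooth_on_derivative_commute[OF A(1) f, of q b bZ] dd_zero_cong[OF A(1) _ Zf] by simp

end

end

text \<open>Monge equations with \<open>F2 \<noteq> 0\<close>, the second derivative of \<open>F\<close> along \<open>z\<^sub>n\<close>, and without the two
  exceptional pairs of orders.\<close>

locale monge_nondeg = monge +
  assumes nondeg: "\<And>q. q \<in> U \<Longrightarrow> F2 q \<noteq> 0"
    and mn: "(m, n) \<noteq> (1, 1)" "(m, n) \<noteq> (1, 2)"
begin

lemma smooth_F1: "smooth_on U F1" by (rule smooth_on_derivative_const[OF smooth_F])

text \<open>The argument for \<open>m \<ge> 2\<close>, to be applied to \<open>f = \<phi>\<^bsub>m-2\<^esub>\<close> and \<open>g = \<psi>\<^bsub>n-2\<^esub>\<close>. Applying \<open>Z\<close> repeatedly to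
  \<open>X1 f = Z D f = F1 Z D g = F1 X1 g\<close> gives \<open>F2 Y f = F2 X1 g + F1 F2 Y g\<close>, hence \<open>Y f = X1 g + F1 Y g\<close>, and
  \<open>0 = 2 F2 Y g\<close>; this is twice \<open>Z Z D g\<close>.\<close>

lemma ZZ_zero_of_two_contact_chains:
  assumes A: "open A" "A \<subseteq> U" and f: "smooth_on A f" and g: "smooth_on A g"
    and Z: "\<And>q. q \<in> A \<Longrightarrow> dd f bZ q = (0::real)" "\<And>q. q \<in> A \<Longrightarrow> dd g bZ q = (0::real)"
    and D: "\<And>q. q \<in> A \<Longrightarrow> dd f (dvec q) q = f1 q" "\<And>q. q \<in> A \<Longrightarrow> dd g (dvec q) q = g1 q"
    and eq: "\<And>q. q \<in> A \<Longrightarrow> dd f1 bZ q = F1 q * dd g1 bZ q"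
    and q: "q \<in> A"
  shows "dd (dd g1 bZ) bZ q = 0"
proof -
  have F1: "smooth_on A F1" and X1: "smooth_on A X1"
    using smooth_F1 smooth_X1 A smooth_on_subset by blast+
  have nd: "F2 q \<noteq> 0" if "q \<in> A" for q using nondeg that A by blast
  have Zf1: "dd f1 bZ q = dd f (X1 q) q" if "q \<in> A" for q
    using Z_D[OF A f Z(1) that] frechet_derivative_cong_open[OF A(1) that D(1)] by simp
  have Zg1: "dd g1 bZ q = dd g (X1 q) q" if "q \<in> A" for q
    using Z_D[OF A g Z(2) that] frechet_derivative_cong_open[OF A(1) that D(2)] by simp
  have e1: "dd f (X1 q) q = F1 q * dd g (X1 q) q" if "q \<in> A" for q
    using eq[OF that] Zf1[OF that] Zg1[OF that] by simp
  have Xg: "smooth_on A (\<lambda>q. dd g (X1 q) q)" by (rule smooth_on_derivative[OF A(1) g X1])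
  have e2: "dd f bY q = dd g (X1 q) q + F1 q * dd g bY q" if "q \<in> A" for q
  proof -
    have "F2 q * dd f bY q = dd (\<lambda>q. F1 q * dd g (X1 q) q) bZ q"
      using Z_X1[OF A f Z(1) that] frechet_derivative_cong_open[OF A(1) that e1] by simp
    also have "\<dots> = F1 q * (F2 q * dd g bY q) + F2 q * dd g (X1 q) q"
      using dd_mult[OF F1 Xg that] Z_X1[OF A g Z(2) that] by simp
    also have "\<dots> = F2 q * (dd g (X1 q) q + F1 q * dd g bY q)" by (simp add: algebra_simps)
    finally show ?thesis using nd[OF that] by simp
  qed
  have e3: "dd g bY q = 0" if "q \<in> A" for q
  proof -
    note Yg = smooth_on_derivative_const[OF g, of bY]
    have "0 = dd (\<lambda>q. dd g (X1 q) q + F1 q * dd g bY q) bZ q"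
      using Z_const[OF A f Z(1) that, of bY] frechet_derivative_cong_open[OF A(1) that e2] by simp
    also have "\<dots> = F2 q * dd g bY q + (F1 q * 0 + F2 q * dd g bY q)"
      using dd_add[OF Xg smooth_on_mult[OF A(1) F1 Yg] that] dd_mult[OF F1 Yg that]
        Z_X1[OF A g Z(2) that] Z_const[OF A g Z(2) that, of bY] by simp
    finally show ?thesis using nd[OF that] by simp
  qed
  have "dd (dd g1 bZ) bZ q = F2 q * dd g bY q"
    using frechet_derivative_cong_open[OF A(1) q Zg1] Z_X1[OF A g Z(2) q] by simp
  then show ?thesis using e3[OF q] by simp
qed

text \<open>The argument for \<open>m = 1\<close>, to be applied to \<open>g = \<psi>\<^bsub>n-3\<^esub>\<close>. From \<open>X1 g = Z D g = 0\<close> follows \<open>F2 Y g = Z X1 g = 0\<close>,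
  then \<open>Y D g = [Y, D] g = 0\<close> because \<open>[Y, D]\<close> is a multiple of \<open>Y\<close> for \<open>m = 1\<close>, and finally
  \<open>Z Z D D g = Z X1 D g = F2 Y D g = 0\<close>.\<close>

lemma ZZ_zero_of_long_contact_chain:
  assumes m: "m = 1"
    and A: "open A" "A \<subseteq> U" and g: "smooth_on A g"
    and Z: "\<And>q. q \<in> A \<Longrightarrow> dd g bZ q = (0::real)" "\<And>q. q \<in> A \<Longrightarrow> dd g1 bZ q = 0"
    and D: "\<And>q. q \<in> A \<Longrightarrow> dd g (dvec q) q = g1 q" "\<And>q. q \<in> A \<Longrightarrow> dd g1 (dvec q) q = g2 q"
    and q: "q \<in> A"
  shows "dd (dd g2 bZ) bZ q = 0"
proof -
  have dv: "smooth_on A dvec" using smooth_dvec A smooth_on_subset by blast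
  have nd: "F2 q \<noteq> 0" if "q \<in> A" for q using nondeg that A by blast
  have g1: "smooth_on A g1"
    using smooth_on_cong[OF A(1), of "\<lambda>q. dd g (dvec q) q" g1] D(1) smooth_on_derivative[OF A(1) g dv] by simp
  have e1: "dd g (X1 q) q = 0" if "q \<in> A" for q
    using Z_D[OF A g Z(1) that] frechet_derivative_cong_open[OF A(1) that D(1)] Z(2)[OF that] by simp
  have e2: "dd g bY q = 0" if "q \<in> A" for q
  proof -
    have "dd (\<lambda>q. dd g (X1 q) q) bZ q = 0" by (rule dd_zero_cong[OF A(1) that e1])
    then show ?thesis using Z_X1[OF A g Z(1) that] nd[OF that] by simp
  qed
  have e3: "dd g1 bY q = 0" if "q \<in> A" for q
  proof -
    have "q \<in> U" using that A by blast
    have "dd g1 bY q = dd (\<lambda>q. dd g (dvec q) q) bY q"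
      using frechet_derivative_cong_open[OF A(1) that D(1)] by simp
    also have "\<dots> = dd (dd g bY) (dvec q) q + dd g (dd F bY q *\<^sub>R bY) q"
      using dd_vector_field[OF A(1) g dv that, of bY] dd_dvec_Y[OF \<open>q \<in> U\<close> m] by simp
    also have "\<dots> = 0"
      using dd_zero_cong[OF A(1) that e2] e2[OF that] linear_cmul[OF smooth_on_linear_derivative[OF g that]]
      by simp
    finally show ?thesis .
  qed
  have "dd g2 bZ q = dd g1 (X1 q) q" if "q \<in> A" for q
    using Z_D[OF A g1 Z(2) that] frechet_derivative_cong_open[OF A(1) that D(2)] by simp
  from frechet_derivative_cong_open[OF A(1) q this] Z_X1[OF A g1 Z(2) q]
  show ?thesis using e3[OF q] by simp
qed

text \<open>Since \<open>F\<close> is not affine in \<open>z\<^sub>n\<close>, a relation \<open>D f = k D h\<close> between functions independent of \<open>z\<^sub>n\<close>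
  splits into its coefficients: two derivatives along \<open>Z\<close> give \<open>Y f = k Y h\<close>, and the field \<open>tot\<close>
  differs from \<open>D\<close> by a multiple of \<open>Y\<close>.\<close>

lemma relation_along_tot:
  assumes A: "open A" "A \<subseteq> U" and sm: "smooth_on A f" "smooth_on A h" "smooth_on A k"
    and Z: "\<And>q. q \<in> A \<Longrightarrow> dd f bZ q = (0::real)" "\<And>q. q \<in> A \<Longrightarrow> dd h bZ q = (0::real)"
      "\<And>q. q \<in> A \<Longrightarrow> dd k bZ q = (0::real)"
    and D: "\<And>q. q \<in> A \<Longrightarrow> dd f (dvec q) q = k q * dd h (dvec q) q"
    and q: "q \<in> A"
  shows "dd f (tot q) q = k q * dd h (tot q) q"
proof -
  have dv: "smooth_on A dvec" and X1: "smooth_on A X1"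
    using smooth_dvec smooth_X1 A smooth_on_subset by blast+
  have e1: "dd f (X1 q) q = k q * dd h (X1 q) q" if "q \<in> A" for q
  proof -
    have "dd f (X1 q) q = dd (\<lambda>q. k q * dd h (dvec q) q) bZ q"
      using Z_D[OF A sm(1) Z(1) that] frechet_derivative_cong_open[OF A(1) that D] by simp
    then show ?thesis
      using dd_mult[OF sm(3) smooth_on_derivative[OF A(1) sm(2) dv] that] Z(3)[OF that]
        Z_D[OF A sm(2) Z(2) that] by simp
  qed
  have "F2 q * dd f bY q = dd (\<lambda>q. k q * dd h (X1 q) q) bZ q"
    using Z_X1[OF A sm(1) Z(1) q] frechet_derivative_cong_open[OF A(1) q e1] by simp
  also have "\<dots> = k q * (F2 q * dd h bY q)"
    using dd_mult[OF sm(3) smooth_on_derivative[OF A(1) sm(2) X1] q] Z(3)[OF q]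
      Z_X1[OF A sm(2) Z(2) q] by simp
  finally have e2: "dd f bY q = k q * dd h bY q" using nondeg[of q] A q by auto
  have tot: "tot q = dvec q + (q $ ym - F q) *\<^sub>R bY"
    unfolding vec_eq_iff
  proof
    fix i
    show "tot q $ i = (dvec q + (q $ ym - F q) *\<^sub>R bY) $ i"
    proof (cases "mid i")
      case True
      then show ?thesis by (auto simp: tot_nth to_eq_nth axis_def nxt_eq(1)[OF True] prv_simps(2))
    next
      case False
      then have "i \<noteq> prv ym" using prv_simps(1) by metis
      then show ?thesis using False by (auto simp: tot_nth axis_def)
    qed
  qed
  note lin = smooth_on_linear_derivative[OF sm(1) q] smooth_on_linear_derivative[OF sm(2) q]
  show ?thesis
    unfolding tot linear_add[OF lin(1)] linear_add[OF lin(2)] linear_cmul[OF lin(1)] linear_cmul[OF lin(2)]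
    using D[OF q] e2 by (simp add: algebra_simps)
qed

end

section \<open>The flow of an internal symmetry in jet coordinates\<close>

text \<open>The local situation for an internal symmetry \<open>v\<close> with flow \<open>\<Phi>\<close>. Both are defined on \<open>E\<close> only, and
  are pulled back by \<open>to_eq\<close> to an open set \<open>A\<close> of the jet space.\<close>

locale internal_flow = monge_nondeg m n c U F
  for m n :: nat and c :: "jet_var \<Rightarrow> 'k::finite" and U :: "(real ^ 'k) set" and F :: "real ^ 'k \<Rightarrow> real" +
  fixes v :: "real ^ 'k \<Rightarrow> real ^ 'k" and \<Phi> :: "real \<Rightarrow> real ^ 'k \<Rightarrow> real ^ 'k"
    and e :: real and A :: "(real ^ 'k) set"
  assumes e_pos: "0 < e" and open_A: "open A" and A_U: "A \<subseteq> U"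
    and smooth_flow: "smooth_on ({-e<..<e} \<times> A) (\<lambda>(t, q). \<Phi> t (to_eq q))"
    and smooth_field: "smooth_on A (\<lambda>q. v (to_eq q))"
    and flow_0: "\<And>q. q \<in> A \<Longrightarrow> \<Phi> 0 (to_eq q) = to_eq q"
    and flow_E: "\<And>t q. t \<in> {-e<..<e} \<Longrightarrow> q \<in> A \<Longrightarrow> \<Phi> t (to_eq q) \<in> E"
    and flow_eq: "\<And>t q. t \<in> {-e<..<e} \<Longrightarrow> q \<in> A \<Longrightarrow>
      ((\<lambda>s. \<Phi> s (to_eq q)) has_vector_derivative v (\<Phi> t (to_eq q))) (at t)"
    and flow_cartan: "\<And>t q w. t \<in> {-e<..<e} \<Longrightarrow> q \<in> A \<Longrightarrow> w \<in> {dvec q, bZ} \<Longrightarrow>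
      dd (\<lambda>q. \<Phi> t (to_eq q)) w q \<in> cartan m n c (\<Phi> t (to_eq q))"
begin

abbreviation I :: "real set" where "I \<equiv> {-e<..<e}"

text \<open>The pullbacks of the flow and of the symmetry.\<close>

definition psi :: "real \<Rightarrow> real ^ 'k \<Rightarrow> real ^ 'k" where "psi t q = \<Phi> t (to_eq q)"

definition vv :: "real ^ 'k \<Rightarrow> real ^ 'k" where "vv q = v (to_eq q)"

lemma zero_I: "0 \<in> I" using e_pos by simp

lemma smooth_vv: "smooth_on A vv" using smooth_field by (simp add: vv_def[abs_def])

lemma smooth_vv_nth: "smooth_on A (\<lambda>q. vv q $ i)"
  using smooth_on_nth[OF open_A smooth_vv] .

lemma smooth_psi: "smooth_on (I \<times> A) (\<lambda>(t, q). psi t q)"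
  using smooth_flow by (simp add: psi_def)

lemma smooth_psi_nth: "smooth_on (I \<times> A) (\<lambda>(t, q). psi t q $ i)"
  using smooth_on_nth[OF _ smooth_psi, of i] open_A by (simp add: case_prod_unfold open_Times)

lemma smooth_psi_slice: "t \<in> I \<Longrightarrow> smooth_on A (psi t)"
  by (rule smooth_on_slice[OF _ open_A smooth_psi]) simp

lemma smooth_psi_slice_nth: "t \<in> I \<Longrightarrow> smooth_on A (\<lambda>q. psi t q $ i)"
  using smooth_on_nth[OF open_A smooth_psi_slice] .

lemma psi_0: "q \<in> A \<Longrightarrow> psi 0 q = to_eq q"
  by (simp add: psi_def flow_0)

lemma psi_nth_derivative:
  "t \<in> I \<Longrightarrow> q \<in> A \<Longrightarrow> ((\<lambda>s. psi s q $ i) has_real_derivative v (psi t q) $ i) (at t)"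
  unfolding psi_def by (rule has_real_derivative_nth[OF flow_eq])

lemma v_psi: "t \<in> I \<Longrightarrow> q \<in> A \<Longrightarrow> v (psi t q) = vv (psi t q)"
  using flow_E by (simp add: vv_def psi_def to_eq_id)

lemma psi_cartan:
  assumes "t \<in> I" "q \<in> A" "w \<in> {dvec q, bZ}" "mid i"
  shows "dd (\<lambda>q. psi t q $ i) w q = psi t q $ nxt i * dd (\<lambda>q. psi t q $ xi) w q"
  using flow_cartan[OF assms(1-3)] assms(4) dd_nth[OF smooth_psi_slice[OF assms(1)] assms(2)]
  unfolding cartan_iff psi_def[abs_def] by simp

text \<open>The derivative of \<open>psi_cartan\<close> at time zero.\<close>

lemma infinitesimal_cartan:
  assumes q: "q \<in> A" and w: "w \<in> {dvec q, bZ}" and i: "mid i"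
  shows "dd (\<lambda>q. vv q $ i) w q = vv q $ nxt i * w $ xi + to_eq q $ nxt i * dd (\<lambda>q. vv q $ xi) w q"
proof -
  have td: "((\<lambda>s. dd (\<lambda>q. psi s q $ j) w q) has_real_derivative dd (\<lambda>q. vv q $ j) w q) (at 0)" for j
  proof -
    have "((\<lambda>s. dd (\<lambda>q. psi s q $ j) w q) has_real_derivative dd (\<lambda>q. v (psi 0 q) $ j) w q) (at 0)"
      by (rule time_derivative_of_slice_derivative[OF _ open_A smooth_psi_nth psi_nth_derivative zero_I q])
        auto
    moreover have "dd (\<lambda>q. v (psi 0 q) $ j) w q = dd (\<lambda>q. vv q $ j) w q"
      by (subst frechet_derivative_cong_open[OF open_A q, of _ "\<lambda>q. vv q $ j"])
        (simp_all add: psi_0 vv_def)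
    ultimately show ?thesis by simp
  qed
  have qU: "q \<in> U" using q A_U by blast
  have dx: "dd (\<lambda>q. psi 0 q $ xi) w q = w $ xi"
    using frechet_derivative_cong_open[OF open_A q, of "\<lambda>q. psi 0 q $ xi" "\<lambda>q. to_eq q $ xi"]
      dd_to_eq_nth[OF qU, of xi w] by (simp add: psi_0)
  have "((\<lambda>s. psi s q $ nxt i * dd (\<lambda>q. psi s q $ xi) w q) has_real_derivative
      v (psi 0 q) $ nxt i * dd (\<lambda>q. psi 0 q $ xi) w q + dd (\<lambda>q. vv q $ xi) w q * psi 0 q $ nxt i) (at 0)"
    by (rule DERIV_mult[OF psi_nth_derivative[OF zero_I q] td])
  then have "((\<lambda>s. psi s q $ nxt i * dd (\<lambda>q. psi s q $ xi) w q) has_real_derivative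
      vv q $ nxt i * w $ xi + to_eq q $ nxt i * dd (\<lambda>q. vv q $ xi) w q) (at 0)"
    by (simp add: psi_0 q vv_def dx[unfolded psi_0] mult.commute)
  then have "((\<lambda>s. dd (\<lambda>q. psi s q $ i) w q) has_real_derivative
      vv q $ nxt i * w $ xi + to_eq q $ nxt i * dd (\<lambda>q. vv q $ xi) w q) (at 0)"
    by (rule has_field_derivative_transform_within_open[of _ _ _ I])
      (use zero_I psi_cartan[OF _ q w i] in auto)
  from DERIV_unique[OF td this] show ?thesis .
qed

text \<open>The values on the symmetry of the contact forms \<open>dy\<^sub>i - y\<^bsub>i+1\<^esub> dx\<close> and \<open>dz\<^sub>j - z\<^bsub>j+1\<^esub> dx\<close>.\<close>

definition phi :: "'k \<Rightarrow> real ^ 'k \<Rightarrow> real" where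
  "phi i q = vv q $ i - to_eq q $ nxt i * vv q $ xi"

lemma smooth_to_eq_A: "smooth_on A (\<lambda>q. to_eq q $ i)"
  using smooth_on_nth[OF open_A smooth_on_subset[OF smooth_to_eq A_U]] .

lemma smooth_phi: "smooth_on A (phi i)"
  unfolding phi_def[abs_def] using open_A
  by (intro smooth_on_diff smooth_on_mult smooth_vv_nth smooth_to_eq_A)

lemma dd_phi:
  assumes q: "q \<in> A" and w: "w \<in> {dvec q, bZ}" and i: "mid i"
  shows "dd (phi i) w q = vv q $ nxt i * w $ xi -
    (if nxt i = ym then dd F w q else w $ nxt i) * vv q $ xi"
proof -
  have "dd (phi i) w q = dd (\<lambda>q. vv q $ i) w q -
      (to_eq q $ nxt i * dd (\<lambda>q. vv q $ xi) w q + dd (\<lambda>q. to_eq q $ nxt i) w q * vv q $ xi)"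
    unfolding phi_def[abs_def]
    using dd_diff[OF smooth_vv_nth smooth_on_mult[OF open_A smooth_to_eq_A smooth_vv_nth] q]
      dd_mult[OF smooth_to_eq_A smooth_vv_nth q] by simp
  then show ?thesis
    using infinitesimal_cartan[OF assms] dd_to_eq_nth[of q "nxt i" w] q A_U by auto
qed

lemma phi_D: "q \<in> A \<Longrightarrow> mid i \<Longrightarrow> mid (nxt i) \<Longrightarrow> dd (phi i) (dvec q) q = phi (nxt i) q"
  by (simp add: dd_phi phi_def tot_nth)

lemma phi_Z: "q \<in> A \<Longrightarrow> mid i \<Longrightarrow> dd (phi i) bZ q =
    (if nxt i = ym then - F1 q * vv q $ xi else if nxt i = zn then - vv q $ xi else 0)"
  by (simp add: dd_phi axis_def)

text \<open>The symmetry preserves the line field of \<open>Z\<close>. Both cases use \<open>\<xi> = - Z \<psi>\<^bsub>n-1\<^esub>\<close>.\<close>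

lemma Z_xi:
  assumes q: "q \<in> A"
  shows "dd (\<lambda>q. vv q $ xi) bZ q = 0"
proof -
  have zn': "prv zn = c (JZ (n - 1))" and ym': "prv ym = c (JY (m - 1))"
    by (simp_all add: prv_def)
  have e1: "dd (phi (prv zn)) bZ q = - vv q $ xi" if "q \<in> A" for q
    using phi_Z[OF that prv_simps(1), of zn] prv_simps(3) by simp
  have e2: "dd (phi (prv ym)) bZ q = - F1 q * vv q $ xi" if "q \<in> A" for q
    using phi_Z[OF that prv_simps(1), of ym] prv_simps(2) by simp
  have "dd (dd (phi (prv zn)) bZ) bZ q = 0"
  proof (cases "m = 1")
    case True
    then have n3: "n \<ge> 3" using mn m_le_n by (cases "n = 1"; cases "n = 2"; simp)
    define a b where "a = c (JZ (n - 3))" and "b = c (JZ (n - 2))"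
    have "Suc (n - 3) = n - 2" "Suc (n - 2) = n - 1" using n3 by auto
    then have ab: "nxt a = b" "nxt b = prv zn" "mid a" "mid b" "b \<noteq> ym" "b \<noteq> zn" "prv zn \<noteq> ym" "prv zn \<noteq> zn"
      using n3 nxt_label(2)[of "n - 3"] nxt_label(2)[of "n - 2"] by (simp_all add: a_def b_def zn')
    show ?thesis
    proof (rule ZZ_zero_of_long_contact_chain[OF True open_A A_U smooth_phi[of a] _ _ _ _ q])
      fix q assume q: "q \<in> A"
      show "dd (phi a) bZ q = 0" "dd (phi b) bZ q = 0" using q ab by (simp_all add: phi_Z)
      show "dd (phi a) (dvec q) q = phi b q" using phi_D[OF q ab(3)] ab by simp
      show "dd (phi b) (dvec q) q = phi (prv zn) q" using phi_D[OF q ab(4)] ab prv_simps(1)[of zn] by simp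
    qed
  next
    case False
    then have m2: "m \<ge> 2" "n \<ge> 2" using m_pos m_le_n by auto
    define a b where "a = c (JY (m - 2))" and "b = c (JZ (n - 2))"
    have "Suc (m - 2) = m - 1" "Suc (n - 2) = n - 1" using m2 by auto
    then have ab: "nxt a = prv ym" "nxt b = prv zn" "mid a" "mid b"
      using m2 nxt_label(1)[of "m - 2"] nxt_label(2)[of "n - 2"] by (simp_all add: a_def b_def zn' ym')
    have ne: "prv ym \<noteq> ym" "prv ym \<noteq> zn" "prv zn \<noteq> ym" "prv zn \<noteq> zn"
      using prv_simps(1)[of ym] prv_simps(1)[of zn] by auto
    show ?thesis
    proof (rule ZZ_zero_of_two_contact_chains[OF open_A A_U smooth_phi[of a] smooth_phi[of b] _ _ _ _ _ q])
      fix q assume q: "q \<in> A"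
      show "dd (phi a) bZ q = 0" "dd (phi b) bZ q = 0" using q ab ne by (simp_all add: phi_Z)
      show "dd (phi a) (dvec q) q = phi (prv ym) q" using phi_D[OF q ab(3)] ab prv_simps(1)[of ym] by simp
      show "dd (phi b) (dvec q) q = phi (prv zn) q" using phi_D[OF q ab(4)] ab prv_simps(1)[of zn] by simp
      show "dd (phi (prv ym)) bZ q = F1 q * dd (phi (prv zn)) bZ q"
        using e1[OF q] e2[OF q] by simp
    qed
  qed
  moreover have "dd (dd (phi (prv zn)) bZ) bZ q = dd (\<lambda>q. - vv q $ xi) bZ q"
    using frechet_derivative_cong_open[OF open_A q e1] by simp
  moreover have "dd (\<lambda>q. - vv q $ xi) bZ q = - dd (\<lambda>q. vv q $ xi) bZ q"
    using frechet_derivative_eqI[OF has_derivative_minus[OF smooth_on_has_derivative[OF smooth_vv_nth q]]]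
    by simp
  ultimately show ?thesis by simp
qed

lemma Z_vv:
  assumes q: "q \<in> A" and i: "low i"
  shows "dd (\<lambda>q. vv q $ i) bZ q = 0"
proof (cases "i = xi")
  case False
  then show ?thesis
    using infinitesimal_cartan[OF q, of bZ i] i Z_xi[OF q] by (simp add: axis_def)
qed (use Z_xi[OF q] in simp)

text \<open>Functions pulled back from \<open>E\<close> are constant along \<open>y\<^sub>m\<close>.\<close>

lemma dd_ym_zero:
  fixes f :: "real ^ 'k \<Rightarrow> real"
  assumes "smooth_on A f" "q \<in> A" "\<And>q. f q = g (to_eq q)"
  shows "dd f (axis ym 1) q = 0"
proof -
  have d: "((\<lambda>s. q + s *\<^sub>R axis ym 1) has_derivative (\<lambda>s. s *\<^sub>R axis ym 1)) (at 0)"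
    by (auto intro!: derivative_eq_intros)
  have "(f has_derivative frechet_derivative f (at q)) (at (q + 0 *\<^sub>R axis ym 1))"
    using smooth_on_has_derivative[OF assms(1,2)] by simp
  from has_derivative_compose[OF d this]
  have "((\<lambda>s. f (q + s *\<^sub>R axis ym 1)) has_derivative (\<lambda>s. dd f (s *\<^sub>R axis ym 1) q)) (at 0)" .
  moreover have "f (q + s *\<^sub>R axis ym 1) = f q" for s
  proof -
    have "q \<in> U" using assms(2) A_U by blast
    then have "F (q + s *\<^sub>R axis ym 1) = F q"
      by (rule U_F_invariant) (simp add: axis_def)
    then have "to_eq (q + s *\<^sub>R axis ym 1) = to_eq q" by (auto simp: vec_eq_iff to_eq_nth axis_def)
    then show ?thesis by (simp add: assms(3))
  qed
  ultimately have "((\<lambda>s. f q) has_derivative (\<lambda>s. dd f (s *\<^sub>R axis ym 1) q)) (at (0::real))" by simp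
  from has_derivative_unique[OF this has_derivative_const]
  have "dd f (1 *\<^sub>R axis ym 1) q = 0" by metis
  then show ?thesis by simp
qed

lemma ym_vv: "q \<in> A \<Longrightarrow> dd (\<lambda>q. vv q $ i) (axis ym 1) q = 0"
  by (rule dd_ym_zero[OF smooth_vv_nth, of _ _ "\<lambda>q. v q $ i"]) (simp_all add: vv_def)

lemma ym_psi: "t \<in> I \<Longrightarrow> q \<in> A \<Longrightarrow> dd (\<lambda>q. psi t q $ i) (axis ym 1) q = 0"
  by (rule dd_ym_zero[OF smooth_psi_slice_nth, of _ _ _ "\<lambda>q. \<Phi> t q $ i"]) (simp_all add: psi_def)

lemma dd_low_cong:
  fixes f :: "real ^ 'k \<Rightarrow> real"
  assumes "smooth_on A f" "q \<in> A" "dd f (axis ym 1) q = 0" "dd f bZ q = 0"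
    and "\<And>i. low i \<Longrightarrow> w $ i = w' $ i"
  shows "dd f w q = dd f w' q"
proof -
  note lin = smooth_on_linear_derivative[OF assms(1,2)]
  have "w = w' + (w $ ym - w' $ ym) *\<^sub>R axis ym 1 + (w $ zn - w' $ zn) *\<^sub>R bZ"
    using assms(5) by (auto simp: vec_eq_iff axis_def)
  then have "dd f w q = dd f (w' + (w $ ym - w' $ ym) *\<^sub>R axis ym 1 + (w $ zn - w' $ zn) *\<^sub>R bZ) q"
    by simp
  then show ?thesis
    unfolding linear_add[OF lin] linear_cmul[OF lin] using assms(3,4) by simp
qed

lemma dd_vv_cong:
  assumes "q \<in> A" "low i" "\<And>i. low i \<Longrightarrow> w $ i = w' $ i"
  shows "dd (\<lambda>q. vv q $ i) w q = dd (\<lambda>q. vv q $ i) w' q"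
  using dd_low_cong[OF smooth_vv_nth assms(1) ym_vv[OF assms(1)] Z_vv[OF assms(1,2)] assms(3)] .

lemma vv_low_eq:
  assumes B: "convex B" "B \<subseteq> A" and q: "q \<in> B" "q' \<in> B" and eq: "\<And>i. low i \<Longrightarrow> q' $ i = q $ i"
    and i: "low i"
  shows "vv q' $ i = vv q $ i"
proof -
  let ?f = "\<lambda>s. vv (q + s *\<^sub>R (q' - q)) $ i"
  have "\<exists>z::real. z > 0 \<and> z < 1 \<and> ?f 1 - ?f 0 = (1 - 0) * 0"
  proof (rule MVT2[of 0 1 ?f "\<lambda>_. 0"])
    fix s :: real assume s: "0 \<le> s" "s \<le> 1"
    have "q + s *\<^sub>R (q' - q) = (1 - s) *\<^sub>R q + s *\<^sub>R q'" by (simp add: algebra_simps)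
    then have inA: "q + s *\<^sub>R (q' - q) \<in> A"
      using convexD[OF B(1) q, of "1 - s" s] s B(2) by auto
    have d: "((\<lambda>s. q + s *\<^sub>R (q' - q)) has_derivative (\<lambda>s. s *\<^sub>R (q' - q))) (at s)"
      by (auto intro!: derivative_eq_intros)
    have z: "dd (\<lambda>q. vv q $ i) (r *\<^sub>R (q' - q)) (q + s *\<^sub>R (q' - q)) = 0" for r
      using dd_vv_cong[OF inA i, of "r *\<^sub>R (q' - q)" 0] eq
        linear_0[OF smooth_on_linear_derivative[OF smooth_vv_nth inA]] by simp
    from has_derivative_compose[OF d smooth_on_has_derivative[OF smooth_vv_nth[of i] inA]]
    have "(?f has_derivative (\<lambda>r. 0)) (at s)" by (simp only: z)
    moreover have "(\<lambda>r. 0) = (*) (0::real)" by auto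
    ultimately show "(?f has_real_derivative 0) (at s)" by (simp only: has_field_derivative_def)
  qed simp
  then show ?thesis by auto
qed

end

section \<open>Prolongation to the jet space\<close>

context internal_flow
begin

text \<open>The prolongation of the symmetry to the jet space: the \<open>low\<close> components are kept, and the components
  along \<open>y\<^sub>m\<close> and \<open>z\<^sub>n\<close> are given by the prolongation formula \<open>D \<eta> - y\<^sub>m D \<xi>\<close>, with the total derivative of
  the jet space instead of the one of the equation.\<close>

definition ext :: "real ^ 'k \<Rightarrow> real ^ 'k" where
  "ext q = (\<chi> i. if low i then vv q $ i
     else dd (\<lambda>q. vv q $ prv i) (tot q) q - q $ i * dd (\<lambda>q. vv q $ xi) (tot q) q)"

text \<open>The prolongation of the flow: its new \<open>y\<^sub>m\<close> and \<open>z\<^sub>n\<close> coordinates are the slopes of the image of the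
  total derivative, whose \<open>x\<close>-component is \<open>Q\<close>.\<close>

definition Q :: "real \<Rightarrow> real ^ 'k \<Rightarrow> real" where
  "Q t q = dd (\<lambda>q. psi t q $ xi) (tot q) q"

definition theta :: "real \<Rightarrow> real ^ 'k \<Rightarrow> real ^ 'k" where
  "theta t q = (\<chi> i. if low i then psi t q $ i else dd (\<lambda>q. psi t q $ prv i) (tot q) q / Q t q)"

lemma ext_high: "\<not> low i \<Longrightarrow>
    ext q $ i = dd (\<lambda>q. vv q $ prv i) (tot q) q - q $ i * dd (\<lambda>q. vv q $ xi) (tot q) q"
  by (auto simp: ext_def)

lemma theta_high: "\<not> low i \<Longrightarrow> theta t q $ i = dd (\<lambda>q. psi t q $ prv i) (tot q) q / Q t q"
  by (auto simp: theta_def)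

lemma prv_low: "\<not> low i \<Longrightarrow> mid (prv i) \<and> nxt (prv i) = i"
  using prv_simps by auto

lemma smooth_tot_A: "smooth_on A tot"
  using smooth_tot[OF open_A smooth_on_ident[OF open_A]] .

lemma smooth_ext: "smooth_on A ext"
proof (rule smooth_on_vec[OF open_A])
  fix i
  show "smooth_on A (\<lambda>q. ext q $ i)"
  proof (cases "low i")
    case True
    then show ?thesis using smooth_vv_nth by (simp add: ext_def)
  next
    case False
    have "smooth_on A (\<lambda>q. dd (\<lambda>q. vv q $ prv i) (tot q) q - q $ i * dd (\<lambda>q. vv q $ xi) (tot q) q)"
      using open_A by (intro smooth_on_diff smooth_on_mult smooth_on_derivative smooth_vv_nth smooth_tot_A
          smooth_on_nth smooth_on_ident)
    then show ?thesis by (simp only: ext_high[OF False])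
  qed
qed

lemma ext_eq:
  assumes q: "q \<in> A \<inter> E"
  shows "ext q = v q"
  unfolding vec_eq_iff
proof
  fix i
  have [simp]: "to_eq q = q" "vv q = v q" using q to_eq_id by (auto simp: vv_def)
  show "ext q $ i = v q $ i"
  proof (cases "low i")
    case False
    then have "mid (prv i)" "nxt (prv i) = i" using prv_low by auto
    then show ?thesis
      using infinitesimal_cartan[of q "tot q" "prv i"] q by (simp add: ext_high[OF False] tot_nth)
  qed (simp add: ext_def)
qed

lemma dd_psi_joint:
  assumes "t \<in> I" "q \<in> A"
  shows "dd (\<lambda>q. psi t q $ i) w q = dd (\<lambda>(t, q). psi t q $ i) (0, w) (t, q)"
proof -
  have "(Pair t has_derivative Pair 0) (at q)"
    by (auto intro!: derivative_eq_intros)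
  from has_derivative_compose[OF this smooth_on_has_derivative[OF smooth_psi_nth]] assms
  have "((\<lambda>q. (\<lambda>(t, q). psi t q $ i) (t, q)) has_derivative
      (\<lambda>w. dd (\<lambda>(t, q). psi t q $ i) (0, w) (t, q))) (at q)" by blast
  from frechet_derivative_eqI[OF this] show ?thesis by simp
qed

lemma open_IA: "open (I \<times> A)" using open_A by (simp add: open_Times)

lemma smooth_dd_psi: "smooth_on (I \<times> A) (\<lambda>(t, q). dd (\<lambda>q. psi t q $ i) (tot q) q)"
proof -
  have "smooth_on (I \<times> A) (\<lambda>z. tot (snd z))"
    by (rule smooth_tot[OF open_IA smooth_on_bounded_linear[OF open_IA bounded_linear_snd
            smooth_on_ident[OF open_IA]]])
  from smooth_on_Pair[OF open_IA smooth_on_const this]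
  have "smooth_on (I \<times> A) (\<lambda>z. (0, tot (snd z)))" .
  from smooth_on_derivative[OF open_IA smooth_psi_nth this]
  show ?thesis
    by (rule smooth_on_cong[OF open_IA, THEN iffD1, rotated]) (auto simp: dd_psi_joint)
qed

lemma Q_0: "q \<in> A \<Longrightarrow> Q 0 q = 1"
proof -
  assume q: "q \<in> A"
  then have "q \<in> U" using A_U by blast
  then show ?thesis unfolding Q_def
    using frechet_derivative_cong_open[OF open_A q, of "\<lambda>q. psi 0 q $ xi" "\<lambda>q. to_eq q $ xi"]
    by (simp add: psi_0 dd_to_eq_nth tot_nth)
qed

lemma theta_0:
  assumes q: "q \<in> A"
  shows "theta 0 q = q"
  unfolding vec_eq_iff
proof
  fix i
  have qU: "q \<in> U" using q A_U by blast
  show "theta 0 q $ i = q $ i"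
  proof (cases "low i")
    case True
    then show ?thesis by (simp add: theta_def psi_0 q to_eq_nth)
  next
    case False
    then have p: "mid (prv i)" "nxt (prv i) = i" using prv_low by auto
    have "dd (\<lambda>q. psi 0 q $ prv i) (tot q) q = q $ i"
      using frechet_derivative_cong_open[OF open_A q, of "\<lambda>q. psi 0 q $ prv i" "\<lambda>q. to_eq q $ prv i"] p
      by (simp add: psi_0 dd_to_eq_nth qU tot_nth)
    then show ?thesis by (simp add: theta_high[OF False] Q_0 q)
  qed
qed

end

text \<open>A domain in which the flow stays inside a convex set \<open>B\<close> on which the derivative of the field is
  bounded. Convexity makes functions with vanishing partial derivative along \<open>y\<^sub>m\<close> and \<open>z\<^sub>n\<close> independent
  of these variables.\<close>

locale internal_flow_in_convex = internal_flow m n c U F v \<Phi> e A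
  for m n :: nat and c :: "jet_var \<Rightarrow> 'k::finite" and U :: "(real ^ 'k) set" and F :: "real ^ 'k \<Rightarrow> real"
    and v \<Phi> e A +
  fixes B :: "(real ^ 'k) set" and e1 :: real and A1 :: "(real ^ 'k) set" and C :: real
  assumes convex_B: "convex B" and B_A: "B \<subseteq> A"
    and bound: "\<And>q h. q \<in> B \<Longrightarrow> norm (dd vv h q) \<le> C * norm h"
    and e1: "0 < e1" "e1 \<le> e" and open_A1: "open A1" and A1_A: "A1 \<subseteq> A"
    and psi_B: "\<And>t q. t \<in> {-e1<..<e1} \<Longrightarrow> q \<in> A1 \<Longrightarrow> psi t q \<in> B"
begin

abbreviation I1 :: "real set" where "I1 \<equiv> {-e1<..<e1}"

lemma I1_I: "I1 \<subseteq> I" using e1 by auto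

text \<open>The variational equation along the flow: \<open>Z\<close>-derivatives of the low coordinates of the flow
  solve a linear homogeneous system, because the low components of the field do not depend on
  the other coordinates.\<close>

lemma Z_psi:
  assumes q: "q \<in> A1" and t: "t \<in> I1" and i: "low i"
  shows "dd (\<lambda>q. psi t q $ i) bZ q = 0"
proof -
  define u where "u s = (\<chi> i. if low i then dd (\<lambda>q. psi s q $ i) bZ q else 0)" for s
  define u' where "u' s = (\<chi> i. if low i then dd (\<lambda>q. v (psi s q) $ i) bZ q else 0)" for s
  have qA: "q \<in> A" using q A1_A by blast
  have "u t = 0"
  proof (rule gronwall_zero[of "-e1" e1 u u' C 0])
    fix s assume s: "s \<in> {-e1<..<e1}"
    then have sI: "s \<in> I" using I1_I by blast
    show "(u has_vector_derivative u' s) (at s)"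
    proof (rule has_vector_derivative_cart)
      fix j
      show "((\<lambda>s. u s $ j) has_real_derivative u' s $ j) (at s)"
      proof (cases "low j")
        case True
        have "((\<lambda>s. dd (\<lambda>q. psi s q $ j) bZ q) has_real_derivative dd (\<lambda>q. v (psi s q) $ j) bZ q) (at s)"
          by (rule time_derivative_of_slice_derivative[OF _ open_A smooth_psi_nth psi_nth_derivative sI qA])
            auto
        then show ?thesis using True by (simp add: u_def u'_def)
      qed (auto simp: u_def u'_def)
    qed
    have inB: "psi s q \<in> B" using psi_B s q by blast
    then have inA: "psi s q \<in> A" using B_A by blast
    have comp: "dd (\<lambda>q. v (psi s q) $ j) bZ q = dd vv (u s) (psi s q) $ j" if "low j" for j
    proof -
      have "dd (\<lambda>q. v (psi s q) $ j) bZ q = dd (\<lambda>q. vv (psi s q) $ j) bZ q"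
        using frechet_derivative_cong_open[OF open_A qA, of "\<lambda>q. v (psi s q) $ j" "\<lambda>q. vv (psi s q) $ j"]
          v_psi[OF sI] by simp
      also have "\<dots> = dd (\<lambda>q. vv q $ j) (dd (psi s) bZ q) (psi s q)"
        using frechet_derivative_eqI[OF has_derivative_compose[OF
              smooth_on_has_derivative[OF smooth_psi_slice[OF sI] qA]
              smooth_on_has_derivative[OF smooth_vv_nth inA]]] by simp
      also have "\<dots> = dd (\<lambda>q. vv q $ j) (u s) (psi s q)"
        by (rule dd_vv_cong[OF inA that])
          (simp add: u_def dd_nth[OF smooth_psi_slice[OF sI] qA])
      also have "\<dots> = dd vv (u s) (psi s q) $ j" by (rule dd_nth[OF smooth_vv inA])
      finally show ?thesis .
    qed
    have "norm (u' s) \<le> norm (dd vv (u s) (psi s q))"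
      by (rule norm_le_componentwise_cart) (simp add: u'_def comp)
    also have "\<dots> \<le> C * norm (u s)" by (rule bound[OF inB])
    finally show "norm (u' s) \<le> C * norm (u s)" .
  next
    have "dd (\<lambda>q. psi 0 q $ j) bZ q = 0" if "low j" for j
      using frechet_derivative_cong_open[OF open_A qA, of "\<lambda>q. psi 0 q $ j" "\<lambda>q. to_eq q $ j"] that
        dd_to_eq_nth[of q j bZ] qA A_U by (auto simp: psi_0 axis_def)
    then show "u 0 = 0" by (auto simp: vec_eq_iff u_def)
  qed (use e1 t in auto)
  then have "u t $ i = 0" by simp
  then show ?thesis using i by (simp add: u_def)
qed

lemma psi_cartan_tot:
  assumes q: "q \<in> A1" and t: "t \<in> I1" and i: "mid i" and nz: "low (nxt i)"
  shows "dd (\<lambda>q. psi t q $ i) (tot q) q = psi t q $ nxt i * Q t q"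
proof -
  have tI: "t \<in> I" using t I1_I by blast
  have sm: "smooth_on A1 (\<lambda>q. psi t q $ j)" for j
    by (rule smooth_on_subset[OF smooth_psi_slice_nth[OF tI] A1_A])
  show ?thesis unfolding Q_def
  proof (rule relation_along_tot[OF open_A1 _ sm sm sm _ _ _ _ q])
    fix q assume q: "q \<in> A1"
    show "dd (\<lambda>q. psi t q $ i) bZ q = 0" "dd (\<lambda>q. psi t q $ xi) bZ q = 0"
      "dd (\<lambda>q. psi t q $ nxt i) bZ q = 0" using Z_psi[OF q t] i nz by auto
    show "dd (\<lambda>q. psi t q $ i) (dvec q) q = psi t q $ nxt i * dd (\<lambda>q. psi t q $ xi) (dvec q) q"
      using psi_cartan[OF tI _ _ i, of q "dvec q"] q A1_A by blast
  qed (use A1_A A_U in blast)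
qed

text \<open>The flow maps total derivatives to multiples of total derivatives: for the coordinates \<open>y\<^bsub>m-1\<^esub>\<close> and
  \<open>z\<^bsub>n-1\<^esub>\<close> this is the definition of \<open>theta\<close>, for the others it is \<open>psi_cartan_tot\<close>.\<close>

lemma dd_psi_tot:
  assumes q: "q \<in> A1" and t: "t \<in> I1" and i: "low i" and nz: "Q t q \<noteq> 0"
  shows "dd (\<lambda>q. psi t q $ i) (tot q) q = Q t q * tot (theta t q) $ i"
proof (cases "i = xi")
  case True
  then show ?thesis by (simp add: Q_def tot_nth)
next
  case False
  then have m: "mid i" using i by simp
  show ?thesis
  proof (cases "low (nxt i)")
    case True
    then show ?thesis using psi_cartan_tot[OF q t m True] m by (simp add: tot_nth theta_def)
  next
    case n: False
    then have "i = prv (nxt i)" using nxt_eq[OF m] by auto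
    then have "dd (\<lambda>q. psi t q $ prv (nxt i)) (tot q) q = dd (\<lambda>q. psi t q $ i) (tot q) q" by simp
    then show ?thesis using m nz by (simp add: tot_nth theta_high[OF n])
  qed
qed

lemma dd_psi_cartan:
  assumes q: "q \<in> A1" and t: "t \<in> I1" and i: "low i" and nz: "Q t q \<noteq> 0"
    and w: "w \<in> cartan m n c q"
  shows "dd (\<lambda>q. psi t q $ i) w q = w $ xi * Q t q * tot (theta t q) $ i"
proof -
  have tI: "t \<in> I" and qA: "q \<in> A" using t I1_I q A1_A by blast+
  have "dd (\<lambda>q. psi t q $ i) w q = dd (\<lambda>q. psi t q $ i) (w $ xi *\<^sub>R tot q) q"
  proof (rule dd_low_cong[OF smooth_psi_slice_nth[OF tI] qA ym_psi[OF tI qA] Z_psi[OF q t i]])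
    fix j assume "low j"
    then show "w $ j = (w $ xi *\<^sub>R tot q) $ j"
      using w unfolding cartan_iff by (cases "j = xi") (auto simp: tot_nth)
  qed
  also have "\<dots> = w $ xi * dd (\<lambda>q. psi t q $ i) (tot q) q"
    using linear_cmul[OF smooth_on_linear_derivative[OF smooth_psi_slice_nth[OF tI] qA]] by simp
  finally show ?thesis using dd_psi_tot[OF q t i nz] by simp
qed

text \<open>A smaller domain, on which the prolonged flow is defined and stays inside \<open>B\<close>.\<close>

context
  fixes e2 :: real and A2 :: "(real ^ 'k) set"
  assumes e2: "0 < e2" "e2 \<le> e1" and open_A2: "open A2" and A2_A1: "A2 \<subseteq> A1"
    and Q_nz: "\<And>t q. t \<in> {-e2<..<e2} \<Longrightarrow> q \<in> A2 \<Longrightarrow> Q t q \<noteq> 0"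
    and theta_B: "\<And>t q. t \<in> {-e2<..<e2} \<Longrightarrow> q \<in> A2 \<Longrightarrow> theta t q \<in> B"
begin

lemma A2_A: "A2 \<subseteq> A" using A2_A1 A1_A by blast

lemma I2_I: "{-e2<..<e2} \<subseteq> I" "{-e2<..<e2} \<subseteq> I1" using e1 e2 by auto

lemma open_IA2: "open ({-e2<..<e2} \<times> A2)" using open_A2 by (simp add: open_Times)

lemma smooth_theta: "smooth_on ({-e2<..<e2} \<times> A2) (\<lambda>(t, q). theta t q)"
proof (rule smooth_on_vec[OF open_IA2])
  fix i
  have sub: "{-e2<..<e2} \<times> A2 \<subseteq> I \<times> A" using I2_I A2_A by (intro Sigma_mono) auto
  show "smooth_on ({-e2<..<e2} \<times> A2) (\<lambda>z. (case z of (t, q) \<Rightarrow> theta t q) $ i)"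
  proof (cases "low i")
    case True
    then show ?thesis using smooth_on_subset[OF smooth_psi_nth sub, of i]
      by (simp add: theta_def case_prod_unfold)
  next
    case False
    have "smooth_on ({-e2<..<e2} \<times> A2) (\<lambda>z. (case z of (t, q) \<Rightarrow> dd (\<lambda>q. psi t q $ prv i) (tot q) q) /
        (case z of (t, q) \<Rightarrow> Q t q))"
      using open_IA2 smooth_on_subset[OF smooth_dd_psi sub] Q_nz
      by (intro smooth_on_divide) (auto simp: Q_def)
    then show ?thesis by (simp add: theta_high[OF False] case_prod_unfold)
  qed
qed

lemma smooth_theta_slice: "t \<in> {-e2<..<e2} \<Longrightarrow> smooth_on A2 (theta t)"
  by (rule smooth_on_slice[OF _ open_A2 smooth_theta]) simp

text \<open>The flow and its prolongation agree in the \<open>low\<close> coordinates, on which alone the \<open>low\<close> components of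
  the field depend.\<close>

lemma v_psi_theta:
  assumes q: "q \<in> A2" and t: "t \<in> {-e2<..<e2}" and i: "low i"
  shows "v (psi t q) $ i = vv (theta t q) $ i"
proof -
  have "vv (theta t q) $ i = vv (psi t q) $ i"
  proof (rule vv_low_eq[OF convex_B B_A _ theta_B[OF t q] _ i])
    show "psi t q \<in> B" using psi_B t q I2_I A2_A1 by blast
  qed (simp add: theta_def)
  moreover have "v (psi t q) = vv (psi t q)" using v_psi[of t q] q t A2_A I2_I by blast
  ultimately show ?thesis by simp
qed

lemma dd_theta_low:
  assumes q: "q \<in> A2" and t: "t \<in> {-e2<..<e2}" and i: "low i"
  shows "dd (theta t) w q $ i = dd (\<lambda>q. psi t q $ i) w q"
  using dd_nth[OF smooth_theta_slice[OF t] q, of i w] i by (simp add: theta_def)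

lemma time_derivative_dd_psi:
  assumes q: "q \<in> A2" and t: "t \<in> {-e2<..<e2}" and i: "low i"
  shows "((\<lambda>s. dd (\<lambda>q. psi s q $ i) (tot q) q) has_real_derivative
    Q t q * dd (\<lambda>q. vv q $ i) (tot (theta t q)) (theta t q)) (at t)"
proof -
  have tI: "t \<in> I" and tI1: "t \<in> I1" and qA: "q \<in> A" and qA1: "q \<in> A1"
    using t I2_I q A2_A A2_A1 by blast+
  have th: "theta t q \<in> A" using theta_B[OF t q] B_A by blast
  have "dd (\<lambda>q. v (psi t q) $ i) (tot q) q = dd (\<lambda>q. vv (theta t q) $ i) (tot q) q"
    using frechet_derivative_cong_open[OF open_A2 q, of "\<lambda>q. v (psi t q) $ i" "\<lambda>q. vv (theta t q) $ i"]
      v_psi_theta[OF _ t i] by simp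
  also have "\<dots> = dd (\<lambda>q. vv q $ i) (dd (theta t) (tot q) q) (theta t q)"
    using frechet_derivative_eqI[OF has_derivative_compose[OF
          smooth_on_has_derivative[OF smooth_theta_slice[OF t] q]
          smooth_on_has_derivative[OF smooth_vv_nth th]]] by simp
  also have "\<dots> = dd (\<lambda>q. vv q $ i) (Q t q *\<^sub>R tot (theta t q)) (theta t q)"
    by (rule dd_vv_cong[OF th i])
      (simp add: dd_theta_low[OF q t] dd_psi_tot[OF qA1 tI1 _ Q_nz[OF t q]])
  also have "\<dots> = Q t q * dd (\<lambda>q. vv q $ i) (tot (theta t q)) (theta t q)"
    using linear_cmul[OF smooth_on_linear_derivative[OF smooth_vv_nth th]] by simp
  finally have eq: "dd (\<lambda>q. v (psi t q) $ i) (tot q) q =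
    Q t q * dd (\<lambda>q. vv q $ i) (tot (theta t q)) (theta t q)" .
  show ?thesis unfolding eq[symmetric]
    by (rule time_derivative_of_slice_derivative[OF _ open_A smooth_psi_nth psi_nth_derivative tI qA]) auto
qed

lemma theta_flow:
  assumes q: "q \<in> A2" and t: "t \<in> {-e2<..<e2}"
  shows "((\<lambda>s. theta s q) has_vector_derivative ext (theta t q)) (at t)"
proof (rule has_vector_derivative_cart)
  fix i
  show "((\<lambda>s. theta s q $ i) has_real_derivative ext (theta t q) $ i) (at t)"
  proof (cases "low i")
    case True
    have "t \<in> I" "q \<in> A" using q t A2_A I2_I by blast+
    from psi_nth_derivative[OF this, of i] v_psi_theta[OF q t True]
    show ?thesis using True by (simp add: theta_def ext_def)
  next
    case False
    have low: "low (prv i)" "low xi" using prv_simps(1)[of i] by auto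
    let ?P = "\<lambda>s. dd (\<lambda>q. psi s q $ prv i) (tot q) q"
    let ?a = "\<lambda>j. dd (\<lambda>q. vv q $ j) (tot (theta t q)) (theta t q)"
    note nz = Q_nz[OF t q]
    have "((\<lambda>s. ?P s / Q s q) has_real_derivative
        ((Q t q * ?a (prv i)) * Q t q - ?P t * (Q t q * ?a xi)) / (Q t q * Q t q)) (at t)"
      using DERIV_divide[OF time_derivative_dd_psi[OF q t low(1)]
          time_derivative_dd_psi[OF q t low(2), folded Q_def] nz] .
    moreover have "((Q t q * ?a (prv i)) * Q t q - ?P t * (Q t q * ?a xi)) / (Q t q * Q t q)
        = ?a (prv i) - theta t q $ i * ?a xi"
      using nz by (simp add: theta_high[OF False] field_simps)
    moreover have "ext (theta t q) $ i = ?a (prv i) - theta t q $ i * ?a xi"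
      by (rule ext_high[OF False])
    moreover have "(\<lambda>s. theta s q $ i) = (\<lambda>s. ?P s / Q s q)"
      by (simp only: theta_high[OF False])
    ultimately show ?thesis by simp
  qed
qed

lemma theta_cartan:
  assumes q: "q \<in> A2" and t: "t \<in> {-e2<..<e2}" and w: "w \<in> cartan m n c q"
  shows "dd (theta t) w q \<in> cartan m n c (theta t q)"
  unfolding cartan_iff
proof (intro allI impI)
  fix i assume i: "mid i"
  have t1: "q \<in> A1" "t \<in> I1" using q t A2_A1 I2_I by blast+
  have *: "dd (theta t) w q $ j = w $ xi * Q t q * tot (theta t q) $ j" if "low j" for j
    using dd_theta_low[OF q t that] dd_psi_cartan[OF t1 that Q_nz[OF t q] w] by simp
  show "dd (theta t) w q $ i = theta t q $ nxt i * dd (theta t) w q $ xi"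
    using *[of i] *[of xi] i by (simp add: tot_nth)
qed

lemma ext_infinitesimal_symmetry: "infinitesimal_symmetry A2 (cartan m n c) ext"
  by (rule infinitesimal_symmetry_of_flow[OF e2(1) open_A2 smooth_on_subset[OF smooth_ext A2_A] smooth_theta])
    (use theta_0 A2_A theta_flow theta_cartan in auto)

end

end

context internal_flow
begin

lemma exists_extension:
  assumes p: "p \<in> A" "p \<in> E"
  shows "\<exists>A2. open A2 \<and> p \<in> A2 \<and> A2 \<subseteq> A \<and> infinitesimal_symmetry A2 (cartan m n c) ext"
proof -
  have psi_p: "psi 0 p = p" using psi_0 to_eq_id p by simp
  obtain r C where r: "r > 0" "cball p r \<subseteq> A"
    and bd: "\<And>x h. x \<in> cball p r \<Longrightarrow> norm (dd vv h x) \<le> C * norm h"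
    using smooth_on_locally_bounded_derivative[OF open_A smooth_vv p(1)] by metis
  obtain e1 r1 where e1: "e1 > 0" "r1 > 0" "e1 \<le> e" "ball p r1 \<subseteq> A"
    and in1: "\<And>t q. t \<in> {-e1<..<e1} \<Longrightarrow> q \<in> ball p r1 \<Longrightarrow> psi t q \<in> ball p r"
    using flow_neighbourhood[OF e_pos open_A p(1) smooth_on_continuous_on[OF smooth_psi] psi_p
        open_ball[of p r]] r by auto
  interpret S: internal_flow_in_convex m n c U F v \<Phi> e A "ball p r" e1 "ball p r1" C
    by unfold_locales (use r bd e1 in1 in auto)
  let ?X = "(\<lambda>(t, q). Q t q) -` (-{0}) \<inter> (I \<times> A)"
  have "open ?X"
    using smooth_on_continuous_on[OF smooth_dd_psi[of xi]]
    by (subst (asm) continuous_on_open_vimage[OF open_IA]) (auto simp: Q_def)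
  moreover have "(0, p) \<in> ?X" using Q_0 p zero_I by auto
  ultimately obtain e3 r3 where e3: "e3 > 0" "r3 > 0" "{-e3<..<e3} \<times> ball p r3 \<subseteq> ?X"
    using open_interval_times_neighbourhood by blast
  define e4 r4 where "e4 = min e1 e3" and "r4 = min r1 r3"
  have nz: "Q t q \<noteq> 0" if "t \<in> {-e4<..<e4}" "q \<in> ball p r4" for t q
  proof -
    have "(t, q) \<in> {-e3<..<e3} \<times> ball p r3" using that by (auto simp: e4_def r4_def)
    from subsetD[OF e3(3) this] show ?thesis by simp
  qed
  have pos: "e4 > 0" "r4 > 0" "e4 \<le> e1" "ball p r4 \<subseteq> ball p r1" "ball p r4 \<subseteq> A"
    using e1 e3 by (auto simp: e4_def r4_def)
  have sub: "{-e4<..<e4} \<times> ball p r4 \<subseteq> I \<times> A" using pos e1 by (intro Sigma_mono) auto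
  have cont: "continuous_on ({-e4<..<e4} \<times> ball p r4) (\<lambda>(t, q). theta t q)"
  proof (rule continuous_on_componentwise[THEN iffD2], rule ballI)
    fix b :: "real ^ 'k" assume "b \<in> Basis"
    then obtain i where b: "b = axis i 1" unfolding Basis_vec_def by auto
    note c1 = continuous_on_subset[OF smooth_on_continuous_on[OF smooth_dd_psi] sub]
    show "continuous_on ({-e4<..<e4} \<times> ball p r4) (\<lambda>z. (case z of (t, q) \<Rightarrow> theta t q) \<bullet> b)"
    proof (cases "low i")
      case True
      then show ?thesis using continuous_on_subset[OF smooth_on_continuous_on[OF smooth_psi_nth] sub, of i]
        by (simp add: b inner_axis theta_def case_prod_unfold)
    next
      case False
      have "continuous_on ({-e4<..<e4} \<times> ball p r4)
          (\<lambda>z. (case z of (t, q) \<Rightarrow> dd (\<lambda>q. psi t q $ prv i) (tot q) q) / (case z of (t, q) \<Rightarrow> Q t q))"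
        using c1[of "prv i"] c1[of xi] nz by (intro continuous_on_divide) (auto simp: Q_def)
      then show ?thesis by (simp add: b inner_axis theta_high[OF False] case_prod_unfold)
    qed
  qed
  obtain e5 r5 where e5: "e5 > 0" "r5 > 0" "e5 \<le> e4" "ball p r5 \<subseteq> ball p r4"
    and in5: "\<And>t q. t \<in> {-e5<..<e5} \<Longrightarrow> q \<in> ball p r5 \<Longrightarrow> theta t q \<in> ball p r"
    using flow_neighbourhood[OF pos(1) open_ball[of p r4] _ cont theta_0[OF p(1)] open_ball[of p r]]
      r(1) pos(2) by auto
  have "infinitesimal_symmetry (ball p r5) (cartan m n c) ext"
  proof (rule S.ext_infinitesimal_symmetry[of e5])
    show "Q t q \<noteq> 0" if "t \<in> {-e5<..<e5}" "q \<in> ball p r5" for t q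
      using nz[of t q] that e5 by auto
  qed (use e5 pos in5 in auto)
  then show ?thesis using e5 pos by (intro exI[of _ "ball p r5"]) auto
qed

end

section \<open>Internal symmetries extend to external symmetries\<close>

context monge_nondeg
begin

text \<open>An internal symmetry provides the local situation described by \<open>internal_flow\<close>. The condition on the
  derivatives of the flow is inherited from the tangent vectors \<open>D\<close> and \<open>Z\<close> of \<open>E\<close>, where the derivative
  within \<open>E\<close> is determined.\<close>

lemma internal_symmetry_flow:
  assumes "internal_symmetry m n c E V v" and p: "p \<in> V"
  shows "\<exists>e A \<Phi>. internal_flow m n c U F v \<Phi> e A \<and> p \<in> A \<and> (\<forall>q\<in>A. to_eq q \<in> V)"
proof -
  let ?D = "monge_distribution m n c E"
  obtain O1 where O1: "open O1" "V = E \<inter> O1"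
    using assms unfolding internal_symmetry_def openin_open by blast
  have sym: "infinitesimal_symmetry V ?D v" using assms unfolding internal_symmetry_def by blast
  then have "smooth_map_on V v" unfolding infinitesimal_symmetry_def vector_field_on_def by blast
  then obtain Bv gv where Bv: "open Bv" "p \<in> Bv" "smooth_on Bv gv" "\<forall>q\<in>V \<inter> Bv. v q = gv q"
    using p unfolding smooth_map_on_def by blast
  obtain e N \<Phi> where pN: "p \<in> N" and flow: "local_flow V v e N \<Phi>"
    and sy: "\<And>t. t \<in> {-e<..<e} \<Longrightarrow> local_symmetry V ?D N (\<Phi> t)"
    using sym p unfolding infinitesimal_symmetry_def by blast
  have e: "0 < e" using flow unfolding local_flow_def by blast
  obtain O2 where O2: "open O2" "N = V \<inter> O2" using flow unfolding local_flow_def openin_open by blast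
  have "(0, p) \<in> {-e<..<e} \<times> N" using e pN by auto
  then obtain Bf g where Bf: "open Bf" "(0, p) \<in> Bf" "smooth_on Bf g"
    "\<forall>z\<in>({-e<..<e} \<times> N) \<inter> Bf. (\<lambda>(t, q). \<Phi> t q) z = g z"
    using flow unfolding local_flow_def smooth_map_on_def by blast
  obtain e0 r0 where e0: "e0 > 0" "r0 > 0" "{-e0<..<e0} \<times> ball p r0 \<subseteq> Bf"
    using open_interval_times_neighbourhood[OF Bf(1,2)] by blast
  define e' where "e' = min e e0"
  define G where "G = O1 \<inter> O2 \<inter> Bv \<inter> ball p r0"
  have oG: "open G" using O1 O2 Bv by (auto simp: G_def)
  define A where "A = to_eq -` G \<inter> U"
  have e': "e' > 0" "{-e'<..<e'} \<subseteq> {-e<..<e}" "{-e'<..<e'} \<subseteq> {-e0<..<e0}" using e e0 by (auto simp: e'_def)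
  have AU: "A \<subseteq> U" by (auto simp: A_def)
  have oA: "open A"
    unfolding A_def
    using smooth_on_continuous_on[OF smooth_to_eq] continuous_on_open_vimage[OF open_U] oG by blast
  have pE: "p \<in> E" using p O1 by blast
  have pA: "p \<in> A" using pE E_subset_U to_eq_id[OF pE] p pN O1 O2 Bv e0 by (auto simp: A_def G_def)
  have inN: "to_eq q \<in> N" "to_eq q \<in> V" "to_eq q \<in> Bv" "to_eq q \<in> ball p r0" if "q \<in> A" for q
    using that to_eq_in[of q] O1 O2 by (auto simp: A_def G_def)
  have sE: "smooth_on A to_eq" by (rule smooth_on_subset[OF smooth_to_eq AU])
  have "internal_flow m n c U F v \<Phi> e' A"
  proof (unfold_locales)
    show "0 < e'" "open A" "A \<subseteq> U" by fact+
    show "smooth_on ({-e'<..<e'} \<times> A) (\<lambda>(t, q). \<Phi> t (to_eq q))"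
    proof -
      let ?T = "{-e'<..<e'} \<times> A"
      have oT: "open ?T" using oA by (simp add: open_Times)
      note id = smooth_on_ident[OF oT]
      have "smooth_on ?T (\<lambda>z. to_eq (snd z))"
        by (rule smooth_on_compose[OF oT oA _ smooth_on_bounded_linear[OF oT bounded_linear_snd id] sE]) auto
      then have "smooth_on ?T (\<lambda>z. (fst z, to_eq (snd z)))"
        by (rule smooth_on_Pair[OF oT smooth_on_bounded_linear[OF oT bounded_linear_fst id]])
      moreover have img: "(\<lambda>z. (fst z, to_eq (snd z))) ` ?T \<subseteq> Bf"
        using inN(4) e' e0(3) by fastforce
      ultimately have "smooth_on ?T (\<lambda>z. g (fst z, to_eq (snd z)))"
        using smooth_on_compose[OF oT Bf(1) _ _ Bf(3)] by blast
      then show ?thesis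
      proof (rule smooth_on_cong[OF oT, THEN iffD1, rotated])
        fix z assume z: "z \<in> ?T"
        then have "(fst z, to_eq (snd z)) \<in> ({-e<..<e} \<times> N) \<inter> Bf" using inN(1) e' img by auto
        then show "g (fst z, to_eq (snd z)) = (case z of (t, q) \<Rightarrow> \<Phi> t (to_eq q))"
          using Bf(4) by (force simp: case_prod_unfold)
      qed
    qed
    show "smooth_on A (\<lambda>q. v (to_eq q))"
    proof -
      have "smooth_on A (\<lambda>q. gv (to_eq q))"
        by (rule smooth_on_compose[OF oA Bv(1) _ sE Bv(3)]) (use inN in auto)
      then show ?thesis
        by (rule smooth_on_cong[OF oA, THEN iffD1, rotated]) (use Bv(4) inN in auto)
    qed
    show "\<Phi> 0 (to_eq q) = to_eq q" if "q \<in> A" for q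
      using flow inN(1)[OF that] unfolding local_flow_def by blast
    show "\<Phi> t (to_eq q) \<in> E" if "t \<in> {-e'<..<e'}" "q \<in> A" for t q
      using flow inN(1)[OF that(2)] that(1) e'(2) O1(2) unfolding local_flow_def by blast
    show "((\<lambda>s. \<Phi> s (to_eq q)) has_vector_derivative v (\<Phi> t (to_eq q))) (at t)"
      if "t \<in> {-e'<..<e'}" "q \<in> A" for t q
      using flow inN(1)[OF that(2)] that(1) e'(2) unfolding local_flow_def by blast
    fix t q w assume t: "t \<in> {-e'<..<e'}" and q: "q \<in> A" and w: "w \<in> {dvec q, bZ}"
    have qU: "q \<in> U" using q AU by blast
    obtain L where L: "(\<Phi> t has_derivative L) (at (to_eq q) within N)"
      "L ` ?D (to_eq q) = ?D (\<Phi> t (to_eq q))"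
      using sy[of t] t e'(2) inN(1)[OF q] unfolding local_symmetry_def preserves_distribution_def by blast
    have dE: "(to_eq has_derivative frechet_derivative to_eq (at q)) (at q)"
      by (rule smooth_on_has_derivative[OF sE q])
    have nth: "dd to_eq w q $ i = (if i = ym then dd F w q else w $ i)" for i
      using dd_nth[OF sE q, of i w] dd_to_eq_nth[OF qU, of i w] by simp
    have "dd to_eq w q \<in> cartan m n c (to_eq q)"
      unfolding cartan_iff using w by (auto simp: nth tot_nth axis_def)
    moreover have "dd to_eq w q \<in> tangent_space E (to_eq q)"
    proof -
      have "((\<lambda>q. F (to_eq q)) has_derivative (\<lambda>w. dd F (dd to_eq w q) (to_eq q))) (at q)"
        by (rule has_derivative_compose[OF dE smooth_on_has_derivative[OF smooth_F to_eq_U(1)[OF qU]]])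
      then have "(F has_derivative (\<lambda>w. dd F (dd to_eq w q) (to_eq q))) (at q)"
        by (rule has_derivative_transform_within_open[OF _ open_U qU]) (rule to_eq_U(2))
      from frechet_derivative_eqI[OF this] have "dd F w q = dd F (dd to_eq w q) (to_eq q)" by metis
      then show ?thesis using tangent_space_E[OF to_eq_in[OF qU]] by (simp add: nth)
    qed
    ultimately have "dd to_eq w q \<in> ?D (to_eq q)" by (simp add: monge_distribution_def)
    then have "L (dd to_eq w q) \<in> cartan m n c (\<Phi> t (to_eq q))"
      using L(2) unfolding monge_distribution_def by blast
    moreover have "((\<lambda>q. \<Phi> t (to_eq q)) has_derivative (\<lambda>w. L (dd to_eq w q))) (at q)"
    proof -
      have "(\<Phi> t has_derivative L) (at (to_eq q) within to_eq ` A)"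
        by (rule has_derivative_subset[OF L(1)]) (use inN in auto)
      from has_derivative_in_compose[OF has_derivative_at_withinI[OF dE] this]
      show ?thesis using at_within_open[OF q oA] by simp
    qed
    ultimately show "dd (\<lambda>q. \<Phi> t (to_eq q)) w q \<in> cartan m n c (\<Phi> t (to_eq q))"
      using frechet_derivative_eqI by metis
  qed
  then show ?thesis using pA inN(2) by blast
qed

lemma internal_symmetry_extends:
  assumes int: "internal_symmetry m n c E V v" and p: "p \<in> V"
  shows "\<exists>W A. p \<in> A \<and> external_symmetry m n c E A W \<and> (\<forall>q\<in>E \<inter> A. W q = v q)"
proof -
  obtain e A \<Phi> where fl: "internal_flow m n c U F v \<Phi> e A" and pA: "p \<in> A"
    and V: "\<And>q. q \<in> A \<Longrightarrow> to_eq q \<in> V"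
    using internal_symmetry_flow[OF assms] by blast
  interpret internal_flow m n c U F v \<Phi> e A by (rule fl)
  have VE: "V \<subseteq> E" using int unfolding internal_symmetry_def by (meson openin_imp_subset)
  obtain A2 where A2: "open A2" "p \<in> A2" "A2 \<subseteq> A" "infinitesimal_symmetry A2 (cartan m n c) ext"
    using exists_extension[OF pA] p VE by blast
  have eq: "ext q = v q" if "q \<in> E \<inter> A2" for q using ext_eq that A2 by blast
  have "ext q \<in> tangent_space E q" if q: "q \<in> E \<inter> A2" for q
  proof -
    have "q \<in> V" using V[of q] to_eq_id[of q] q A2 by auto
    then have "v q \<in> tangent_space V q"
      using int unfolding internal_symmetry_def infinitesimal_symmetry_def vector_field_on_def by blast
    moreover have "tangent_space V q \<subseteq> tangent_space E q"
      unfolding tangent_space_def using VE by (auto elim!: eventually_mono)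
    ultimately show ?thesis using eq[OF q] by auto
  qed
  then have "external_symmetry m n c E A2 ext"
    using A2 unfolding external_symmetry_def infinitesimal_lie_transformation_def by blast
  then show ?thesis using A2 eq by blast
qed

end

theorem theorem2:
  fixes m n :: nat
    and c :: "jet_var \<Rightarrow> 'k::finite"
    and U :: "(real ^ 'k) set"
    and F :: "real ^ 'k \<Rightarrow> real"
    and p :: "real ^ 'k"
  assumes "0 < m" and "m \<le> n"
    and "(m, n) \<noteq> (1, 1)" and "(m, n) \<noteq> (1, 2)"
    and "jet_labelling m n c"
    and "monge_rhs m n c U F"
    and "\<And>p. p \<in> U \<Longrightarrow> partial_deriv (partial_deriv F (c (JZ n))) (c (JZ n)) p \<noteq> 0"
    and "p \<in> monge_eq m c U F"
  shows "internal_symmetry_algebra m n c (monge_eq m c U F) p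
       = external_symmetry_algebra m n c (monge_eq m c U F) p"
proof -
  interpret monge_nondeg m n c U F
    using assms by unfold_locales (auto simp: partial_deriv_def[abs_def])
  show ?thesis
  proof
    show "internal_symmetry_algebra m n c (monge_eq m c U F) p
        \<subseteq> external_symmetry_algebra m n c (monge_eq m c U F) p"
    proof
      fix g assume "g \<in> internal_symmetry_algebra m n c (monge_eq m c U F) p"
      then obtain v V where g: "g = germ_on E p v" "p \<in> V" "internal_symmetry m n c E V v"
        unfolding internal_symmetry_algebra_def by blast
      obtain W A where W: "p \<in> A" "external_symmetry m n c E A W" "\<forall>q\<in>E \<inter> A. W q = v q"
        using internal_symmetry_extends[OF g(3,2)] by blast
      have "open A"
        using W(2) unfolding external_symmetry_def infinitesimal_lie_transformation_def by blast
      then have "\<forall>\<^sub>F q in nhds p. q \<in> A" using W(1) eventually_nhds by blast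
      then have "\<forall>\<^sub>F q in nhds p. (q \<in> E \<longrightarrow> w q = v q) \<longleftrightarrow> (q \<in> E \<longrightarrow> w q = W q)" for w
        by (rule eventually_mono) (use W(3) in auto)
      then have "germ_on E p v = germ_on E p W"
        unfolding germ_on_def by (intro Collect_cong eventually_subst)
      then show "g \<in> external_symmetry_algebra m n c (monge_eq m c U F) p"
        unfolding external_symmetry_algebra_def using g(1) W by blast
    qed
    show "external_symmetry_algebra m n c (monge_eq m c U F) p
        \<subseteq> internal_symmetry_algebra m n c (monge_eq m c U F) p"
      unfolding external_symmetry_algebra_def internal_symmetry_algebra_def
      using external_symmetry_internal assms(8) by blast
  qed
qed

end
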